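(* For every instance $\mathcal I$ of the heterogeneous data-center right-sizing problem and every $\epsilon\in(0,1)$, a feasible schedule whose cost is at most $(1+\epsilon)$ times the cost of an optimal schedule can be computed in time $\mathcal O\big(T\cdot\epsilon^{-d}\cdot\prod_{j=1}^d\log m_j\big)$.
   Context: Notation: $[k]=\{1,\dots,k\}$, $[k]_0=\{0,\dots,k\}$, $(x)^+=\max(x,0)$. Problem: An instance consists of $T\in\mathbb N$ time slots, $d\in\mathbb N$ server types, numbers $m_1,\dots,m_d\in\mathbb N$ of servers of each type, switching costs $\beta_j>0$, capacities $z^{\max}_j>0$, job volumes $\lambda_t\ge 0$, and operating cost functions $f_{t,j}$ ($t\in[T]$, $j\in[d]$) that are convex, increasing and non-negative on $[0,z^{\max}_j]$ (value $+\infty$ for loads above $z^{\max}_j$). For $x\in\mathbb N_0$, $z\in[0,1]$ put $g_{t,j}(x,z)=x f_{t,j}(\lambda_t z/x)$ if $x>0$, $g_{t,j}(0,z)=\infty$ if $\lambda_t z>0$, $g_{t,j}(0,z)=0$ if $\lambda_t z=0$. Let $\mathcal Z=\{(z_1,\dots,z_d)\in[0,1]^d:\sum_j z_j=1\}$ and $g_t(x_1,\dots,x_d)=\min_{z\in\mathcal Z}\sum_j g_{t,j}(x_j,z_j)$. A schedule is $X=(\vec x_1,\dots,\vec x_T)$, $x_{t,j}\in[m_j]_0$, with $\vec x_0=\vec x_{T+1}=\vec 0$; feasible if also $\sum_j x_{t,j}z^{\max}_j\ge\lambda_t$ for all $t$. Cost: $C(X)=\sum_{t=1}^T\big(g_t(\vec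 x_t)+\sum_j\beta_j(x_{t,j}-x_{t-1,j})^+\big)$. Running time is measured counting each evaluation of $g_t$ and each arithmetic operation as unit cost.
   Formalization: Each factor log m_j is read as max(1, log_2 m_j), since for m_j = 1 the literal bound would be zero steps; the O-constant may depend on d; and the claim is made for instances that admit a feasible schedule. *)

theory Defs
  imports "HOL-Analysis.Analysis"
begin

section \<open>The right-sizing problem\<close>

text \<open>Time slots and server types are indexed from 1; values of the component functions at other
  indices are irrelevant.  The operating cost is real-valued and only meaningful on
  \<open>[0, capacity j]\<close>; the value \<open>\<infinity>\<close> beyond the capacity is added in \<open>load_cost\<close>.\<close>

record dc_instance =
  slots :: nat
  types :: nat
  servers :: "nat \<Rightarrow> nat"
  switch_cost :: "nat \<Rightarrow> real"
  capacity :: "nat \<Rightarrow> real"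
  volume :: "nat \<Rightarrow> real"
  op_cost :: "nat \<Rightarrow> nat \<Rightarrow> real \<Rightarrow> real"

definition valid_instance :: "dc_instance \<Rightarrow> bool" where
  "valid_instance I \<longleftrightarrow>
     1 \<le> slots I \<and> 1 \<le> types I \<and>
     (\<forall>j\<in>{1..types I}. 1 \<le> servers I j \<and> 0 < switch_cost I j \<and> 0 < capacity I j) \<and>
     (\<forall>t\<in>{1..slots I}. 0 \<le> volume I t) \<and>
     (\<forall>t\<in>{1..slots I}. \<forall>j\<in>{1..types I}.
        convex_on {0..capacity I j} (op_cost I t j) \<and>
        mono_on {0..capacity I j} (op_cost I t j) \<and>
        (\<forall>z\<in>{0..capacity I j}. 0 \<le> op_cost I t j z))"

definition load_cost :: "dc_instance \<Rightarrow> nat \<Rightarrow> nat \<Rightarrow> real \<Rightarrow> ereal" where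
  "load_cost I t j z = (if z \<le> capacity I j then ereal (op_cost I t j z) else \<infinity>)"

definition type_cost :: "dc_instance \<Rightarrow> nat \<Rightarrow> nat \<Rightarrow> nat \<Rightarrow> real \<Rightarrow> ereal" where
  "type_cost I t j x z =
     (if x > 0 then ereal (real x) * load_cost I t j (volume I t * z / real x)
      else if volume I t * z > 0 then \<infinity> else 0)"

definition splits :: "dc_instance \<Rightarrow> (nat \<Rightarrow> real) set" where
  "splits I = {z. (\<forall>j\<in>{1..types I}. z j \<in> {0..1}) \<and> (\<Sum>j=1..types I. z j) = 1}"

text \<open>The infimum is the minimum whenever the latter exists.  A convex increasing function
  may jump at the right end of its domain, in which case no minimum need exist.\<close>

definition slot_cost :: "dc_instance \<Rightarrow> nat \<Rightarrow> (nat \<Rightarrow> nat) \<Rightarrow> ereal" where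
  "slot_cost I t x = (INF z\<in>splits I. \<Sum>j=1..types I. type_cost I t j (x j) (z j))"

definition is_schedule :: "dc_instance \<Rightarrow> (nat \<Rightarrow> nat \<Rightarrow> nat) \<Rightarrow> bool" where
  "is_schedule I X \<longleftrightarrow>
     (\<forall>t\<in>{1..slots I}. \<forall>j\<in>{1..types I}. X t j \<le> servers I j) \<and>
     (\<forall>j\<in>{1..types I}. X 0 j = 0 \<and> X (slots I + 1) j = 0)"

definition feasible_schedule :: "dc_instance \<Rightarrow> (nat \<Rightarrow> nat \<Rightarrow> nat) \<Rightarrow> bool" where
  "feasible_schedule I X \<longleftrightarrow>
     is_schedule I X \<and>
     (\<forall>t\<in>{1..slots I}. (\<Sum>j=1..types I. real (X t j) * capacity I j) \<ge> volume I t)"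

definition schedule_cost :: "dc_instance \<Rightarrow> (nat \<Rightarrow> nat \<Rightarrow> nat) \<Rightarrow> ereal" where
  "schedule_cost I X =
     (\<Sum>t=1..slots I. slot_cost I t (X t) +
        ereal (\<Sum>j=1..types I. switch_cost I j * max (real (X t j) - real (X (t - 1) j)) 0))"

definition optimal_schedule :: "dc_instance \<Rightarrow> (nat \<Rightarrow> nat \<Rightarrow> nat) \<Rightarrow> bool" where
  "optimal_schedule I X \<longleftrightarrow>
     feasible_schedule I X \<and>
     (\<forall>Y. feasible_schedule I Y \<longrightarrow> schedule_cost I X \<le> schedule_cost I Y)"

section \<open>Computation model\<close>

text \<open>Programs for a random access machine with unit-cost arithmetic on natural and real numbers.
  Memory is organised in named arrays of naturals and of reals; scalars live in cell 0 of an
  array.  A program is a finite syntactic object independent of the input, and the only numeric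
  constants are naturals, so no information about an instance (or any non-computable real) can be
  hidden in it.  Subtraction on naturals is truncated, and there is no rounding of reals.\<close>

type_synonym vname = string

record mem =
  nats :: "vname \<Rightarrow> nat \<Rightarrow> nat"
  reals :: "vname \<Rightarrow> nat \<Rightarrow> real"

datatype nexp =
    NConst nat
  | NRead vname nexp
  | NAdd nexp nexp
  | NSub nexp nexp
  | NMul nexp nexp

datatype rexp =
    RNat nexp
  | RRead vname nexp
  | RAdd rexp rexp
  | RSub rexp rexp
  | RMul rexp rexp
  | RDiv rexp rexp

datatype bexp =
    NLess nexp nexp
  | RLess rexp rexp
  | BNot bexp
  | BAnd bexp bexp

text \<open>\<open>Eval y i t a b\<close> queries the operating cost of slot \<open>t\<close> at the configuration
  stored in cells \<open>b + 1, \<dots>, b + d\<close> of the array \<open>a\<close> and stores the answer in \<open>y[i]\<close>.\<close>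

datatype com =
    Skip
  | NAssign vname nexp nexp
  | RAssign vname nexp rexp
  | Eval vname nexp nexp vname nexp
  | Seq com com
  | If bexp com com
  | While bexp com

fun nval :: "nexp \<Rightarrow> mem \<Rightarrow> nat" where
  "nval (NConst n) s = n"
| "nval (NRead a e) s = nats s a (nval e s)"
| "nval (NAdd e1 e2) s = nval e1 s + nval e2 s"
| "nval (NSub e1 e2) s = nval e1 s - nval e2 s"
| "nval (NMul e1 e2) s = nval e1 s * nval e2 s"

fun rval :: "rexp \<Rightarrow> mem \<Rightarrow> real" where
  "rval (RNat e) s = real (nval e s)"
| "rval (RRead a e) s = reals s a (nval e s)"
| "rval (RAdd e1 e2) s = rval e1 s + rval e2 s"
| "rval (RSub e1 e2) s = rval e1 s - rval e2 s"
| "rval (RMul e1 e2) s = rval e1 s * rval e2 s"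
| "rval (RDiv e1 e2) s = rval e1 s / rval e2 s"

fun bval :: "bexp \<Rightarrow> mem \<Rightarrow> bool" where
  "bval (NLess e1 e2) s \<longleftrightarrow> nval e1 s < nval e2 s"
| "bval (RLess e1 e2) s \<longleftrightarrow> rval e1 s < rval e2 s"
| "bval (BNot b) s \<longleftrightarrow> \<not> bval b s"
| "bval (BAnd b1 b2) s \<longleftrightarrow> bval b1 s \<and> bval b2 s"

text \<open>Every constant, memory access, arithmetic operation, conversion, comparison and connective
  costs one unit.\<close>

fun ntime :: "nexp \<Rightarrow> nat" where
  "ntime (NConst n) = 1"
| "ntime (NRead a e) = 1 + ntime e"
| "ntime (NAdd e1 e2) = 1 + ntime e1 + ntime e2"
| "ntime (NSub e1 e2) = 1 + ntime e1 + ntime e2"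
| "ntime (NMul e1 e2) = 1 + ntime e1 + ntime e2"

fun rtime :: "rexp \<Rightarrow> nat" where
  "rtime (RNat e) = 1 + ntime e"
| "rtime (RRead a e) = 1 + ntime e"
| "rtime (RAdd e1 e2) = 1 + rtime e1 + rtime e2"
| "rtime (RSub e1 e2) = 1 + rtime e1 + rtime e2"
| "rtime (RMul e1 e2) = 1 + rtime e1 + rtime e2"
| "rtime (RDiv e1 e2) = 1 + rtime e1 + rtime e2"

fun btime :: "bexp \<Rightarrow> nat" where
  "btime (NLess e1 e2) = 1 + ntime e1 + ntime e2"
| "btime (RLess e1 e2) = 1 + rtime e1 + rtime e2"
| "btime (BNot b) = 1 + btime b"
| "btime (BAnd b1 b2) = 1 + btime b1 + btime b2"

definition nat_update :: "vname \<Rightarrow> nat \<Rightarrow> nat \<Rightarrow> mem \<Rightarrow> mem" where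
  "nat_update a i v s = s\<lparr>nats := (nats s)(a := (nats s a)(i := v))\<rparr>"

definition real_update :: "vname \<Rightarrow> nat \<Rightarrow> real \<Rightarrow> mem \<Rightarrow> mem" where
  "real_update a i v s = s\<lparr>reals := (reals s)(a := (reals s a)(i := v))\<rparr>"

text \<open>\<open>exec I c s n s'\<close>: started in \<open>s\<close>, the program \<open>c\<close> terminates in \<open>s'\<close> after \<open>n\<close> steps.  The
  instance enters only through the queries, which get stuck (so that no run exists) if the slot
  is out of range or the value is infinite; a program can avoid the latter by comparing the total
  capacity of the configuration with the job volume.\<close>

inductive exec :: "dc_instance \<Rightarrow> com \<Rightarrow> mem \<Rightarrow> nat \<Rightarrow> mem \<Rightarrow> bool" for I where
  Skip: "exec I Skip s 1 s"
| NAssign: "exec I (NAssign a i e) s (1 + ntime i + ntime e) (nat_update a (nval i s) (nval e s) s)"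
| RAssign: "exec I (RAssign a i e) s (1 + ntime i + rtime e) (real_update a (nval i s) (rval e s) s)"
| Eval: "nval t s \<in> {1..slots I} \<Longrightarrow>
    slot_cost I (nval t s) (\<lambda>j. nats s a (nval b s + j)) = ereal v \<Longrightarrow>
    exec I (Eval y i t a b) s (1 + ntime i + ntime t + ntime b) (real_update y (nval i s) v s)"
| Seq: "exec I c1 s n1 s1 \<Longrightarrow> exec I c2 s1 n2 s2 \<Longrightarrow> exec I (Seq c1 c2) s (n1 + n2) s2"
| IfTrue: "bval b s \<Longrightarrow> exec I c1 s n s' \<Longrightarrow> exec I (If b c1 c2) s (1 + btime b + n) s'"
| IfFalse: "\<not> bval b s \<Longrightarrow> exec I c2 s n s' \<Longrightarrow> exec I (If b c1 c2) s (1 + btime b + n) s'"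
| WhileFalse: "\<not> bval b s \<Longrightarrow> exec I (While b c) s (1 + btime b) s"
| WhileTrue: "bval b s \<Longrightarrow> exec I c s n1 s1 \<Longrightarrow> exec I (While b c) s1 n2 s2 \<Longrightarrow>
    exec I (While b c) s (1 + btime b + n1 + n2) s2"

inductive_cases SkipE: "exec I Skip s n s'"
inductive_cases NAssignE: "exec I (NAssign a i e) s n s'"
inductive_cases RAssignE: "exec I (RAssign a i e) s n s'"
inductive_cases EvalE: "exec I (Eval y i t a b) s n s'"
inductive_cases SeqE: "exec I (Seq c1 c2) s n s'"
inductive_cases IfE: "exec I (If b c1 c2) s n s'"
inductive_cases WhileE: "exec I (While b c) s n s'"

lemma exec_deterministic:
  assumes "exec I c s n s1" "exec I c s m s2"
  shows "n = m \<and> s1 = s2"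
  using assms
proof (induction arbitrary: m s2 rule: exec.induct)
  case (Skip s)
  then show ?case by (rule SkipE) simp
next
  case (NAssign a i e s)
  then show ?case by (rule NAssignE) simp
next
  case (RAssign a i e s)
  then show ?case by (rule RAssignE) simp
next
  case (Eval t s a b v y i)
  from Eval.prems Eval.hyps show ?case by (elim EvalE) simp
next
  case (Seq c1 s n1 s1 c2 n2 s2')
  from Seq.prems obtain k1 t k2 where k: "exec I c1 s k1 t" "exec I c2 t k2 s2" "m = k1 + k2"
    by (rule SeqE)
  from Seq.IH(1)[OF k(1)] Seq.IH(2)[of k2 s2] k show ?case by simp
next
  case (IfTrue b s c1 n s' c2)
  from IfTrue.prems IfTrue.hyps(1) obtain k where "exec I c1 s k s2" "m = 1 + btime b + k"
    by (elim IfE) simp_all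
  with IfTrue.IH[of k s2] show ?case by simp
next
  case (IfFalse b s c2 n s' c1)
  from IfFalse.prems IfFalse.hyps(1) obtain k where "exec I c2 s k s2" "m = 1 + btime b + k"
    by (elim IfE) simp_all
  with IfFalse.IH[of k s2] show ?case by simp
next
  case (WhileFalse b s c)
  from WhileFalse.prems show ?case by (rule WhileE) (use WhileFalse.hyps in simp_all)
next
  case (WhileTrue b s c n1 s1 n2 s2')
  from WhileTrue.prems obtain k1 t k2 where k: "exec I c s k1 t" "exec I (While b c) t k2 s2"
    "m = 1 + btime b + k1 + k2"
    by (rule WhileE) (use WhileTrue.hyps(1) in simp_all)
  from WhileTrue.IH(1)[OF k(1)] WhileTrue.IH(2)[of k2 s2] k show ?case by simp
qed

text \<open>The input of a run consists of \<open>T\<close>, \<open>d\<close>, \<open>m\<close>, \<open>\<beta>\<close>, the capacities, the job volumes and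
  \<open>\<epsilon>\<close>; all remaining memory is zero.\<close>

definition input_mem :: "dc_instance \<Rightarrow> real \<Rightarrow> mem" where
  "input_mem I \<epsilon> =
     \<lparr>nats = (\<lambda>_ _. 0)
        (''T'' := (\<lambda>_. 0)(0 := slots I),
         ''d'' := (\<lambda>_. 0)(0 := types I),
         ''m'' := (\<lambda>j. if j \<in> {1..types I} then servers I j else 0)),
      reals = (\<lambda>_ _. 0)
        (''beta'' := (\<lambda>j. if j \<in> {1..types I} then switch_cost I j else 0),
         ''zmax'' := (\<lambda>j. if j \<in> {1..types I} then capacity I j else 0),
         ''lambda'' := (\<lambda>t. if t \<in> {1..slots I} then volume I t else 0),
         ''eps'' := (\<lambda>_. 0)(0 := \<epsilon>))\<rparr>"

text \<open>The computed schedule is read off row by row from cells \<open>1, \<dots>, T * d\<close> of the array \<open>x\<close>.\<close>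

definition output_schedule :: "dc_instance \<Rightarrow> mem \<Rightarrow> nat \<Rightarrow> nat \<Rightarrow> nat" where
  "output_schedule I s t j =
     (if t \<in> {1..slots I} \<and> j \<in> {1..types I} then nats s ''x'' ((t - 1) * types I + j) else 0)"

end

theory Submission
  imports Defs
begin

text \<open>Only server counts from a grid with relative gaps \<open>1 + \<epsilon>/2\<close> are considered; it has
  \<open>O(log m / \<epsilon>)\<close> points.  Since each operating cost is increasing in the load, replacing \<open>x\<close> by some
  \<open>y\<close> with \<open>x \<le> y \<le> (1 + \<epsilon>) x\<close> increases the operating cost by at most the factor \<open>1 + \<epsilon>\<close>.  The grid
  value follows \<open>x\<close> lazily: it moves only when it leaves the window between \<open>x\<close> and \<open>(1 + \<epsilon>) x\<close>.  The
  window has room for two grid gaps, so a potential argument bounds the upward moves by \<open>1 + \<epsilon>\<close>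
  times those of \<open>x\<close>.

  A cheapest grid schedule is found by dynamic programming.  The switching cost is the distance in the
  product of paths in which going up costs \<open>\<beta>\<close> and going down is free, so the transition to the
  next slot takes two sweeps over the configurations that only look at neighbours.\<close>

section \<open>Operating costs\<close>

text \<open>Rounding every count up to the grid would fail: a schedule that oscillates by one server
  across a grid point pays \<beta> per move up, while its rounded version pays a whole gap each
  time, and no constant factor covers that. Hence the hysteresis, and its window fixes the density
  of the grid. The time bound shapes the rest. Comparing all pairs of configurations would cost
  about \<epsilon>^(-2d), so a transition has to be linear in the number of configurations, up to a
  factor depending on d. The machine offers neither logarithms nor rounding, so instead of rounded
  powers of a real ratio the grid uses integer steps whose width doubles, and \<epsilon> enters only
  through a natural number q, the least with q \<epsilon> \<ge> 2. The program must not depend on d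
  either, so there cannot be d nested loops; configurations are encoded as mixed radix
  numbers.\<close>

definition can_serve :: "dc_instance \<Rightarrow> nat \<Rightarrow> (nat \<Rightarrow> nat) \<Rightarrow> bool" where
  "can_serve I t x \<longleftrightarrow> volume I t \<le> (\<Sum>j=1..types I. real (x j) * capacity I j)"

text \<open>\<open>real_of_ereal\<close> maps \<infinity> to 0, so the value is meaningful only
  under \<open>can_serve\<close>, where \<open>slot_cost_real\<close> applies.\<close>

definition real_slot_cost :: "dc_instance \<Rightarrow> nat \<Rightarrow> (nat \<Rightarrow> nat) \<Rightarrow> real" where
  "real_slot_cost I t x = real_of_ereal (slot_cost I t x)"

lemma type_cost_nonneg:
  assumes "valid_instance I" "t \<in> {1..slots I}" "j \<in> {1..types I}" "0 \<le> z"
  shows "0 \<le> type_cost I t j x z"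
proof -
  have "0 \<le> volume I t" using assms unfolding valid_instance_def by auto
  then have "0 \<le> volume I t * z / real x" using assms by simp
  then have "0 \<le> load_cost I t j (volume I t * z / real x)"
    using assms unfolding load_cost_def valid_instance_def by auto
  then show ?thesis unfolding type_cost_def by simp
qed

lemma slot_cost_nonneg:
  assumes "valid_instance I" "t \<in> {1..slots I}"
  shows "0 \<le> slot_cost I t x"
  unfolding slot_cost_def
proof (rule INF_greatest)
  fix z assume "z \<in> splits I"
  then show "0 \<le> (\<Sum>j=1..types I. type_cost I t j (x j) (z j))"
    using assms by (intro sum_nonneg type_cost_nonneg) (auto simp: splits_def)
qed

lemma slot_cost_cong:
  assumes "\<And>j. j \<in> {1..types I} \<Longrightarrow> x j = y j"
  shows "slot_cost I t x = slot_cost I t y"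
  unfolding slot_cost_def by (intro INF_cong refl sum.cong) (auto simp: assms)

lemma slot_cost_finite:
  assumes valid: "valid_instance I" and t: "t \<in> {1..slots I}" and serve: "can_serve I t x"
  shows "slot_cost I t x \<noteq> \<infinity>"
proof -
  have d: "1 \<le> types I" and vol: "0 \<le> volume I t"
    and cap: "\<And>j. j \<in> {1..types I} \<Longrightarrow> 0 < capacity I j"
    using valid t unfolding valid_instance_def by auto
  define S where "S = (\<Sum>j=1..types I. real (x j) * capacity I j)"
  have "\<exists>z\<in>splits I. \<forall>j\<in>{1..types I}. type_cost I t j (x j) (z j) \<noteq> \<infinity>"
  proof (cases "volume I t = 0")
    case True
    have "(\<lambda>j. if j = 1 then 1 else 0) \<in> splits I"
      using d unfolding splits_def by (auto simp: sum.delta)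
    moreover have "type_cost I t j (x j) z \<noteq> \<infinity>" if "j \<in> {1..types I}" for j z
      using True cap[OF that] unfolding type_cost_def load_cost_def by auto
    ultimately show ?thesis by blast
  next
    case False
    with vol serve have S: "volume I t \<le> S" "0 < S" unfolding can_serve_def S_def by auto
    define z where "z j = real (x j) * capacity I j / S" for j
    have nn: "0 \<le> real (x j) * capacity I j" if "j \<in> {1..types I}" for j
      using cap[OF that] by simp
    have "z j \<le> 1" if "j \<in> {1..types I}" for j
      using member_le_sum[of j "{1..types I}" "\<lambda>j. real (x j) * capacity I j"] nn that S
      by (auto simp: z_def) (simp add: S_def)
    moreover have "0 \<le> z j" if "j \<in> {1..types I}" for j
      using nn[OF that] S by (simp add: z_def)
    moreover have "(\<Sum>j=1..types I. z j) = 1"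
      using S by (simp add: z_def S_def sum_divide_distrib[symmetric])
    ultimately have "z \<in> splits I" by (auto simp: splits_def)
    moreover have "type_cost I t j (x j) (z j) \<noteq> \<infinity>" if j: "j \<in> {1..types I}" for j
    proof (cases "x j = 0")
      case True
      then show ?thesis by (simp add: type_cost_def z_def)
    next
      case False
      then have "volume I t * z j / real (x j) = volume I t / S * capacity I j"
        using S by (simp add: z_def field_simps)
      also have "\<dots> \<le> 1 * capacity I j"
        using S cap[OF j] by (intro mult_right_mono) auto
      finally show ?thesis using False by (simp add: type_cost_def load_cost_def)
    qed
    ultimately show ?thesis by blast
  qed
  then obtain z where z: "z \<in> splits I" "\<And>j. j \<in> {1..types I} \<Longrightarrow> type_cost I t j (x j) (z j) \<noteq> \<infinity>"
    by blast
  then have "(\<Sum>j=1..types I. type_cost I t j (x j) (z j)) \<noteq> \<infinity>"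
    by (simp add: sum_Pinfty)
  moreover have "slot_cost I t x \<le> (\<Sum>j=1..types I. type_cost I t j (x j) (z j))"
    unfolding slot_cost_def using z(1) by (rule INF_lower)
  ultimately show ?thesis by auto
qed

lemma slot_cost_real:
  assumes "valid_instance I" "t \<in> {1..slots I}" "can_serve I t x"
  shows "slot_cost I t x = ereal (real_slot_cost I t x)"
  using slot_cost_finite[OF assms] slot_cost_nonneg[OF assms(1,2)]
  unfolding real_slot_cost_def by (auto simp: ereal_real)

text \<open>With more servers sharing the same volume the load per server does not rise, nor does
  the cost per server; only the number of servers grows, by at most the factor \<rho>. If the old
  load exceeds the capacity, the right-hand side is \<infinity>; and x = 0 forces y = 0.\<close>

lemma type_cost_scale:
  assumes valid: "valid_instance I" and t: "t \<in> {1..slots I}" and j: "j \<in> {1..types I}"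
    and "x \<le> y" "real y \<le> \<rho> * real x" "0 < \<rho>" "0 \<le> z"
  shows "type_cost I t j y z \<le> ereal \<rho> * type_cost I t j x z"
proof (cases "x = 0")
  case True
  with assms have "y = 0" by simp
  with True \<open>0 < \<rho>\<close> show ?thesis by (simp add: type_cost_def)
next
  case False
  have vol: "0 \<le> volume I t * z"
    using valid t \<open>0 \<le> z\<close> unfolding valid_instance_def by simp
  define a b where "a = volume I t * z / real y" and "b = volume I t * z / real x"
  have ab: "0 \<le> a" "a \<le> b"
    using False \<open>x \<le> y\<close> vol by (auto simp: a_def b_def intro!: divide_left_mono)
  show ?thesis
  proof (cases "b \<le> capacity I j")
    case True
    have f: "op_cost I t j a \<le> op_cost I t j b" "0 \<le> op_cost I t j a"
      using valid t j True ab unfolding valid_instance_def mono_on_def by auto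
    have "real y * op_cost I t j a \<le> \<rho> * real x * op_cost I t j b"
      using assms f by (intro mult_mono) auto
    then show ?thesis using True ab False \<open>x \<le> y\<close>
      by (simp add: type_cost_def load_cost_def a_def[symmetric] b_def[symmetric] mult.assoc)
  next
    case False
    then show ?thesis using \<open>x \<noteq> 0\<close> \<open>0 < \<rho>\<close>
      by (simp add: type_cost_def load_cost_def b_def[symmetric])
  qed
qed

lemma slot_cost_scale:
  assumes valid: "valid_instance I" and t: "t \<in> {1..slots I}" and \<rho>: "0 < \<rho>"
    and xy: "\<And>j. j \<in> {1..types I} \<Longrightarrow> x j \<le> y j \<and> real (y j) \<le> \<rho> * real (x j)"
  shows "slot_cost I t y \<le> ereal \<rho> * slot_cost I t x"
proof -
  \<comment> \<open>The factor is moved to the left so that the right-hand side is a bare infimum;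
    each split for x is reused for y.\<close>
  have "slot_cost I t y / ereal \<rho> \<le> slot_cost I t x"
    unfolding slot_cost_def[of I t x]
  proof (rule INF_greatest)
    fix z assume z: "z \<in> splits I"
    have "slot_cost I t y \<le> (\<Sum>j=1..types I. type_cost I t j (y j) (z j))"
      unfolding slot_cost_def using z by (rule INF_lower)
    also have "\<dots> \<le> (\<Sum>j=1..types I. ereal \<rho> * type_cost I t j (x j) (z j))"
      using z xy by (intro sum_mono type_cost_scale valid t \<rho>) (auto simp: splits_def)
    also have "\<dots> = ereal \<rho> * (\<Sum>j=1..types I. type_cost I t j (x j) (z j))"
      using z by (intro sum_ereal_right_distrib[symmetric] type_cost_nonneg valid t)
        (auto simp: splits_def)
    finally show "slot_cost I t y / ereal \<rho> \<le> (\<Sum>j=1..types I. type_cost I t j (x j) (z j))"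
      using \<rho> by (simp add: ereal_divide_le_pos)
  qed
  then show ?thesis using \<rho> by (simp add: ereal_divide_le_pos)
qed

lemma real_slot_cost_scale:
  assumes valid: "valid_instance I" and t: "t \<in> {1..slots I}" and \<rho>: "0 < \<rho>"
    and xy: "\<And>j. j \<in> {1..types I} \<Longrightarrow> x j \<le> y j \<and> real (y j) \<le> \<rho> * real (x j)"
    and serve: "can_serve I t x"
  shows "can_serve I t y" "real_slot_cost I t y \<le> \<rho> * real_slot_cost I t x"
proof -
  have "(\<Sum>j=1..types I. real (x j) * capacity I j) \<le> (\<Sum>j=1..types I. real (y j) * capacity I j)"
    using xy valid unfolding valid_instance_def
    by (intro sum_mono mult_right_mono) (auto simp: less_imp_le)
  then show y: "can_serve I t y" using serve unfolding can_serve_def by simp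
  show "real_slot_cost I t y \<le> \<rho> * real_slot_cost I t x"
    using slot_cost_scale[where x = x and y = y, OF valid t \<rho>] xy
    by (simp add: slot_cost_real[OF valid t serve] slot_cost_real[OF valid t y])
qed

definition real_schedule_cost :: "dc_instance \<Rightarrow> (nat \<Rightarrow> nat \<Rightarrow> nat) \<Rightarrow> real" where
  "real_schedule_cost I X = (\<Sum>t=1..slots I. real_slot_cost I t (X t) +
     (\<Sum>j=1..types I. switch_cost I j * max (real (X t j) - real (X (t - 1) j)) 0))"

lemma schedule_cost_real:
  assumes "valid_instance I" "feasible_schedule I X"
  shows "schedule_cost I X = ereal (real_schedule_cost I X)"
proof -
  have "slot_cost I t (X t) = ereal (real_slot_cost I t (X t))" if "t \<in> {1..slots I}" for t
    using slot_cost_real[OF assms(1) that] assms(2) that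
    unfolding feasible_schedule_def can_serve_def by auto
  then show ?thesis unfolding schedule_cost_def real_schedule_cost_def
    by (subst sum_ereal[symmetric]) (auto intro!: sum.cong)
qed

text \<open>There are infinitely many feasible schedules as functions, since values outside the
  index ranges are arbitrary. The cost depends only on the restriction to \<open>A\<close>, which
  includes row 0, and there are finitely many such restrictions.\<close>

lemma optimal_schedule_exists:
  assumes "feasible_schedule I X"
  shows "\<exists>Y. optimal_schedule I Y"
proof -
  define A where "A = {0..slots I} \<times> {1..types I}"
  define r where "r X = restrict (\<lambda>(t, j). X t j) A" for X :: "nat \<Rightarrow> nat \<Rightarrow> nat"
  define M where "M = (\<Sum>j=1..types I. servers I j)"
  let ?F = "Collect (feasible_schedule I)"
  have "r Z \<in> PiE A (\<lambda>_. {..M})" if Z: "feasible_schedule I Z" for Z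
  proof -
    have "Z t j \<le> M" if "t \<in> {0..slots I}" "j \<in> {1..types I}" for t j
    proof -
      have "Z t j \<le> servers I j"
      proof (cases "t = 0")
        case True
        then show ?thesis
          using Z that unfolding feasible_schedule_def is_schedule_def by simp
      next
        case False
        then show ?thesis
          using Z that unfolding feasible_schedule_def is_schedule_def by auto
      qed
      also have "\<dots> \<le> M" unfolding M_def using that by (intro member_le_sum) auto
      finally show ?thesis .
    qed
    then show ?thesis unfolding r_def A_def by auto
  qed
  then have "r ` ?F \<subseteq> PiE A (\<lambda>_. {..M})" by blast
  then have fin: "finite (r ` ?F)"
    by (rule finite_subset) (auto intro!: finite_PiE simp: A_def)
  have cost: "schedule_cost I Z = schedule_cost I (\<lambda>t j. r Z (t, j))" for Z
    unfolding schedule_cost_def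
    by (intro sum.cong arg_cong2[where f = "(+)"] slot_cost_cong arg_cong[where f = ereal] refl)
      (auto simp: r_def A_def intro!: sum.cong)
  have "schedule_cost I ` ?F \<subseteq> (\<lambda>R. schedule_cost I (\<lambda>t j. R (t, j))) ` (r ` ?F)"
    using cost by auto
  then have fin2: "finite (schedule_cost I ` ?F)" using fin by (meson finite_imageI finite_subset)
  then have "Min (schedule_cost I ` ?F) \<in> schedule_cost I ` ?F"
    using assms by (intro Min_in) auto
  then obtain Y where Y: "feasible_schedule I Y" "schedule_cost I Y = Min (schedule_cost I ` ?F)"
    by auto
  then have "optimal_schedule I Y"
    using fin2 unfolding optimal_schedule_def by (auto intro!: Min_le)
  then show ?thesis by blast
qed

section \<open>Rounding to a sparse grid\<close>

text \<open>The alternative \<open>real v + 1\<close> in \<open>gap\<close> lets small integers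
  follow one another where a relative gap would be shorter than 1. The condition 2 \<gamma> - 1
  \<le> \<rho> says that two gaps of length (\<gamma> - 1) v fit between v and \<rho> v.\<close>

locale sparse_grid =
  fixes G :: "nat set" and m :: nat and \<gamma> \<rho> :: real
  assumes finite_grid: "finite G" and zero_in: "0 \<in> G" and top_in: "m \<in> G"
    and grid_le: "v \<in> G \<Longrightarrow> v \<le> m"
    and gap: "v \<in> G \<Longrightarrow> v < m \<Longrightarrow> \<exists>w\<in>G. v < w \<and> real w \<le> max (real v + 1) (\<gamma> * real v)"
    and gamma: "1 \<le> \<gamma>" "2 * \<gamma> - 1 \<le> \<rho>"
begin

text \<open>The names tell how a value enters the window of x: from below it goes up to
  \<open>up x\<close>, from above it goes down to \<open>down x\<close>, which for x \<le> m is
  still no less than x.\<close>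

definition up :: "nat \<Rightarrow> nat" where "up x = Min {v \<in> G. x \<le> v}"
definition down :: "nat \<Rightarrow> nat" where "down x = Max {v \<in> G. real v \<le> \<rho> * real x}"

lemma rho: "1 \<le> \<rho>" "\<gamma> \<le> \<rho>" using gamma by auto

lemma up:
  assumes "x \<le> m"
  shows "up x \<in> G" "x \<le> up x" "\<And>v. v \<in> G \<Longrightarrow> x \<le> v \<Longrightarrow> up x \<le> v"
proof -
  have f: "finite {v \<in> G. x \<le> v}" "{v \<in> G. x \<le> v} \<noteq> {}" using finite_grid top_in assms by auto
  show "up x \<in> G" "x \<le> up x" using Min_in[OF f] by (auto simp: up_def)
  show "\<And>v. v \<in> G \<Longrightarrow> x \<le> v \<Longrightarrow> up x \<le> v" using f by (auto simp: up_def intro: Min_le)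
qed

lemma down:
  shows "down x \<in> G" "real (down x) \<le> \<rho> * real x"
    "\<And>v. v \<in> G \<Longrightarrow> real v \<le> \<rho> * real x \<Longrightarrow> v \<le> down x"
proof -
  have f: "finite {v \<in> G. real v \<le> \<rho> * real x}" "{v \<in> G. real v \<le> \<rho> * real x} \<noteq> {}"
    using finite_grid zero_in rho by (auto intro!: exI[of _ 0])
  show "down x \<in> G" "real (down x) \<le> \<rho> * real x" using Max_in[OF f] by (auto simp: down_def)
  show "\<And>v. v \<in> G \<Longrightarrow> real v \<le> \<rho> * real x \<Longrightarrow> v \<le> down x"
    using f by (auto simp: down_def intro: Max_ge)
qed

text \<open>A number x outside the grid lies strictly between its grid neighbours v and
  \<open>up x\<close>. Such a gap is longer than 1, hence of the multiplicative kind.\<close>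

lemma up_cases:
  assumes "x \<le> m"
  obtains "up x = x"
  | v where "v \<in> G" "v < x" "x < up x" "real (up x) \<le> \<gamma> * real v" "\<And>w. w \<in> G \<Longrightarrow> w < up x \<Longrightarrow> w \<le> v"
proof (cases "x \<in> G")
  case True
  then have "up x = x" using up[OF assms] by (meson le_antisym order_refl)
  then show ?thesis by (rule that(1))
next
  case False
  define v where "v = Max {v \<in> G. v \<le> x}"
  have f: "finite {v \<in> G. v \<le> x}" "{v \<in> G. v \<le> x} \<noteq> {}" using finite_grid zero_in by auto
  have v: "v \<in> G" "v \<le> x" using Max_in[OF f] by (auto simp: v_def)
  have vmax: "w \<le> v" if "w \<in> G" "w \<le> x" for w using f that by (auto simp: v_def intro: Max_ge)
  have "v < x" using v False by (metis le_neq_implies_less)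
  then obtain w where w: "w \<in> G" "v < w" "real w \<le> max (real v + 1) (\<gamma> * real v)"
    using gap[OF v(1)] assms by auto
  have "x < w" using vmax[OF w(1)] w(2) by force
  then have "real w > real v + 1" using \<open>v < x\<close> by linarith
  then have "real w \<le> \<gamma> * real v" using w(3) by auto
  moreover have "up x \<le> w" using up(3)[OF assms w(1)] \<open>x < w\<close> by simp
  moreover have "x < up x" using up(1,2)[OF assms] False by (metis le_neq_implies_less)
  moreover have "u \<le> v" if "u \<in> G" "u < up x" for u
  proof -
    have "u \<le> x" using up(3)[OF assms that(1)] that(2) by force
    then show ?thesis using vmax that by simp
  qed
  ultimately show ?thesis using v(1) \<open>v < x\<close> by (intro that(2)[of v]) auto
qed

lemma up_le_down:
  assumes "x \<le> m"
  shows "up x \<le> down x"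
  using assms
proof (rule up_cases)
  assume "up x = x"
  then have "real (up x) \<le> \<rho> * real x" using rho by (simp add: mult_le_cancel_right1)
  then show ?thesis using down(3) up(1)[OF assms] by simp
next
  fix v assume v: "v < x" "real (up x) \<le> \<gamma> * real v"
  have "\<gamma> * real v \<le> \<rho> * real x" using v rho gamma by (intro mult_mono) auto
  then show ?thesis using down(3) up(1)[OF assms] v by simp
qed

text \<open>The credit is what the original schedule has paid for \<open>\<rho> x\<close> beyond the next grid point
  above \<open>a\<close>.\<close>

definition credit :: "nat \<Rightarrow> nat \<Rightarrow> real" where
  "credit x a = max 0 (\<rho> * real x - real a - max ((\<gamma> - 1) * real a) 1)"

text \<open>One step of the potential argument: x becomes y while the grid value goes from a to b.
  Staying put raises the credit by at most what the original schedule pays. Moving up is covered by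
  the credit and that payment together. Moving down leaves no credit, since the next grid point is
  already beyond \<rho> y.\<close>

lemma lazy_move:
  assumes "x \<le> m" "y \<le> m" "a \<in> G" "x \<le> a"
  defines "b \<equiv> max (up y) (min a (down y))"
  shows "max (real b - real a) 0 + credit y b \<le> \<rho> * max (real y - real x) 0 + credit x a"
proof (cases "a < b")
  case True
  then have b: "b = up y" unfolding b_def by auto
  have "a < y"
  proof (rule ccontr)
    assume "\<not> a < y"
    then have "up y \<le> a" using up(3)[OF \<open>y \<le> m\<close> \<open>a \<in> G\<close>] by simp
    with b True show False by simp
  qed
  then have xy: "x \<le> y" using \<open>x \<le> a\<close> by simp
  have lhs: "max (real b - real a) 0 = real b - real a" using True by simp
  have rhs: "\<rho> * max (real y - real x) 0 = \<rho> * real y - \<rho> * real x"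
    using xy by (simp add: right_diff_distrib)
  have x: "credit x a \<ge> \<rho> * real x - real a - max ((\<gamma> - 1) * real a) 1" "0 \<le> credit x a"
    unfolding credit_def by simp_all
  have mono: "max ((\<gamma> - 1) * real a) 1 \<le> max ((\<gamma> - 1) * real b) 1"
    using True gamma by (intro max.mono mult_left_mono) auto
  show ?thesis
  proof (cases "credit y b = 0")
    case False
    \<comment> \<open>If credit remains, b cancels on the left-hand side, and the gap reserved at b
      is at least the one reserved at a.\<close>
    then have "credit y b = \<rho> * real y - real b - max ((\<gamma> - 1) * real b) 1"
      unfolding credit_def by linarith
    then show ?thesis using mono x lhs rhs by linarith
  next
    case zero: True
    show ?thesis using \<open>y \<le> m\<close>
    proof (rule up_cases)
      assume "up y = y"
      then have "real b - real a \<le> 1 * (real y - real x)" using b \<open>x \<le> a\<close> by simp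
      also have "\<dots> \<le> \<rho> * (real y - real x)" using rho xy by (intro mult_right_mono) auto
      also have "\<dots> = \<rho> * real y - \<rho> * real x" by (rule right_diff_distrib)
      finally show ?thesis using x zero lhs rhs by linarith
    next
      fix v assume v: "v \<in> G" "v < y" "y < up y" "real (up y) \<le> \<gamma> * real v"
        "\<And>w. w \<in> G \<Longrightarrow> w < up y \<Longrightarrow> w \<le> v"
      have av: "a \<le> v" using v(5)[OF \<open>a \<in> G\<close>] True b by simp
      \<comment> \<open>Since y lies strictly between v and \<open>up y\<close>, the gap is at least
        2, so the lower limit 1 in the credit is dominated by (\<gamma> - 1) v.\<close>
      have "real v + 2 \<le> real (up y)" using v(2,3) by linarith
      then have "1 \<le> (\<gamma> - 1) * real v" using v(4) by (simp add: left_diff_distrib)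
      moreover have "(\<gamma> - 1) * real a \<le> (\<gamma> - 1) * real v"
        using av gamma by (intro mult_left_mono) auto
      ultimately have "max ((\<gamma> - 1) * real a) 1 \<le> (\<gamma> - 1) * real v" by simp
      \<comment> \<open>The new value plus the gap reserved at a stays below \<rho> y: here the room
        for two gaps is used.\<close>
      then have "real b + max ((\<gamma> - 1) * real a) 1 \<le> \<gamma> * real v + (\<gamma> - 1) * real v"
        using v(4) b by linarith
      also have "\<dots> = (2 * \<gamma> - 1) * real v" by (simp add: algebra_simps)
      also have "\<dots> \<le> \<rho> * real y" using gamma rho v(2) by (intro mult_mono) auto
      finally show ?thesis using x zero lhs rhs by linarith
    qed
  qed
next
  case False
  have nn: "0 \<le> \<rho> * max (real y - real x) 0" using rho by simp
  have lhs: "max (real b - real a) 0 = 0" using False by simp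
  consider "b = a" | "b = down y" "down y < a"
    using up_le_down[OF \<open>y \<le> m\<close>] False unfolding b_def
    by (auto simp: max_def min_def split: if_splits)
  then show ?thesis
  proof cases
    case 1
    have "\<rho> * (real y - real x) \<le> \<rho> * max (real y - real x) 0"
      using rho by (intro mult_left_mono) auto
    then have "\<rho> * real y - \<rho> * real x \<le> \<rho> * max (real y - real x) 0"
      by (simp only: right_diff_distrib)
    then have "credit y a \<le> \<rho> * max (real y - real x) 0 + credit x a"
      using nn unfolding credit_def by linarith
    then show ?thesis using 1 by simp
  next
    case 2
    \<comment> \<open>Being below a, the point \<open>down y\<close> is not the top and has a
      successor w, which must exceed \<rho> y by maximality of \<open>down y\<close>.\<close>
    have "down y < m" using 2 grid_le[OF \<open>a \<in> G\<close>] by simp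
    then obtain w where w: "w \<in> G" "down y < w"
      "real w \<le> max (real (down y) + 1) (\<gamma> * real (down y))"
      using gap[OF down(1)] by blast
    have "\<rho> * real y < real w" using down(3)[OF w(1), of y] w(2) by force
    moreover have "\<gamma> * real b = (\<gamma> - 1) * real b + real b" by (simp add: algebra_simps)
    ultimately have "credit y b = 0" using w(3) unfolding 2(1)[symmetric] credit_def by linarith
    moreover have "0 \<le> credit x a" by (simp add: credit_def)
    ultimately show ?thesis using lhs nn by linarith
  qed
qed

text \<open>\<open>lazy_move\<close> telescopes; the credit is 0 at the start and nonnegative at the
  end, so it disappears from the bound.\<close>

theorem rounding:
  fixes x :: "nat \<Rightarrow> nat"
  assumes x0: "x 0 = 0" and xm: "\<And>t. t \<le> n \<Longrightarrow> x t \<le> m"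
  obtains y where "y 0 = 0" "\<And>t. t \<le> n \<Longrightarrow> y t \<in> G \<and> x t \<le> y t \<and> real (y t) \<le> \<rho> * real (x t)"
    "(\<Sum>t=1..n. max (real (y t) - real (y (t - 1))) 0) \<le>
     \<rho> * (\<Sum>t=1..n. max (real (x t) - real (x (t - 1))) 0)"
proof -
  \<comment> \<open>The previous value is clamped to the window of the next x.\<close>
  define y where "y = rec_nat 0 (\<lambda>t a. max (up (x (Suc t))) (min a (down (x (Suc t)))))"
  have y0: "y 0 = 0" and yS: "y (Suc t) = max (up (x (Suc t))) (min (y t) (down (x (Suc t))))" for t
    by (simp_all add: y_def)
  have y: "y t \<in> G \<and> x t \<le> y t \<and> real (y t) \<le> \<rho> * real (x t)" if "t \<le> n" for t
    using that
  proof (induction t)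
    case 0
    then show ?case by (simp add: y0 x0 zero_in)
  next
    case (Suc t)
    have "x (Suc t) \<le> m" using xm Suc by simp
    note u = up(1,2)[OF this] up_le_down[OF this] down(1,2)[of "x (Suc t)"]
    have "y (Suc t) \<le> down (x (Suc t))" "up (x (Suc t)) \<le> y (Suc t)" using u(3) by (simp_all add: yS)
    moreover have "y (Suc t) \<in> G" using u Suc by (auto simp: yS max_def min_def)
    ultimately show ?case using u(2,5) by linarith
  qed
  have "(\<Sum>t=1..k. max (real (y t) - real (y (t - 1))) 0) + credit (x k) (y k) \<le>
     \<rho> * (\<Sum>t=1..k. max (real (x t) - real (x (t - 1))) 0)" if "k \<le> n" for k
    using that
  proof (induction k)
    case 0
    then show ?case by (simp add: credit_def x0 y0)
  next
    case (Suc k)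
    have "max (real (y (Suc k)) - real (y k)) 0 + credit (x (Suc k)) (y (Suc k)) \<le>
        \<rho> * max (real (x (Suc k)) - real (x k)) 0 + credit (x k) (y k)"
      unfolding yS using y[of k] Suc xm by (intro lazy_move) auto
    then show ?case using Suc by (simp add: algebra_simps)
  qed
  from this[of n] have "(\<Sum>t=1..n. max (real (y t) - real (y (t - 1))) 0) \<le>
     \<rho> * (\<Sum>t=1..n. max (real (x t) - real (x (t - 1))) 0)"
    by (simp add: credit_def)
  then show ?thesis using that y0 y by blast
qed

end

section \<open>An integer grid with doubling step widths\<close>

fun grid_step :: "nat \<Rightarrow> nat \<Rightarrow> nat \<times> nat \<Rightarrow> nat \<times> nat" where
  "grid_step q m (v, s) = (let s' = if 2 * q * s \<le> v then 2 * s else s in (min m (v + s'), s'))"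

text \<open>A state consists of the current point v and the step width s. The width doubles only if
  the doubled width s' still satisfies q s' \<le> v, so every step wider than 1 is at most v / q.
  Cutting off at m makes m itself the last point.\<close>

definition grid_state :: "nat \<Rightarrow> nat \<Rightarrow> nat \<Rightarrow> nat \<times> nat" where
  "grid_state q m k = (grid_step q m ^^ k) (0, 1)"

abbreviation grid :: "nat \<Rightarrow> nat \<Rightarrow> nat \<Rightarrow> nat" where
  "grid q m k \<equiv> fst (grid_state q m k)"

definition grid_top :: "nat \<Rightarrow> nat \<Rightarrow> nat" where
  "grid_top q m = (LEAST k. grid q m k = m)"

lemma grid_state_0 [simp]: "grid_state q m 0 = (0, 1)"
  by (simp add: grid_state_def)

lemma grid_state_Suc: "grid_state q m (Suc k) = grid_step q m (grid_state q m k)"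
  by (simp add: grid_state_def)

lemma grid_invariant:
  "grid q m k \<le> m \<and> 1 \<le> snd (grid_state q m k) \<and>
   (snd (grid_state q m k) = 1 \<or> q * snd (grid_state q m k) \<le> grid q m k)"
proof (induction k)
  case (Suc k)
  obtain v s where vs: "grid_state q m k = (v, s)" by fastforce
  then show ?case using Suc by (auto simp: grid_state_Suc Let_def min_def)
qed simp

lemma grid_Suc:
  assumes "1 \<le> q" "grid q m k < m"
  shows "grid q m k < grid q m (Suc k)"
    "real (grid q m (Suc k)) \<le> max (real (grid q m k) + 1) ((1 + 1 / real q) * real (grid q m k))"
proof -
  obtain v s where vs: "grid_state q m k = (v, s)" by fastforce
  obtain v' s' where vs': "grid_state q m (Suc k) = (v', s')" by fastforce
  have s: "1 \<le> s" "v < m" using grid_invariant[of q m k] vs assms by auto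
  have eq: "v' = min m (v + s')" "s' = (if 2 * q * s \<le> v then 2 * s else s)"
    using vs' by (auto simp: grid_state_Suc vs Let_def)
  then show "grid q m k < grid q m (Suc k)" using vs vs' s by auto
  have "s' = 1 \<or> q * s' \<le> v" using grid_invariant[of q m k] vs eq by auto
  then have "s' = 1 \<or> real s' \<le> real v / real q"
    using assms by (auto simp: field_simps simp flip: of_nat_mult)
  then show "real (grid q m (Suc k)) \<le> max (real (grid q m k) + 1) ((1 + 1 / real q) * real (grid q m k))"
    using vs vs' eq by (auto simp: algebra_simps min_def)
qed

lemma grid_top:
  assumes "1 \<le> q"
  shows "grid q m (grid_top q m) = m"
proof -
  \<comment> \<open>Every step below m gains at least 1, so m is reached at index m at the
    latest.\<close>
  have "k \<le> grid q m k \<or> grid q m k = m" for k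
  proof (induction k)
    case (Suc k)
    show ?case
    proof (cases "grid q m k < m")
      case True
      then show ?thesis using grid_Suc(1)[OF assms True] Suc by auto
    next
      case False
      then have "grid q m k = m" using grid_invariant[of q m k] by simp
      then show ?thesis by (cases "grid_state q m k") (auto simp: grid_state_Suc Let_def)
    qed
  qed simp
  from this[of m] have "grid q m m = m" using grid_invariant[of q m m] by auto
  then show ?thesis unfolding grid_top_def by (rule LeastI)
qed

lemma grid_less_top: "k < grid_top q m \<Longrightarrow> grid q m k < m"
  using grid_invariant[of q m k] not_less_Least[of k "\<lambda>k. grid q m k = m"]
  unfolding grid_top_def by (metis le_neq_implies_less)

lemma grid_strict_mono:
  assumes "1 \<le> q" "k < l" "l \<le> grid_top q m"
  shows "grid q m k < grid q m l"
  using assms(2,3)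
proof (induction l)
  case (Suc l)
  have "grid q m l < grid q m (Suc l)" using grid_Suc(1) grid_less_top assms(1) Suc by simp
  then show ?case using Suc by (cases "k = l") auto
qed simp

text \<open>Each doubling of the step width \<open>2 ^ a\<close> happens after at most \<open>q + 1\<close> further points.\<close>

lemma grid_growth:
  assumes "1 \<le> q" "grid q m k < m"
  shows "\<exists>a. snd (grid_state q m k) = 2 ^ a \<and> k * 2 ^ a \<le> grid q m k + a * (q + 1) * 2 ^ a \<and>
    grid q m k \<le> 2 * q * 2 ^ a + 2 ^ a"
  using assms(2)
proof (induction k)
  case 0
  then show ?case by (auto intro!: exI[of _ 0])
next
  case (Suc k)
  obtain v s where vs: "grid_state q m k = (v, s)" by fastforce
  have "v < m"
  proof (rule ccontr)
    assume "\<not> v < m"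
    then have "grid q m (Suc k) = m" using vs by (auto simp: grid_state_Suc Let_def)
    with Suc show False by simp
  qed
  with Suc vs obtain a where a: "s = 2 ^ a" "k * 2 ^ a \<le> v + a * (q + 1) * 2 ^ a"
    "v \<le> 2 * q * 2 ^ a + 2 ^ a" by auto
  show ?case
  proof (cases "2 * q * s \<le> v")
    case True
    then have eq: "grid_state q m (Suc k) = (v + 2 * s, 2 * s)"
      using Suc.prems vs by (auto simp: grid_state_Suc Let_def min_def split: if_splits)
    define p :: nat where "p = 2 ^ a"
    have "p \<le> p * q" using assms by simp
    then have "v \<le> 4 * (p * q)" using a(3) unfolding p_def[symmetric] by (simp only: ac_simps)
    \<comment> \<open>Doubling the width doubles the left-hand side of the invariant and thus asks
      for v a second time; v is at most (2 q + 1) p, which the new term 2 (q + 1) p covers.\<close>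
    then have "(Suc k) * (2 * p) \<le> (v + 2 * p) + Suc a * (q + 1) * (2 * p)"
      "v + 2 * p \<le> 2 * q * (2 * p) + 2 * p"
      using a unfolding p_def[symmetric] by (simp_all add: algebra_simps)
    then show ?thesis using a by (intro exI[of _ "Suc a"]) (simp add: eq p_def)
  next
    case False
    then have eq: "grid_state q m (Suc k) = (v + s, s)"
      using Suc.prems vs by (auto simp: grid_state_Suc Let_def min_def split: if_splits)
    then show ?thesis using a False by (intro exI[of _ a]) simp
  qed
qed

text \<open>\<open>grid_growth\<close> at the last index below the top bounds k linearly in a. The
  width 2 ^ a is at most m there, so a is at most log m. The constant is 7 = 5 + 2, from 2 q + 3
  \<le> 5 q and q + 1 \<le> 2 q; the maximum with 1 is for m = 1, where the logarithm
  vanishes.\<close>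

lemma grid_top_bound:
  assumes "1 \<le> q" "1 \<le> m"
  shows "real (Suc (grid_top q m)) \<le> 7 * real q * max 1 (log 2 (real m))"
proof (cases "grid_top q m")
  case 0
  have "1 \<le> 7 * real q" using assms by simp
  also have "\<dots> \<le> 7 * real q * max 1 (log 2 (real m))"
    using mult_left_mono[of 1 "max 1 (log 2 (real m))" "7 * real q"] by simp
  finally show ?thesis using 0 by simp
next
  case (Suc k)
  then have km: "grid q m k < m" by (simp add: grid_less_top)
  obtain a where a: "snd (grid_state q m k) = 2 ^ a" "k * 2 ^ a \<le> grid q m k + a * (q + 1) * 2 ^ a"
    "grid q m k \<le> 2 * q * 2 ^ a + 2 ^ a" using grid_growth[OF assms(1) km] by blast
  have "k * 2 ^ a \<le> (2 * q + 1 + a * (q + 1)) * 2 ^ a" using a by (simp add: algebra_simps)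
  then have k: "k \<le> 2 * q + 1 + a * (q + 1)" by (rule mult_right_le_imp_le) simp
  have "2 ^ a \<le> m"
  proof (cases "a = 0")
    case False
    then have "(2::nat) ^ a \<noteq> 1" by simp
    then have "q * 2 ^ a \<le> grid q m k" using grid_invariant[of q m k] a by auto
    moreover have "2 ^ a \<le> q * 2 ^ a" using assms by simp
    ultimately show ?thesis using km by linarith
  qed (use assms in simp)
  then have "2 powr real a \<le> real m" by (simp add: powr_realpow flip: of_nat_power)
  then have al: "real a \<le> log 2 (real m)" using assms by (simp add: le_log_iff)
  define L where "L = max 1 (log 2 (real m))"
  have L: "1 \<le> L" "real a \<le> L" using al by (auto simp: L_def)
  have q: "1 \<le> real q" using assms by simp
  have "real (Suc (grid_top q m)) \<le> 2 * real q + 3 + real a * (real q + 1)"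
    using of_nat_mono[OF k, where ?'a = real] Suc by (simp add: algebra_simps)
  also have "\<dots> \<le> 5 * real q * L + L * (2 * real q)"
  proof (intro add_mono mult_mono)
    show "2 * real q + 3 \<le> 5 * real q * L"
      using mult_left_mono[of 1 L "5 * real q"] L q by linarith
  qed (use L q in auto)
  finally show ?thesis by (simp add: L_def algebra_simps)
qed

text \<open>A step of at most v / q amounts to the ratio \<gamma> = 1 + 1 / q, and then 2 \<gamma> -
  1 = 1 + 2 / q is at most 1 + \<epsilon>.\<close>

lemma sparse_grid_grid:
  assumes "1 \<le> q" "2 / real q \<le> \<epsilon>"
  shows "sparse_grid (grid q m ` {..grid_top q m}) m (1 + 1 / real q) (1 + \<epsilon>)"
proof
  show "0 \<in> grid q m ` {..grid_top q m}"
    by (rule image_eqI[of _ _ 0]) auto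
  show "m \<in> grid q m ` {..grid_top q m}"
    using grid_top[OF assms(1)] by (intro image_eqI[of _ _ "grid_top q m"]) auto
  show "v \<le> m" if "v \<in> grid q m ` {..grid_top q m}" for v
    using that grid_invariant by auto
  fix v assume "v \<in> grid q m ` {..grid_top q m}" and vm: "v < m"
  then obtain k where k: "k \<le> grid_top q m" "v = grid q m k" by auto
  have "k \<noteq> grid_top q m" using grid_top[OF assms(1)] k vm by auto
  then have "Suc k \<le> grid_top q m" using k by simp
  then have "grid q m (Suc k) \<in> grid q m ` {..grid_top q m}" by blast
  then show "\<exists>w\<in>grid q m ` {..grid_top q m}. v < w \<and>
      real w \<le> max (real v + 1) ((1 + 1 / real q) * real v)"
    using grid_Suc[OF assms(1)] vm k by blast
qed (use assms in auto)

section \<open>Mixed radix numbers\<close>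

context
  fixes n :: "nat \<Rightarrow> nat"
begin

text \<open>The place value of digit j, with digits counted from 1. Changing coordinate j by one
  grid step changes the code by \<open>stride j\<close>, and \<open>stride (Suc d)\<close> is the
  number of all d-digit codes.\<close>

definition stride :: "nat \<Rightarrow> nat" where "stride j = (\<Prod>l=1..<j. n l)"

definition digit :: "nat \<Rightarrow> nat \<Rightarrow> nat" where "digit j i = i div stride j mod n j"

lemma stride_1 [simp]: "stride (Suc 0) = 1" by (simp add: stride_def)

lemma stride_Suc: "1 \<le> j \<Longrightarrow> stride (Suc j) = stride j * n j"
  by (simp add: stride_def prod.atLeastLessThan_Suc)

lemma stride_split:
  assumes "1 \<le> j" "j < l"
  shows "stride l = stride j * (n j * (\<Prod>i=Suc j..<l. n i))"
proof -
  have "stride l = stride j * (\<Prod>i=j..<l. n i)"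
    unfolding stride_def using assms by (subst prod.atLeastLessThan_concat) auto
  then show ?thesis using assms by (simp add: prod.atLeast_Suc_lessThan)
qed

context
  assumes base_pos: "\<And>j. 1 \<le> n j"
begin

lemma stride_pos: "0 < stride j"
  using base_pos by (auto simp: stride_def intro!: prod_pos) (metis less_eq_Suc_le One_nat_def)

lemma stride_mono: "i \<le> j \<Longrightarrow> stride i \<le> stride j"
proof (induction j)
  case (Suc j)
  show ?case
  proof (cases "i = Suc j")
    case False
    then have "stride i \<le> stride j" using Suc by simp
    also have "\<dots> \<le> stride (Suc j)"
      using base_pos[of j] by (cases "j = 0") (auto simp: stride_Suc stride_def)
    finally show ?thesis .
  qed simp
qed simp

lemma digit_less: "digit j i < n j"
  using base_pos[of j] by (simp add: digit_def)

lemma mod_stride_Suc: "1 \<le> j \<Longrightarrow> i mod stride (Suc j) = i mod stride j + stride j * digit j i"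
  by (simp add: stride_Suc digit_def mod_mult2_eq)

lemma digit_zero: "i < stride j \<Longrightarrow> digit j i = 0"
  by (simp add: digit_def)

text \<open>Without a carry only digit j changes: for l < j the summand is a multiple of
  \<open>stride l * n l\<close>, and for l > j the quotient by \<open>stride l\<close> stays the
  same.\<close>

lemma digit_add_stride:
  assumes "1 \<le> j" "1 \<le> l" "digit j i + 1 < n j"
  shows "digit l (i + stride j) = (if l = j then digit j i + 1 else digit l i)"
proof -
  consider "l = j" | "l < j" | "j < l" by linarith
  then show ?thesis
  proof cases
    case 1
    have "(i + stride j) div stride j = i div stride j + 1" using stride_pos[of j] by simp
    moreover have "Suc (i div stride j) mod n j = Suc (i div stride j mod n j)"
      using assms(3) unfolding digit_def by (subst mod_Suc) auto
    ultimately show ?thesis using 1 by (simp add: digit_def)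
  next
    case 2
    define r where "r = (\<Prod>i=Suc l..<j. n i)"
    have "stride j = stride l * (n l * r)" using stride_split[OF assms(2) 2] by (simp add: r_def)
    then have "(i + stride j) div stride l = i div stride l + n l * r"
      using stride_pos[of l] by simp
    then show ?thesis using 2 by (simp add: digit_def)
  next
    case 3
    define r where "r = (\<Prod>i=Suc j..<l. n i)"
    have l: "stride l = stride j * (n j * r)" using stride_split[OF assms(1) 3] by (simp add: r_def)
    have "(i + stride j) div stride j = Suc (i div stride j)" using stride_pos[of j] by simp
    moreover have "Suc (i div stride j) div n j = i div stride j div n j"
      using assms(3) unfolding digit_def by (subst div_Suc, subst mod_Suc) auto
    ultimately have "(i + stride j) div stride l = i div stride l"
      by (simp add: l div_mult2_eq)
    then show ?thesis using 3 by (simp add: digit_def)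
  qed
qed

lemma digit_sub_stride:
  assumes "1 \<le> j" "1 \<le> l" "0 < digit j i"
  shows "stride j \<le> i" "digit l (i - stride j) = (if l = j then digit j i - 1 else digit l i)"
proof -
  show le: "stride j \<le> i" using digit_zero[of i j] assms by force
  define i' where "i' = i - stride j"
  have i: "i = i' + stride j" using le by (simp add: i'_def)
  have "i div stride j = Suc (i' div stride j)" using stride_pos[of j] by (simp add: i)
  then have "digit j i = Suc (i' div stride j) mod n j" by (simp add: digit_def)
  \<comment> \<open>Had digit j of i' been maximal, adding the stride would have wrapped it to
    0.\<close>
  then have "digit j i' + 1 < n j"
    using assms(3) base_pos[of j] by (auto simp: digit_def mod_Suc split: if_splits)
      (metis Suc_lessI le_numeral_extra(3) less_Suc0 mod_less_divisor not_less_eq_eq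
        One_nat_def bot_nat_0.not_eq_extremum)
  from digit_add_stride[OF assms(1,2) this] digit_add_stride[OF assms(1,1) this]
  show "digit l (i - stride j) = (if l = j then digit j i - 1 else digit l i)"
    by (simp add: i)
qed

text \<open>Leaving the range would mean that the quotient by \<open>stride j\<close> reaches a
  multiple of \<open>n j\<close>, so digit j would wrap to 0, contrary to the absence of a
  carry.\<close>

lemma add_stride_less:
  assumes "1 \<le> j" "j < e" "i < stride e" "digit j i + 1 < n j"
  shows "i + stride j < stride e"
proof -
  define r where "r = (\<Prod>i=Suc j..<e. n i)"
  have e: "stride e = stride j * (n j * r)" using stride_split[OF assms(1,2)] by (simp add: r_def)
  have sj: "0 < stride j" by (rule stride_pos)
  have nr: "0 < n j * r" using stride_pos[of e] e by simp
  have "i div stride j < n j * r" using assms(3) sj by (simp add: e less_mult_imp_div_less mult.commute)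
  moreover have "Suc (i div stride j) \<noteq> n j * r"
  proof
    assume "Suc (i div stride j) = n j * r"
    then have "Suc (i div stride j) mod n j = 0" by simp
    then show False using assms(4) by (simp add: digit_def mod_Suc split: if_splits)
  qed
  ultimately have "Suc (i div stride j) < n j * r" by simp
  then have "(i + stride j) div stride j < n j * r" using sj by simp
  then show ?thesis using sj unfolding e by (metis div_less_iff_less_mult mult.commute)
qed

text \<open>This is the shape in which the table is built: the codes using digit j consist of
  \<open>n j\<close> shifted copies of the codes using only the lower digits.\<close>

lemma digit_block:
  assumes "1 \<le> j" "1 \<le> l" "i < stride j" "k < n j"
  shows "digit l (k * stride j + i) = (if l = j then k else digit l i)"
  using assms(4)
proof (induction k)
  case 0
  then show ?case using assms by (auto simp: digit_zero)
next
  case (Suc k)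
  have j: "digit j (k * stride j + i) = k"
    using Suc assms stride_pos[of j] by (simp add: digit_def)
  have eq: "Suc k * stride j + i = k * stride j + i + stride j" by simp
  show ?case unfolding eq
    using digit_add_stride[OF assms(1,2), of "k * stride j + i"] j Suc by auto
qed

lemma digits_inj:
  assumes "i < stride (Suc d)" "k < stride (Suc d)" "\<And>j. j \<in> {1..d} \<Longrightarrow> digit j i = digit j k"
  shows "i = k"
proof -
  have "l \<le> d \<Longrightarrow> i mod stride (Suc l) = k mod stride (Suc l)" for l
  proof (induction l)
    case (Suc l)
    then show ?case using assms(3)[of "Suc l"] by (simp add: mod_stride_Suc)
  qed simp
  from this[of d] show ?thesis using assms by simp
qed

lemma digits_surj:
  assumes "\<And>j. j \<in> {1..d} \<Longrightarrow> e j < n j"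
  shows "\<exists>i<stride (Suc d). \<forall>j\<in>{1..d}. digit j i = e j"
  using assms
proof (induction d)
  case 0
  then show ?case by auto
next
  case (Suc d)
  then obtain i where i: "i < stride (Suc d)" "\<forall>j\<in>{1..d}. digit j i = e j" by auto
  have e: "e (Suc d) < n (Suc d)" using Suc by simp
  let ?i = "e (Suc d) * stride (Suc d) + i"
  have "?i < Suc (e (Suc d)) * stride (Suc d)" using i by simp
  also have "\<dots> \<le> n (Suc d) * stride (Suc d)" using e by (intro mult_right_mono) auto
  also have "\<dots> = stride (Suc (Suc d))" by (simp add: stride_Suc mult.commute)
  finally have "?i < stride (Suc (Suc d))" .
  moreover have "\<forall>j\<in>{1..Suc d}. digit j ?i = e j"
    using i e by (auto simp: digit_block)
  ultimately show ?case by blast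
qed

end

end

section \<open>Dynamic programming over grid configurations\<close>

locale sizing_grid =
  fixes I :: dc_instance and q :: nat
  assumes valid: "valid_instance I" and q_pos: "1 \<le> q"
begin

abbreviation "T \<equiv> slots I"
abbreviation "d \<equiv> types I"
abbreviation "\<beta> \<equiv> switch_cost I"

definition base :: "nat \<Rightarrow> nat" where "base j = Suc (grid_top q (servers I j))"

abbreviation "str \<equiv> stride base"
abbreviation "dig \<equiv> digit base"

definition N :: nat where "N = str (Suc d)"

definition row :: "nat \<Rightarrow> nat \<Rightarrow> nat" where "row i j = grid q (servers I j) (dig j i)"

text \<open>The first argument is the source, the second the target of the switching.\<close>

definition sw :: "nat \<Rightarrow> nat \<Rightarrow> real" where
  "sw k i = (\<Sum>j=1..d. \<beta> j * max (real (row i j) - real (row k j)) 0)"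

abbreviation serves :: "nat \<Rightarrow> nat \<Rightarrow> bool" where "serves t i \<equiv> can_serve I t (row i)"
abbreviation g :: "nat \<Rightarrow> nat \<Rightarrow> real" where "g t i \<equiv> real_slot_cost I t (row i)"

lemma base_pos: "1 \<le> base j" by (simp add: base_def)

lemma beta_pos: "j \<in> {1..d} \<Longrightarrow> 0 < \<beta> j"
  using valid unfolding valid_instance_def by auto

lemma N_pos: "0 < N" unfolding N_def by (rule stride_pos[where n = base, OF base_pos])

lemma dig_0: "dig j 0 = 0" using stride_pos[where n = base, OF base_pos, of j] by (rule digit_zero[where n = base, OF base_pos])

lemma row_0: "row 0 j = 0" by (simp add: row_def dig_0)

lemma dig_le: "dig j i \<le> grid_top q (servers I j)"
  using digit_less[where n = base, OF base_pos, of j i] by (simp add: base_def)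

lemma row_less_iff: "row i j < row k j \<longleftrightarrow> dig j i < dig j k"
  using grid_strict_mono[OF q_pos _ dig_le, of "dig j i" j k]
    grid_strict_mono[OF q_pos _ dig_le, of "dig j k" j i]
  unfolding row_def by (metis less_asym linorder_neqE_nat less_irrefl)

lemma row_le_iff: "row i j \<le> row k j \<longleftrightarrow> dig j i \<le> dig j k"
  using row_less_iff[of k j i] by (simp add: not_less[symmetric])

lemma row_pos_iff: "0 < row i j \<longleftrightarrow> 0 < dig j i"
  using row_less_iff[of 0 j i] by (simp add: row_0 dig_0)

lemma row_le: "row i j \<le> servers I j"
  unfolding row_def using grid_invariant[of q "servers I j"] by blast

lemma row_less_servers_iff: "row i j < servers I j \<longleftrightarrow> dig j i + 1 < base j"
proof
  assume "row i j < servers I j"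
  then have "dig j i \<noteq> grid_top q (servers I j)"
    using grid_top[OF q_pos, of "servers I j"] by (auto simp: row_def)
  then show "dig j i + 1 < base j" using dig_le[of j i] by (simp add: base_def)
next
  assume "dig j i + 1 < base j"
  then show "row i j < servers I j" unfolding row_def by (intro grid_less_top) (simp add: base_def)
qed

lemma up_neighbour:
  assumes "i < N" "j \<in> {1..d}" "row i j < servers I j"
  shows "i + str j < N" "l \<in> {1..d} \<Longrightarrow> dig l (i + str j) = (if l = j then dig j i + 1 else dig l i)"
  using assms add_stride_less[where n = base, OF base_pos, of j "Suc d" i] digit_add_stride[where n = base, OF base_pos, of j l i]
  by (auto simp: row_less_servers_iff N_def)

lemma down_neighbour:
  assumes "j \<in> {1..d}" "0 < row i j"
  shows "str j \<le> i" "l \<in> {1..d} \<Longrightarrow> dig l (i - str j) = (if l = j then dig j i - 1 else dig l i)"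
  using assms digit_sub_stride[where n = base, OF base_pos, of j j i] digit_sub_stride[where n = base, OF base_pos, of j l i]
  by (auto simp: row_pos_iff)

lemma rows_inj:
  assumes "i < N" "k < N" "\<And>j. j \<in> {1..d} \<Longrightarrow> row i j = row k j"
  shows "i = k"
proof (rule digits_inj[where n = base, OF base_pos])
  show "i < str (Suc d)" "k < str (Suc d)" using assms by (auto simp: N_def)
  show "dig j i = dig j k" if "j \<in> {1..d}" for j
    using assms(3)[OF that] row_le_iff[of i j k] row_le_iff[of k j i] by simp
qed

lemma rows_surj:
  assumes "\<And>j. j \<in> {1..d} \<Longrightarrow> x j \<in> grid q (servers I j) ` {..grid_top q (servers I j)}"
  shows "\<exists>i<N. \<forall>j\<in>{1..d}. row i j = x j"
proof -
  have "\<forall>j\<in>{1..d}. \<exists>e. e < base j \<and> x j = grid q (servers I j) e"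
  proof
    fix j assume "j \<in> {1..d}"
    from assms[OF this] show "\<exists>e. e < base j \<and> x j = grid q (servers I j) e"
      by (auto simp: base_def less_Suc_eq_le)
  qed
  then obtain e where e: "\<And>j. j \<in> {1..d} \<Longrightarrow> e j < base j \<and> x j = grid q (servers I j) (e j)"
    using bchoice[of "{1..d}" "\<lambda>j e. e < base j \<and> x j = grid q (servers I j) e"] by blast
  then obtain i where "i < str (Suc d)" "\<forall>j\<in>{1..d}. dig j i = e j"
    using digits_surj[where n = base, OF base_pos, of d e] by auto
  then show ?thesis using e by (auto simp: N_def row_def)
qed

text \<open>If some coordinate could still grow, the upper neighbour would have a code beyond the
  last one.\<close>

lemma row_top: "j \<in> {1..d} \<Longrightarrow> row (N - 1) j = servers I j"
proof -
  assume j: "j \<in> {1..d}"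
  show ?thesis
  proof (rule ccontr)
    assume "row (N - 1) j \<noteq> servers I j"
    then have "row (N - 1) j < servers I j" using row_le[of "N - 1" j] by simp
    then have "N - 1 + str j < N" using up_neighbour(1)[of "N - 1" j] j N_pos by simp
    moreover have "0 < str j" by (rule stride_pos[where n = base, OF base_pos])
    ultimately show False by simp
  qed
qed

lemma serves_top:
  assumes "feasible_schedule I X" "t \<in> {1..T}"
  shows "serves t (N - 1)"
proof -
  have "volume I t \<le> (\<Sum>j=1..d. real (X t j) * capacity I j)"
    using assms unfolding feasible_schedule_def by auto
  also have "\<dots> \<le> (\<Sum>j=1..d. real (row (N - 1) j) * capacity I j)"
  proof (intro sum_mono mult_right_mono)
    fix j assume j: "j \<in> {1..d}"
    show "real (X t j) \<le> real (row (N - 1) j)"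
      using assms j row_top[OF j] unfolding feasible_schedule_def is_schedule_def by auto
    show "0 \<le> capacity I j" using valid j unfolding valid_instance_def by (auto simp: less_imp_le)
  qed
  finally show ?thesis unfolding can_serve_def .
qed

lemma sw_eq_0: "(\<And>j. j \<in> {1..d} \<Longrightarrow> row i j \<le> row k j) \<Longrightarrow> sw k i = 0"
  unfolding sw_def by (intro sum.neutral) auto

text \<open>The triangle inequality through the lower neighbour in coordinate j. Equality holds if i
  is above k there: no grid point is skipped, so the neighbour is still at least as high as k and
  thus on a shortest path.\<close>

lemma sw_down_neighbour:
  assumes j: "j \<in> {1..d}" "0 < row i j"
  shows "sw k i \<le> sw k (i - str j) + \<beta> j * (real (row i j) - real (row (i - str j) j))"
    and "row k j < row i j \<Longrightarrow>
      sw k i = sw k (i - str j) + \<beta> j * (real (row i j) - real (row (i - str j) j))"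
proof -
  let ?i = "i - str j"
  have same: "row ?i l = row i l" if "l \<in> {1..d} - {j}" for l
    using down_neighbour(2)[OF j, of l] that by (simp add: row_def)
  have less: "dig j ?i < dig j i"
    using down_neighbour(2)[OF j, of j] j by (simp add: row_pos_iff)
  have split: "sw k i' = \<beta> j * max (real (row i' j) - real (row k j)) 0 +
      (\<Sum>l\<in>{1..d} - {j}. \<beta> l * max (real (row i' l) - real (row k l)) 0)" for i'
    unfolding sw_def using j by (subst sum.remove[of _ j]) auto
  have eq: "(\<Sum>l\<in>{1..d} - {j}. \<beta> l * max (real (row ?i l) - real (row k l)) 0) =
      (\<Sum>l\<in>{1..d} - {j}. \<beta> l * max (real (row i l) - real (row k l)) 0)"
    using same by (intro sum.cong) auto
  have ri: "row ?i j < row i j" using less by (simp add: row_less_iff)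
  have "\<beta> j * max (real (row i j) - real (row k j)) 0 \<le>
      \<beta> j * (max (real (row ?i j) - real (row k j)) 0 + (real (row i j) - real (row ?i j)))"
    using beta_pos[OF j(1)] ri by (intro mult_left_mono) auto
  then show "sw k i \<le> sw k ?i + \<beta> j * (real (row i j) - real (row ?i j))"
    unfolding split eq by (simp add: algebra_simps)
  assume "row k j < row i j"
  then have "dig j k \<le> dig j ?i"
    using down_neighbour(2)[OF j, of j] j by (simp add: row_less_iff)
  then have "row k j \<le> row ?i j" by (simp add: row_le_iff)
  then have "max (real (row i j) - real (row k j)) 0 =
      max (real (row ?i j) - real (row k j)) 0 + (real (row i j) - real (row ?i j))"
    using ri by auto
  then show "sw k i = sw k ?i + \<beta> j * (real (row i j) - real (row ?i j))"
    unfolding split eq by (simp only: distrib_left)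
qed

text \<open>The descending sweep computes the cheapest state from which \<open>i\<close> is reached by switching off
  servers, the ascending sweep then accounts for switching on.\<close>

lemma sweeps_optimal:
  assumes A_own: "\<And>i. i < N \<Longrightarrow> serves t i \<Longrightarrow> A i \<le> h i"
    and A_up: "\<And>i j. i < N \<Longrightarrow> j \<in> {1..d} \<Longrightarrow> row i j < servers I j \<Longrightarrow> A i \<le> A (i + str j)"
    and W_own: "\<And>i. i < N \<Longrightarrow> W i \<le> A i"
    and W_down: "\<And>i j. i < N \<Longrightarrow> j \<in> {1..d} \<Longrightarrow> 0 < row i j \<Longrightarrow>
      W i \<le> W (i - str j) + \<beta> j * (real (row i j) - real (row (i - str j) j))"
    and k: "k < N" "serves t k" and i: "i < N"
  shows "W i \<le> h k + sw k i"
proof -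
  \<comment> \<open>Climbing from i towards k, one coordinate and one grid point at a time, never
    leaves the region below k.\<close>
  have A: "A i \<le> h k" if "i < N" "\<forall>j\<in>{1..d}. row i j \<le> row k j" for i
    using that
  proof (induction "N - i" arbitrary: i rule: less_induct)
    case less
    show ?case
    proof (cases "\<forall>j\<in>{1..d}. row i j = row k j")
      case True
      then have "i = k" using rows_inj less.prems k by auto
      then show ?thesis using A_own k by simp
    next
      case False
      then obtain j where j: "j \<in> {1..d}" "row i j < row k j"
        using less.prems by (auto simp: less_le)
      then have s: "row i j < servers I j" using row_le[of k j] by simp
      note up = up_neighbour[OF less.prems(1) j(1) s]
      have "\<forall>l\<in>{1..d}. row (i + str j) l \<le> row k l"
        using up(2) j less.prems(2) by (auto simp: row_le_iff row_less_iff)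
      then have "A (i + str j) \<le> h k"
        using stride_pos[where n = base, OF base_pos, of j] up(1) less.prems by (intro less.hyps) auto
      then show ?thesis using A_up[OF less.prems(1) j(1) s] by simp
    qed
  qed
  \<comment> \<open>Any coordinate in which i exceeds k is lowered along a shortest path until the
    descending sweep covers i.\<close>
  show ?thesis using i
  proof (induction i rule: less_induct)
    case (less i)
    show ?case
    proof (cases "\<forall>j\<in>{1..d}. row i j \<le> row k j")
      case True
      then show ?thesis using A[OF less.prems] W_own[OF less.prems] sw_eq_0[of i k] by auto
    next
      case False
      then obtain j where j: "j \<in> {1..d}" "row k j < row i j" by (auto simp: not_le)
      then have pos: "0 < row i j" by simp
      have "str j \<le> i" "0 < str j" using down_neighbour(1)[OF j(1) pos] stride_pos[where n = base, OF base_pos] by auto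
      then have "W (i - str j) \<le> h k + sw k (i - str j)" using less by auto
      then show ?thesis
        using W_down[OF less.prems j(1) pos] sw_down_neighbour(2)[OF j(1) pos j(2)] by simp
    qed
  qed
qed

section \<open>Tables of the dynamic program and their traces\<close>

definition path_cost :: "(nat \<Rightarrow> nat) \<Rightarrow> nat \<Rightarrow> real" where
  "path_cost P n = (\<Sum>t=1..n. g t (P t) + sw (P (t - 1)) (P t))"

text \<open>The two inequalities together say that \<open>W t i\<close> is the minimum over all
  serving k, attained at \<open>Q t i\<close>. As the switching after slot t is included and
  switching off is free, the value sought is \<open>W n 0\<close>.\<close>

definition dp_tables :: "(nat \<Rightarrow> nat \<Rightarrow> real) \<Rightarrow> (nat \<Rightarrow> nat \<Rightarrow> nat) \<Rightarrow> nat \<Rightarrow> bool" where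
  "dp_tables W Q n \<longleftrightarrow> (\<forall>i<N. W 0 i = sw 0 i) \<and>
     (\<forall>t\<in>{1..n}. \<forall>i<N. Q t i < N \<and> serves t (Q t i) \<and>
        W (t - 1) (Q t i) + g t (Q t i) + sw (Q t i) i \<le> W t i \<and>
        (\<forall>k<N. serves t k \<longrightarrow> W t i \<le> W (t - 1) k + g t k + sw k i))"

lemma dp_le_path_cost:
  assumes "dp_tables W Q n" "P 0 = 0" "\<And>t. t \<in> {1..n} \<Longrightarrow> P t < N \<and> serves t (P t)"
  shows "l \<le> n \<Longrightarrow> i < N \<Longrightarrow> W l i \<le> path_cost P l + sw (P l) i"
proof (induction l arbitrary: i)
  case 0
  then show ?case using assms unfolding dp_tables_def by (simp add: path_cost_def)
next
  case (Suc l)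
  have P: "P (Suc l) < N" "serves (Suc l) (P (Suc l))" using assms(3)[of "Suc l"] Suc.prems by auto
  have "W (Suc l) i \<le> W l (P (Suc l)) + g (Suc l) (P (Suc l)) + sw (P (Suc l)) i"
    using assms(1) Suc.prems P unfolding dp_tables_def by (auto dest!: bspec[of _ _ "Suc l"])
  also have "W l (P (Suc l)) \<le> path_cost P l + sw (P l) (P (Suc l))" using Suc P by simp
  finally show ?case by (simp add: path_cost_def)
qed

text \<open>Following \<open>Q\<close> backwards from the configuration 0 after the last slot
  realises the table entry. Validity of the codes is proved backwards in time, the cost bound
  forwards.\<close>

lemma trace_cost_le_dp:
  assumes "dp_tables W Q n" "u (Suc n) = 0" "\<And>t. t \<in> {1..n} \<Longrightarrow> u t = Q t (u (Suc t))" "u 0 = 0"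
  shows "\<And>t. t \<in> {1..n} \<Longrightarrow> u t < N \<and> serves t (u t)"
    and "path_cost u n \<le> W n 0"
proof -
  have uS: "u (Suc n - k) < N" if "k \<le> n" for k using that
  proof (induction k)
    case 0
    then show ?case using assms N_pos by simp
  next
    case (Suc k)
    define t where "t = Suc n - Suc k"
    have t: "t \<in> {1..n}" "Suc t = Suc n - k" using Suc by (auto simp: t_def)
    have "Q t (u (Suc t)) < N" using assms(1) t Suc unfolding dp_tables_def by simp
    then show ?case using assms(3)[OF t(1)] by (simp add: t_def)
  qed
  have u: "u (Suc t) < N" if "t \<le> n" for t
    using uS[of "n - t"] that by (simp add: Suc_diff_le)
  show "u t < N \<and> serves t (u t)" if t: "t \<in> {1..n}" for t
    using assms(1) assms(3)[OF t] u[of t] t unfolding dp_tables_def by auto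
  have "path_cost u l + sw (u l) (u (Suc l)) \<le> W l (u (Suc l))" if "l \<le> n" for l
    using that
  proof (induction l)
    case 0
    then show ?case using assms u[of 0] unfolding dp_tables_def by (simp add: path_cost_def)
  next
    case (Suc l)
    have "W l (u (Suc l)) + g (Suc l) (u (Suc l)) + sw (u (Suc l)) (u (Suc (Suc l))) \<le>
        W (Suc l) (u (Suc (Suc l)))"
      using assms(1) assms(3)[of "Suc l"] u[of "Suc l"] Suc.prems unfolding dp_tables_def
      by (auto dest!: bspec[of _ _ "Suc l"])
    then show ?case using Suc by (simp add: path_cost_def)
  qed
  from this[of n] show "path_cost u n \<le> W n 0"
    using assms(2) sw_eq_0[of 0 "u n"] by (simp add: row_0)
qed

text \<open>The types are rounded independently: the grid is a product, the switching cost is a sum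
  over types, and \<open>real_slot_cost_scale\<close> needs only a bound in each coordinate.\<close>

lemma grid_path:
  assumes Y: "feasible_schedule I Y" and \<epsilon>: "2 / real q \<le> \<epsilon>"
  obtains P where "P 0 = 0" "\<And>t. t \<in> {1..T} \<Longrightarrow> P t < N \<and> serves t (P t)"
    "path_cost P T \<le> (1 + \<epsilon>) * real_schedule_cost I Y"
proof -
  have "0 < 2 / real q" using q_pos by simp
  then have \<epsilon>0: "0 < 1 + \<epsilon>" using \<epsilon> by linarith
  let ?G = "\<lambda>j. grid q (servers I j) ` {..grid_top q (servers I j)}"
  define good where "good j y \<longleftrightarrow> y 0 = 0 \<and>
     (\<forall>t\<le>T. y t \<in> ?G j \<and> Y t j \<le> y t \<and> real (y t) \<le> (1 + \<epsilon>) * real (Y t j)) \<and>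
     (\<Sum>t=1..T. max (real (y t) - real (y (t - 1))) 0) \<le>
     (1 + \<epsilon>) * (\<Sum>t=1..T. max (real (Y t j) - real (Y (t - 1) j)) 0)" for j and y :: "nat \<Rightarrow> nat"
  have "\<exists>y. good j y" if j: "j \<in> {1..d}" for j
  proof -
    have Y0: "Y 0 j = 0" using Y j unfolding feasible_schedule_def is_schedule_def by simp
    have Ym: "Y t j \<le> servers I j" if "t \<le> T" for t
      using Y Y0 j that unfolding feasible_schedule_def is_schedule_def by (cases "t = 0") auto
    interpret sparse_grid "?G j" "servers I j" "1 + 1 / real q" "1 + \<epsilon>"
      by (rule sparse_grid_grid[OF q_pos \<epsilon>])
    show ?thesis unfolding good_def
      by (rule rounding[of "\<lambda>t. Y t j" T, OF Y0 Ym]) auto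
  qed
  then obtain y where "\<And>j. j \<in> {1..d} \<Longrightarrow> good j (y j)" by metis
  then have y0: "\<And>j. j \<in> {1..d} \<Longrightarrow> y j 0 = 0"
    and y: "\<And>j t. j \<in> {1..d} \<Longrightarrow> t \<le> T \<Longrightarrow>
      y j t \<in> ?G j \<and> Y t j \<le> y j t \<and> real (y j t) \<le> (1 + \<epsilon>) * real (Y t j)"
    and ysw: "\<And>j. j \<in> {1..d} \<Longrightarrow> (\<Sum>t=1..T. max (real (y j t) - real (y j (t - 1))) 0) \<le>
     (1 + \<epsilon>) * (\<Sum>t=1..T. max (real (Y t j) - real (Y (t - 1) j)) 0)"
    unfolding good_def by blast+
  have "\<exists>i<N. \<forall>j\<in>{1..d}. row i j = y j t" if "t \<le> T" for t
    using rows_surj[of "\<lambda>j. y j t"] y that by blast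
  then obtain P' where P': "\<And>t. t \<le> T \<Longrightarrow> P' t < N \<and> (\<forall>j\<in>{1..d}. row (P' t) j = y j t)"
    by metis
  \<comment> \<open>The rounded schedule is 0 at time 0 in every type, so the code 0 represents it
    there.\<close>
  define P where "P t = (if t = 0 then 0 else P' t)" for t
  have P: "P t < N" "\<And>j. j \<in> {1..d} \<Longrightarrow> row (P t) j = y j t" if "t \<le> T" for t
    using P'[OF that] y0 N_pos by (auto simp: P_def row_0)
  have serve: "can_serve I t (Y t)" if "t \<in> {1..T}" for t
    using Y that unfolding feasible_schedule_def can_serve_def by auto
  have cmp: "Y t j \<le> row (P t) j \<and> real (row (P t) j) \<le> (1 + \<epsilon>) * real (Y t j)"
    if "t \<in> {1..T}" "j \<in> {1..d}" for t j
    using y[OF that(2), of t] P(2)[of t j] that by auto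
  have gP: "serves t (P t)" "g t (P t) \<le> (1 + \<epsilon>) * real_slot_cost I t (Y t)" if "t \<in> {1..T}" for t
    using real_slot_cost_scale[where x = "Y t" and y = "row (P t)", OF valid that \<epsilon>0 _ serve[OF that]] cmp[OF that]
    by blast+
  have "path_cost P T = (\<Sum>t=1..T. g t (P t)) + (\<Sum>t=1..T. sw (P (t - 1)) (P t))"
    by (simp add: path_cost_def sum.distrib)
  also have "(\<Sum>t=1..T. sw (P (t - 1)) (P t)) =
      (\<Sum>t=1..T. \<Sum>j=1..d. \<beta> j * max (real (y j t) - real (y j (t - 1))) 0)"
    unfolding sw_def using P(2) by (intro sum.cong refl) auto
  also have "\<dots> = (\<Sum>j=1..d. \<beta> j * (\<Sum>t=1..T. max (real (y j t) - real (y j (t - 1))) 0))"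
    by (subst sum.swap) (simp add: sum_distrib_left)
  also have "\<dots> \<le> (\<Sum>j=1..d. \<beta> j * ((1 + \<epsilon>) * (\<Sum>t=1..T. max (real (Y t j) - real (Y (t - 1) j)) 0)))"
    using ysw beta_pos by (intro sum_mono mult_left_mono) (auto simp: less_imp_le)
  also have "\<dots> = (1 + \<epsilon>) * (\<Sum>t=1..T. \<Sum>j=1..d. \<beta> j * max (real (Y t j) - real (Y (t - 1) j)) 0)"
    by (subst sum.swap) (simp add: sum_distrib_left mult_ac)
  also have "(\<Sum>t=1..T. g t (P t)) \<le> (1 + \<epsilon>) * (\<Sum>t=1..T. real_slot_cost I t (Y t))"
    unfolding sum_distrib_left using gP(2) by (rule sum_mono)
  finally have "path_cost P T \<le> (1 + \<epsilon>) * real_schedule_cost I Y"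
    by (simp add: real_schedule_cost_def sum.distrib distrib_left)
  moreover have "P 0 = 0" by (simp add: P_def)
  ultimately show ?thesis using that P(1) gP(1) by auto
qed

text \<open>The table entry \<open>W T 0\<close> separates the two sides: the traced schedule costs
  at most that, and the rounded version of any feasible schedule costs at least that.\<close>

theorem trace_approximates:
  assumes dp: "dp_tables W Q T" and u: "u (Suc T) = 0" "\<And>t. t \<in> {1..T} \<Longrightarrow> u t = Q t (u (Suc t))"
    and X: "\<And>t j. X t j = (if t \<in> {1..T} \<and> j \<in> {1..d} then row (u t) j else 0)"
    and \<epsilon>: "2 / real q \<le> \<epsilon>"
  shows "feasible_schedule I X"
    and "feasible_schedule I Y \<Longrightarrow> real_schedule_cost I X \<le> (1 + \<epsilon>) * real_schedule_cost I Y"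
proof -
  \<comment> \<open>The trace says nothing about time 0, where all servers have to be off.\<close>
  define u' where "u' t = (if t = 0 then 0 else u t)" for t
  have u': "u' (Suc T) = 0" "\<And>t. t \<in> {1..T} \<Longrightarrow> u' t = Q t (u' (Suc t))" "u' 0 = 0"
    using u by (auto simp: u'_def)
  have tr: "u' t < N \<and> serves t (u' t)" if "t \<in> {1..T}" for t
    using trace_cost_le_dp(1)[where u = u', OF dp u'(1) _ u'(3) that] u'(2) by blast
  have Xu: "X t j = row (u' t) j" if "t \<le> T" "j \<in> {1..d}" for t j
    using that by (auto simp: X u'_def row_0)
  have "can_serve I t (X t)" if "t \<in> {1..T}" for t
    using tr[OF that] that Xu[of t] unfolding can_serve_def by simp
  then show "feasible_schedule I X"
    unfolding feasible_schedule_def is_schedule_def can_serve_def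
    by (auto simp: X row_le)
  assume Y: "feasible_schedule I Y"
  obtain P where P: "P 0 = 0" "\<And>t. t \<in> {1..T} \<Longrightarrow> P t < N \<and> serves t (P t)"
    "path_cost P T \<le> (1 + \<epsilon>) * real_schedule_cost I Y"
    using grid_path[OF Y \<epsilon>] by blast
  have "real_schedule_cost I X = path_cost u' T"
    unfolding real_schedule_cost_def path_cost_def
  proof (intro sum.cong refl arg_cong2[where f = "(+)"])
    fix t assume t: "t \<in> {1..T}"
    show "real_slot_cost I t (X t) = g t (u' t)"
      unfolding real_slot_cost_def using Xu t by (intro arg_cong[where f = real_of_ereal] slot_cost_cong) auto
    show "(\<Sum>j=1..d. \<beta> j * max (real (X t j) - real (X (t - 1) j)) 0) = sw (u' (t - 1)) (u' t)"
      unfolding sw_def using Xu t by (intro sum.cong) auto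
  qed
  also have "\<dots> \<le> W T 0" using trace_cost_le_dp(2)[where u = u', OF dp u'(1) _ u'(3)] u'(2) by blast
  also have "\<dots> \<le> path_cost P T"
    using dp_le_path_cost[where P = P, OF dp P(1,2), of T 0] N_pos sw_eq_0[of 0 "P T"] by (simp add: row_0)
  also note P(3)
  finally show "real_schedule_cost I X \<le> (1 + \<epsilon>) * real_schedule_cost I Y" .
qed

end

section \<open>A calculus for running times\<close>

text \<open>A total correctness statement with a time budget. Since execution is deterministic, the
  existence of one such run determines all runs. The rules marked \<open>simp\<close> below execute
  straight-line code symbolically and subtract its cost from the budget.\<close>

definition runs :: "dc_instance \<Rightarrow> com \<Rightarrow> mem \<Rightarrow> nat \<Rightarrow> (mem \<Rightarrow> bool) \<Rightarrow> bool" where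
  "runs I c s b Q \<longleftrightarrow> (\<exists>n s'. exec I c s n s' \<and> n \<le> b \<and> Q s')"

lemma runs_mono:
  "runs I c s b Q \<Longrightarrow> b \<le> b' \<Longrightarrow> (\<And>s'. Q s' \<Longrightarrow> Q' s') \<Longrightarrow> runs I c s b' Q'"
  unfolding runs_def by (meson order_trans)

lemma runs_Skip [simp]: "runs I Skip s b Q \<longleftrightarrow> 1 \<le> b \<and> Q s"
  unfolding runs_def using exec.Skip[of I s] by (auto elim: SkipE)

lemma runs_NAssign [simp]:
  "runs I (NAssign a i e) s b Q \<longleftrightarrow>
     1 + ntime i + ntime e \<le> b \<and> Q (nat_update a (nval i s) (nval e s) s)"
  unfolding runs_def using exec.NAssign[of I a i e s] by (auto elim: NAssignE)

lemma runs_RAssign [simp]: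
  "runs I (RAssign a i e) s b Q \<longleftrightarrow>
     1 + ntime i + rtime e \<le> b \<and> Q (real_update a (nval i s) (rval e s) s)"
  unfolding runs_def using exec.RAssign[of I a i e s] by (auto elim: RAssignE)

lemma runs_Eval:
  assumes "nval t s \<in> {1..slots I}" "slot_cost I (nval t s) (\<lambda>j. nats s a (nval b s + j)) = ereal v"
    and "1 + ntime i + ntime t + ntime b \<le> n" "Q (real_update y (nval i s) v s)"
  shows "runs I (Eval y i t a b) s n Q"
  unfolding runs_def using exec.Eval[OF assms(1,2)] assms(3,4) by blast

lemma runs_Seq:
  assumes "runs I c1 s b1 (\<lambda>s'. runs I c2 s' b2 Q)" "b1 + b2 \<le> b"
  shows "runs I (Seq c1 c2) s b Q"
  using assms unfolding runs_def by (meson add_mono exec.Seq order_trans)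

lemma runs_If [simp]:
  "runs I (If e c1 c2) s b Q \<longleftrightarrow> 1 + btime e \<le> b \<and>
     (if bval e s then runs I c1 s (b - (1 + btime e)) Q else runs I c2 s (b - (1 + btime e)) Q)"
proof
  assume "runs I (If e c1 c2) s b Q"
  then show "1 + btime e \<le> b \<and>
     (if bval e s then runs I c1 s (b - (1 + btime e)) Q else runs I c2 s (b - (1 + btime e)) Q)"
    unfolding runs_def by (auto elim!: IfE) force+
next
  assume R: "1 + btime e \<le> b \<and>
     (if bval e s then runs I c1 s (b - (1 + btime e)) Q else runs I c2 s (b - (1 + btime e)) Q)"
  show "runs I (If e c1 c2) s b Q"
  proof (cases "bval e s")
    case True
    with R obtain n s' where "exec I c1 s n s'" "n \<le> b - (1 + btime e)" "Q s'" by (auto simp: runs_def)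
    then show ?thesis using exec.IfTrue[OF True, of I c1 n s' c2] R
      unfolding runs_def by (intro exI[of _ "1 + btime e + n"] exI[of _ s']) auto
  next
    case False
    with R obtain n s' where "exec I c2 s n s'" "n \<le> b - (1 + btime e)" "Q s'" by (auto simp: runs_def)
    then show ?thesis using exec.IfFalse[OF False, of I c2 n s' c1] R
      unfolding runs_def by (intro exI[of _ "1 + btime e + n"] exI[of _ s']) auto
  qed
qed

fun block :: "com list \<Rightarrow> com" where
  "block [] = Skip"
| "block (c # cs) = Seq c (block cs)"

lemma runs_Seq_NAssign [simp]:
  "runs I (Seq (NAssign a i e) c) s b Q \<longleftrightarrow> 1 + ntime i + ntime e \<le> b \<and>
     runs I c (nat_update a (nval i s) (nval e s) s) (b - (1 + ntime i + ntime e)) Q"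
proof
  assume "runs I (Seq (NAssign a i e) c) s b Q"
  then show "1 + ntime i + ntime e \<le> b \<and>
     runs I c (nat_update a (nval i s) (nval e s) s) (b - (1 + ntime i + ntime e)) Q"
    unfolding runs_def by (auto elim!: SeqE NAssignE) force
qed (auto intro!: runs_Seq[where ?b1.0 = "1 + ntime i + ntime e"])

lemma runs_Seq_RAssign [simp]:
  "runs I (Seq (RAssign a i e) c) s b Q \<longleftrightarrow> 1 + ntime i + rtime e \<le> b \<and>
     runs I c (real_update a (nval i s) (rval e s) s) (b - (1 + ntime i + rtime e)) Q"
proof
  assume "runs I (Seq (RAssign a i e) c) s b Q"
  then show "1 + ntime i + rtime e \<le> b \<and>
     runs I c (real_update a (nval i s) (rval e s) s) (b - (1 + ntime i + rtime e)) Q"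
    unfolding runs_def by (auto elim!: SeqE RAssignE) force
qed (auto intro!: runs_Seq[where ?b1.0 = "1 + ntime i + rtime e"])

lemma runs_Seq_Skip [simp]:
  "runs I (Seq Skip c) s b Q \<longleftrightarrow> 1 \<le> b \<and> runs I c s (b - 1) Q"
proof
  assume "runs I (Seq Skip c) s b Q"
  then show "1 \<le> b \<and> runs I c s (b - 1) Q"
    unfolding runs_def by (auto elim!: SeqE SkipE) force
qed (auto intro!: runs_Seq[where ?b1.0 = 1])

text \<open>The continuation moves into both branches, so that symbolic execution can go on without
  an intermediate assertion.\<close>

lemma runs_Seq_If [simp]:
  "runs I (Seq (If e c1 c2) c) s b Q \<longleftrightarrow> 1 + btime e \<le> b \<and>
     (if bval e s then runs I (Seq c1 c) s (b - (1 + btime e)) Q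
      else runs I (Seq c2 c) s (b - (1 + btime e)) Q)"
proof -
  have "exec I (Seq (If e c1 c2) c) s n s' \<longleftrightarrow>
      (\<exists>m. n = 1 + btime e + m \<and> exec I (Seq (if bval e s then c1 else c2) c) s m s')" for n s'
  proof
    assume "exec I (Seq (If e c1 c2) c) s n s'"
    then show "\<exists>m. n = 1 + btime e + m \<and> exec I (Seq (if bval e s then c1 else c2) c) s m s'"
      by (elim SeqE IfE) (auto intro: exec.Seq)
  next
    assume "\<exists>m. n = 1 + btime e + m \<and> exec I (Seq (if bval e s then c1 else c2) c) s m s'"
    then obtain n1 n2 s1 where "exec I (if bval e s then c1 else c2) s n1 s1" "exec I c s1 n2 s'"
      "n = 1 + btime e + n1 + n2" by (auto elim!: SeqE)
    moreover from this have "exec I (If e c1 c2) s (1 + btime e + n1) s1"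
      by (cases "bval e s") (auto dest: exec.IfTrue exec.IfFalse)
    ultimately show "exec I (Seq (If e c1 c2) c) s n s'" using exec.Seq by blast
  qed
  note ex = this
  have "runs I (Seq (If e c1 c2) c) s b Q \<longleftrightarrow> 1 + btime e \<le> b \<and>
     runs I (Seq (if bval e s then c1 else c2) c) s (b - (1 + btime e)) Q" (is "?L \<longleftrightarrow> ?R")
  proof
    assume ?L
    then obtain m s' where "1 + btime e + m \<le> b" "Q s'"
      "exec I (Seq (if bval e s then c1 else c2) c) s m s'"
      unfolding runs_def ex by blast
    then show ?R unfolding runs_def by (intro conjI exI[of _ m] exI[of _ s']) auto
  next
    assume ?R
    then obtain m s' where "1 + btime e \<le> b" "m \<le> b - (1 + btime e)" "Q s'"
      "exec I (Seq (if bval e s then c1 else c2) c) s m s'"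
      unfolding runs_def by blast
    then show ?L unfolding runs_def ex
      by (intro exI[of _ "1 + btime e + m"] exI[of _ s'] conjI exI[of _ m] refl) auto
  qed
  then show ?thesis by simp
qed

lemma mem_update [simp]:
  "nats (nat_update a i v s) = (nats s)(a := (nats s a)(i := v))"
  "nats (real_update a i r s) = nats s"
  "reals (nat_update a i v s) = reals s"
  "reals (real_update a i r s) = (reals s)(a := (reals s a)(i := r))"
  by (simp_all add: nat_update_def real_update_def)

section \<open>Frame conditions\<close>

fun nat_writes :: "com \<Rightarrow> vname set" where
  "nat_writes Skip = {}"
| "nat_writes (NAssign a i e) = {a}"
| "nat_writes (RAssign a i e) = {}"
| "nat_writes (Eval y i t a b) = {}"
| "nat_writes (Seq c1 c2) = nat_writes c1 \<union> nat_writes c2"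
| "nat_writes (If b c1 c2) = nat_writes c1 \<union> nat_writes c2"
| "nat_writes (While b c) = nat_writes c"

fun real_writes :: "com \<Rightarrow> vname set" where
  "real_writes Skip = {}"
| "real_writes (NAssign a i e) = {}"
| "real_writes (RAssign a i e) = {a}"
| "real_writes (Eval y i t a b) = {y}"
| "real_writes (Seq c1 c2) = real_writes c1 \<union> real_writes c2"
| "real_writes (If b c1 c2) = real_writes c1 \<union> real_writes c2"
| "real_writes (While b c) = real_writes c"

definition agree :: "vname set \<Rightarrow> vname set \<Rightarrow> mem \<Rightarrow> mem \<Rightarrow> bool" where
  "agree A B s s' \<longleftrightarrow> (\<forall>a. a \<notin> A \<longrightarrow> nats s' a = nats s a) \<and> (\<forall>a. a \<notin> B \<longrightarrow> reals s' a = reals s a)"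

lemma agree_refl: "agree A B s s" by (simp add: agree_def)

lemma agree_trans: "agree A B s s' \<Longrightarrow> agree A B s' s'' \<Longrightarrow> agree A B s s''"
  by (simp add: agree_def)

lemma agree_mono: "agree A B s s' \<Longrightarrow> A \<subseteq> A' \<Longrightarrow> B \<subseteq> B' \<Longrightarrow> agree A' B' s s'"
  by (auto simp: agree_def)

lemma exec_agree: "exec I c s n s' \<Longrightarrow> agree (nat_writes c) (real_writes c) s s'"
  by (induction rule: exec.induct) (auto simp: agree_def)

lemma runs_agree:
  "runs I c s b Q \<Longrightarrow> runs I c s b (\<lambda>s'. Q s' \<and> agree (nat_writes c) (real_writes c) s s')"
  unfolding runs_def using exec_agree by blast

lemma runs_Seq_agree:
  assumes "runs I c1 s b1 R" "b1 + b2 \<le> b"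
    and "\<And>s'. R s' \<Longrightarrow> agree (nat_writes c1) (real_writes c1) s s' \<Longrightarrow> runs I c2 s' b2 Q"
  shows "runs I (Seq c1 c2) s b Q"
  by (rule runs_Seq[OF runs_mono[OF runs_agree[OF assms(1)] order_refl] assms(2)])
    (use assms(3) in blast)

text \<open>\<open>P k\<close> describes the state after k rounds. The frame relative to the initial
  state is supplied automatically, so invariants need to mention only what the body changes.\<close>

lemma runs_While:
  assumes "P 0 s"
    and step: "\<And>k s'. k < n \<Longrightarrow> P k s' \<Longrightarrow> agree (nat_writes c) (real_writes c) s s' \<Longrightarrow>
      bval e s' \<and> runs I c s' b (P (Suc k))"
    and exit: "\<And>s'. P n s' \<Longrightarrow> agree (nat_writes c) (real_writes c) s s' \<Longrightarrow> \<not> bval e s' \<and> Q s'"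
    and "n * (1 + btime e + b) + 1 + btime e \<le> t"
  shows "runs I (While e c) s t Q"
proof -
  have "runs I (While e c) s' ((n - k) * (1 + btime e + b) + 1 + btime e) Q"
    if "k \<le> n" "P k s'" "agree (nat_writes c) (real_writes c) s s'" for k s'
    using that
  proof (induction "n - k" arbitrary: k s')
    case 0
    then have "\<not> bval e s' \<and> Q s'" using exit by simp
    then show ?case unfolding runs_def using exec.WhileFalse[of e s' I c] by force
  next
    case (Suc l)
    then have k: "k < n" by simp
    with step[OF k] Suc.prems have "bval e s'" "runs I c s' b (P (Suc k))" by auto
    then obtain n1 s1 where s1: "exec I c s' n1 s1" "n1 \<le> b" "P (Suc k) s1"
      by (auto simp: runs_def)
    have "agree (nat_writes c) (real_writes c) s s1"
      using exec_agree[OF s1(1)] Suc.prems(3) agree_trans by blast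
    then have "runs I (While e c) s1 ((n - Suc k) * (1 + btime e + b) + 1 + btime e) Q"
      using Suc.hyps(1)[of "Suc k" s1] Suc.hyps(2) k s1(3) by auto
    then obtain n2 s2 where s2: "exec I (While e c) s1 n2 s2"
      "n2 \<le> (n - Suc k) * (1 + btime e + b) + 1 + btime e" "Q s2"
      by (auto simp: runs_def)
    have "n - k = Suc (n - Suc k)" using k by simp
    then have "1 + btime e + n1 + n2 \<le> (n - k) * (1 + btime e + b) + 1 + btime e"
      using s1(2) s2(2) by simp
    then show ?case
      unfolding runs_def using exec.WhileTrue[OF \<open>bval e s'\<close> s1(1) s2(1)] s2(3) by blast
  qed
  from this[of 0 s] assms(1,4) show ?thesis
    by (auto simp: agree_refl intro: runs_mono)
qed

abbreviation nvar :: "vname \<Rightarrow> nexp" where "nvar a \<equiv> NRead a (NConst 0)"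
abbreviation nset :: "vname \<Rightarrow> nexp \<Rightarrow> com" where "nset a e \<equiv> NAssign a (NConst 0) e"

definition For :: "vname \<Rightarrow> nexp \<Rightarrow> nexp \<Rightarrow> com \<Rightarrow> com" where
  "For x lo hi c = Seq (nset x lo)
     (While (NLess (nvar x) hi) (Seq c (nset x (NAdd (nvar x) (NConst 1)))))"

lemma writes_For [simp]:
  "nat_writes (For x lo hi c) = insert x (nat_writes c)"
  "real_writes (For x lo hi c) = real_writes c"
  by (auto simp: For_def)

text \<open>The bound \<open>hi\<close> is evaluated before every round and has to be stable, and
  the invariant must not depend on the cell of x. A round costs b, 6 for the increment and
  \<open>4 + ntime hi\<close> for the test.\<close>

lemma runs_For:
  assumes lo: "nval lo s = l" "l \<le> h"
    and init: "P l s"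
    and local: "\<And>k s' v. P k s' \<Longrightarrow> P k (nat_update x 0 v s')"
    and hi: "\<And>k s'. P k s' \<Longrightarrow> agree (insert x (nat_writes c)) (real_writes c) s s' \<Longrightarrow> nval hi s' = h"
    and fresh: "x \<notin> nat_writes c"
    and step: "\<And>k s'. l \<le> k \<Longrightarrow> k < h \<Longrightarrow> P k s' \<Longrightarrow> nats s' x 0 = k \<Longrightarrow>
      agree (insert x (nat_writes c)) (real_writes c) s s' \<Longrightarrow> runs I c s' b (P (Suc k))"
    and exit: "\<And>s'. P h s' \<Longrightarrow> agree (insert x (nat_writes c)) (real_writes c) s s' \<Longrightarrow> Q s'"
    and bound: "(h - l) * (b + 10 + ntime hi) + 6 + ntime lo + ntime hi \<le> t"
  shows "runs I (For x lo hi c) s t Q"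
proof -
  let ?s = "nat_update x 0 l s"
  let ?c = "Seq c (nset x (NAdd (nvar x) (NConst 1)))"
  have ag: "agree (insert x (nat_writes c)) (real_writes c) s ?s" by (simp add: agree_def)
  define P' where "P' k s' \<longleftrightarrow> P (l + k) s' \<and> nats s' x 0 = l + k" for k s'
  have "runs I (While (NLess (nvar x) hi) ?c) ?s
      ((h - l) * (b + 10 + ntime hi) + 4 + ntime hi) Q"
  proof (rule runs_While[where P = P' and n = "h - l" and b = "b + 6"])
    show "P' 0 ?s" using init local by (simp add: P'_def)
  next
    fix k s' assume k: "k < h - l" "P' k s'" and a: "agree (nat_writes ?c) (real_writes ?c) ?s s'"
    have a': "agree (insert x (nat_writes c)) (real_writes c) s s'"
      using agree_trans[OF ag] a by (simp add: insert_commute agree_mono)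
    have "runs I c s' b (\<lambda>s''. P (Suc (l + k)) s'' \<and> agree (nat_writes c) (real_writes c) s' s'')"
      using k a' by (intro runs_agree step) (auto simp: P'_def)
    then have "runs I c s' b (\<lambda>s''. runs I (nset x (NAdd (nvar x) (NConst 1))) s'' 6 (P' (Suc k)))"
    proof (rule runs_mono)
      fix s'' assume "P (Suc (l + k)) s'' \<and> agree (nat_writes c) (real_writes c) s' s''"
      then show "runs I (nset x (NAdd (nvar x) (NConst 1))) s'' 6 (P' (Suc k))"
        using k fresh local[of "Suc (l + k)" s''] by (simp add: P'_def agree_def)
    qed simp
    then have "runs I ?c s' (b + 6) (P' (Suc k))" by (rule runs_Seq) simp
    moreover have "bval (NLess (nvar x) hi) s'" using k hi[OF _ a', of "l + k"] by (simp add: P'_def)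
    ultimately show "bval (NLess (nvar x) hi) s' \<and> runs I ?c s' (b + 6) (P' (Suc k))" by simp
  next
    fix s' assume k: "P' (h - l) s'" and a: "agree (nat_writes ?c) (real_writes ?c) ?s s'"
    have a': "agree (insert x (nat_writes c)) (real_writes c) s s'"
      using agree_trans[OF ag] a by (simp add: insert_commute agree_mono)
    show "\<not> bval (NLess (nvar x) hi) s' \<and> Q s'"
      using k hi[OF _ a', of h] exit[OF _ a'] lo by (simp add: P'_def)
  qed (simp add: algebra_simps)
  then show ?thesis unfolding For_def using lo(1) bound
    by (intro runs_Seq[where ?b1.0 = "2 + ntime lo" and
      ?b2.0 = "(h - l) * (b + 10 + ntime hi) + 4 + ntime hi"]) simp_all
qed

section \<open>Tabulating the configurations\<close>

text \<open>With \<open>N\<close> configurations in total, row \<open>i\<close> of the table occupies the cells \<open>i * d + 1, \<dots>, i * d + d\<close>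
  of the array \<open>V\<close>, its capacity is \<open>cap[i]\<close>, and \<open>S[j]\<close> is the distance between rows adjacent in
  coordinate \<open>j\<close>.  The cell \<open>t * N + i\<close> of \<open>W\<close> holds the cost of being in configuration \<open>i\<close> just after
  the switching that follows slot \<open>t\<close>, and that of \<open>Q\<close> the configuration used in slot \<open>t\<close>.\<close>

abbreviation incr :: "vname \<Rightarrow> com" where "incr a \<equiv> nset a (NAdd (nvar a) (NConst 1))"

text \<open>The rounded quotient is found by counting, as the machine cannot round; the
  O(1/\<epsilon>) steps are within the bound because d is at least 1.\<close>

definition find_precision :: com where
  "find_precision = Seq (nset ''q'' (NConst 1))
     (While (RLess (RMul (RNat (nvar ''q'')) (RRead ''eps'' (NConst 0))) (RNat (NConst 2))) (incr ''q''))"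

definition copy_row :: "vname \<Rightarrow> com" where
  "copy_row a = For ''e'' (NConst 1) (NAdd (nvar ''d'') (NConst 1))
     (NAssign a (NAdd (nvar ''b'') (nvar ''e'')) (NRead ''V'' (NAdd (nvar ''c'') (nvar ''e''))))"

text \<open>Coordinate j of the copied row is still 0, so raising it to v adds v times the unit
  value to the capacity and to the cost of switching on. The latter starts \<open>W\<close> with the
  entries for slot 0.\<close>

definition store_row :: com where
  "store_row = block [
     NAssign ''V'' (NAdd (nvar ''b'') (nvar ''j'')) (nvar ''v''),
     RAssign ''W'' (nvar ''N'')
       (RAdd (RRead ''W'' (nvar ''i'')) (RMul (RRead ''beta'' (nvar ''j'')) (RNat (nvar ''v'')))),
     RAssign ''cap'' (nvar ''N'')
       (RAdd (RRead ''cap'' (nvar ''i'')) (RMul (RNat (nvar ''v'')) (RRead ''zmax'' (nvar ''j'')))),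
     incr ''N'']"

definition add_row :: com where
  "add_row =
     Seq (nset ''b'' (NMul (nvar ''N'') (nvar ''d'')))
    (Seq (nset ''c'' (NMul (nvar ''i'') (nvar ''d'')))
    (Seq (copy_row ''V'') store_row))"

definition next_value :: com where
  "next_value = block [
     If (NLess (nvar ''v'') (NMul (NMul (NConst 2) (nvar ''q'')) (nvar ''s'')))
       Skip (nset ''s'' (NMul (NConst 2) (nvar ''s''))),
     nset ''v'' (NAdd (nvar ''v'') (nvar ''s'')),
     If (NLess (NRead ''m'' (nvar ''j'')) (nvar ''v'')) (nset ''v'' (NRead ''m'' (nvar ''j''))) Skip]"

text \<open>One block of the mixed radix table: the rows for the earlier types are appended once
  more, with the new value in coordinate j.\<close>

definition add_value :: com where
  "add_value = Seq next_value (For ''i'' (NConst 0) (NRead ''S'' (nvar ''j'')) add_row)"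

definition add_values :: com where
  "add_values = While (NLess (nvar ''v'') (NRead ''m'' (nvar ''j''))) add_value"

definition add_type :: com where
  "add_type = Seq (NAssign ''S'' (nvar ''j'') (nvar ''N''))
     (Seq (nset ''v'' (NConst 0)) (Seq (nset ''s'' (NConst 1)) add_values))"

definition build_table :: com where
  "build_table = Seq (nset ''N'' (NConst 1))
     (For ''j'' (NConst 1) (NAdd (nvar ''d'') (NConst 1)) add_type)"

lemma writes_copy_row [simp]:
  "nat_writes (copy_row a) = {''e'', a}" "real_writes (copy_row a) = {}"
  by (auto simp: copy_row_def)

lemma writes_add_row [simp]:
  "nat_writes add_row = {''b'', ''c'', ''e'', ''V'', ''N''}" "real_writes add_row = {''W'', ''cap''}"
  by (auto simp: add_row_def store_row_def)

lemma writes_add_value [simp]: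
  "nat_writes add_value = {''b'', ''c'', ''e'', ''V'', ''N'', ''s'', ''v'', ''i''}"
  "real_writes add_value = {''W'', ''cap''}"
  by (auto simp: add_value_def next_value_def)

lemma writes_add_type [simp]:
  "nat_writes add_type = {''b'', ''c'', ''e'', ''V'', ''N'', ''s'', ''v'', ''i'', ''S''}"
  "real_writes add_type = {''W'', ''cap''}"
  by (auto simp: add_type_def add_values_def)

lemma agree_nats: "agree A B s s' \<Longrightarrow> a \<notin> A \<Longrightarrow> nats s' a = nats s a"
  by (simp add: agree_def)

lemma agree_reals: "agree A B s s' \<Longrightarrow> a \<notin> B \<Longrightarrow> reals s' a = reals s a"
  by (simp add: agree_def)

lemma runs_weaken: "runs I c s b Q \<Longrightarrow> b \<le> b' \<Longrightarrow> runs I c s b' Q"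
  by (rule runs_mono)

lemma runs_find_precision:
  assumes eps: "reals s ''eps'' 0 = \<epsilon>" "0 < \<epsilon>" "\<epsilon> < 1"
    and exit: "\<And>s'. agree {''q''} {} s s' \<Longrightarrow> nats s' ''q'' 0 = nat \<lceil>2 / \<epsilon>\<rceil> \<Longrightarrow> Q s'"
    and bound: "16 * nat \<lceil>2 / \<epsilon>\<rceil> + 20 \<le> t"
  shows "runs I find_precision s t Q"
proof -
  define q where "q = nat \<lceil>2 / \<epsilon>\<rceil>"
  have "0 < 2 / \<epsilon>" using eps by simp
  then have q: "1 \<le> q" unfolding q_def by linarith
  have less: "real k * \<epsilon> < 2 \<longleftrightarrow> k < q" for k
  proof -
    have "real k * \<epsilon> < 2 \<longleftrightarrow> real k < 2 / \<epsilon>" using eps by (simp add: field_simps)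
    also have "\<dots> \<longleftrightarrow> k < q" unfolding q_def by linarith
    finally show ?thesis .
  qed
  have "runs I (While (RLess (RMul (RNat (nvar ''q'')) (RRead ''eps'' (NConst 0))) (RNat (NConst 2))) (incr ''q''))
      (nat_update ''q'' 0 1 s) (16 * (q - 1) + 20) Q"
  proof (rule runs_While[where P = "\<lambda>k s'. nats s' ''q'' 0 = Suc k" and n = "q - 1" and b = 6])
    fix k s' assume "k < q - 1" "nats s' ''q'' 0 = Suc k"
      "agree (nat_writes (incr ''q'')) (real_writes (incr ''q'')) (nat_update ''q'' 0 1 s) s'"
    then show "bval (RLess (RMul (RNat (nvar ''q'')) (RRead ''eps'' (NConst 0))) (RNat (NConst 2))) s' \<and>
        runs I (incr ''q'') s' 6 (\<lambda>s'. nats s' ''q'' 0 = Suc (Suc k))"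
      using eps less[of "Suc k"] by (auto simp: agree_def)
  next
    fix s' assume "nats s' ''q'' 0 = Suc (q - 1)"
      "agree (nat_writes (incr ''q'')) (real_writes (incr ''q'')) (nat_update ''q'' 0 1 s) s'"
    then show "\<not> bval (RLess (RMul (RNat (nvar ''q'')) (RRead ''eps'' (NConst 0))) (RNat (NConst 2))) s' \<and> Q s'"
      using eps less[of q] q exit[of s'] by (auto simp: agree_def q_def)
  qed auto
  then have "runs I find_precision s (3 + (16 * (q - 1) + 20)) Q"
    unfolding find_precision_def by (intro runs_Seq[where ?b1.0 = 3, OF _ order_refl]) simp
  then show ?thesis by (rule runs_weaken) (use bound q in \<open>simp add: q_def\<close>)
qed

text \<open>When \<open>V\<close> is copied within itself, the source has to end before the target
  begins, so that no cell is overwritten before it is read.\<close>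

lemma runs_copy_row:
  assumes s: "nats s ''d'' 0 = d" "nats s ''b'' 0 = p" "nats s ''c'' 0 = r"
    and disjoint: "a \<noteq> ''V'' \<or> r + d \<le> p" and fresh: "a \<notin> {''b'', ''c'', ''d'', ''e''}"
    and exit: "\<And>s'. agree {''e'', a} {} s s' \<Longrightarrow>
      nats s' a = (\<lambda>k. if p < k \<and> k \<le> p + d then nats s ''V'' (k - p + r) else nats s a k) \<Longrightarrow> Q s'"
    and bound: "26 * d + 11 \<le> t"
  shows "runs I (copy_row a) s t Q"
  unfolding copy_row_def
proof (rule runs_For[where h = "Suc d" and l = 1 and b = 12 and P = "\<lambda>e s'. nats s' a =
      (\<lambda>k. if p < k \<and> k < p + e then nats s ''V'' (k - p + r) else nats s a k)"], goal_cases)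
  case (7 e s')
  have "nats s' ''V'' (r + e) = nats s ''V'' (r + e)"
    using 7 disjoint by (cases "a = ''V''") (auto simp: agree_def)
  moreover have "nats s' ''b'' 0 = p" "nats s' ''c'' 0 = r"
    using s fresh agree_nats[OF 7(5)] by auto
  ultimately show ?case using 7(1-4) fresh by (simp add: fun_eq_iff add.commute)
next
  case (5 e s')
  then show ?case using s fresh agree_nats[OF 5(2), of "''d''"] by auto
next
  case (8 s')
  then have "nats s' a = (\<lambda>k. if p < k \<and> k \<le> p + d then nats s ''V'' (k - p + r) else nats s a k)"
    by (simp add: less_Suc_eq_le)
  then show ?case using 8(2) by (intro exit) simp_all
qed (use s fresh bound in auto)

section \<open>Correctness of the tabulation\<close>

context sizing_grid
begin

definition inputs :: "mem \<Rightarrow> bool" where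
  "inputs s \<longleftrightarrow> nats s ''T'' 0 = T \<and> nats s ''d'' 0 = d \<and> nats s ''q'' 0 = q \<and>
     (\<forall>j\<in>{1..d}. nats s ''m'' j = servers I j \<and> reals s ''beta'' j = \<beta> j \<and>
        reals s ''zmax'' j = capacity I j) \<and>
     (\<forall>t\<in>{1..T}. reals s ''lambda'' t = volume I t)"

definition tab :: "nat \<Rightarrow> mem \<Rightarrow> bool" where
  "tab n s \<longleftrightarrow> nats s ''N'' 0 = n \<and>
     (\<forall>i<n. (\<forall>j\<in>{1..d}. nats s ''V'' (i * d + j) = row i j) \<and> reals s ''W'' i = sw 0 i \<and>
        reals s ''cap'' i = (\<Sum>j=1..d. real (row i j) * capacity I j))"

lemma inputs_agree:
  assumes "agree A B s s'" "inputs s" "''T'' \<notin> A" "''d'' \<notin> A" "''q'' \<notin> A" "''m'' \<notin> A"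
    "''beta'' \<notin> B" "''zmax'' \<notin> B" "''lambda'' \<notin> B"
  shows "inputs s'"
  using assms(2) unfolding inputs_def
  by (simp add: agree_nats[OF assms(1)] agree_reals[OF assms(1)] assms(3-))

text \<open>The weights f are instantiated with the switching costs and with the capacities, the two
  sums that the table maintains incrementally.\<close>

lemma row_block:
  assumes "i < str j" "k < base j" "j \<in> {1..d}"
  shows "row i j = 0"
    "l \<in> {1..d} \<Longrightarrow> row (k * str j + i) l = (if l = j then grid q (servers I j) k else row i l)"
    "(\<Sum>l=1..d. f l * real (row (k * str j + i) l)) =
     (\<Sum>l=1..d. f l * real (row i l)) + f j * real (grid q (servers I j) k)"
proof -
  show 0: "row i j = 0" using digit_zero[where n = base, OF base_pos assms(1)] by (simp add: row_def)
  show l: "row (k * str j + i) l = (if l = j then grid q (servers I j) k else row i l)"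
    if "l \<in> {1..d}" for l
    using digit_block[where n = base, OF base_pos, of j l i k] assms that by (auto simp: row_def)
  have "(\<Sum>l=1..d. f l * real (row (k * str j + i) l)) =
      (\<Sum>l=1..d. f l * real (row i l) + (if l = j then f j * real (grid q (servers I j) k) else 0))"
    using l 0 by (intro sum.cong) auto
  then show "(\<Sum>l=1..d. f l * real (row (k * str j + i) l)) =
     (\<Sum>l=1..d. f l * real (row i l)) + f j * real (grid q (servers I j) k)"
    using assms(3) by (simp add: sum.distrib)
qed

lemma sw_0: "sw 0 i = (\<Sum>j=1..d. \<beta> j * real (row i j))"
  by (simp add: sw_def row_0)

lemma cell_less:
  assumes "j \<in> {1..d}" "l \<in> {1..d}" "i < k"
  shows "i * d + j < k * d + l"
proof -
  have "Suc i * d \<le> k * d" using assms(3) by (intro mult_right_mono) auto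
  then show ?thesis using assms by auto
qed

lemma tab_Suc:
  assumes "tab n s" "nats s' ''N'' 0 = Suc n"
    and "\<And>i j. i < n \<Longrightarrow> j \<in> {1..d} \<Longrightarrow> nats s' ''V'' (i * d + j) = nats s ''V'' (i * d + j)"
    and "\<And>j. j \<in> {1..d} \<Longrightarrow> nats s' ''V'' (n * d + j) = row n j"
    and "\<And>i. i < n \<Longrightarrow> reals s' ''W'' i = reals s ''W'' i" "reals s' ''W'' n = sw 0 n"
    and "\<And>i. i < n \<Longrightarrow> reals s' ''cap'' i = reals s ''cap'' i"
    and "reals s' ''cap'' n = (\<Sum>j=1..d. real (row n j) * capacity I j)"
  shows "tab (Suc n) s'"
  using assms unfolding tab_def by (simp add: less_Suc_eq all_conj_distrib)

lemma runs_add_row: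
  assumes inp: "inputs s" and tab: "tab (k * str j + i) s" and i: "i < str j"
    and k: "1 \<le> k" "k < base j" and j: "j \<in> {1..d}"
    and s: "nats s ''i'' 0 = i" "nats s ''j'' 0 = j" "nats s ''v'' 0 = grid q (servers I j) k"
    and bound: "26 * d + 100 \<le> t"
  shows "runs I add_row s t (tab (Suc (k * str j + i)))"
proof -
  let ?n = "k * str j + i"
  \<comment> \<open>As k is at least 1, the source row i is strictly earlier than the new row, which
    gives the disjointness needed for copying.\<close>
  have "str j \<le> k * str j" using k by simp
  then have in_n: "i < ?n" using i by linarith
  then have "Suc i * d \<le> ?n * d" by (intro mult_right_mono) auto
  then have dis: "i * d + d \<le> ?n * d" by simp
  have N: "nats s ''N'' 0 = ?n" and d: "nats s ''d'' 0 = d"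
    and bz: "reals s ''beta'' j = \<beta> j" "reals s ''zmax'' j = capacity I j"
    and Wi: "reals s ''W'' i = sw 0 i" "reals s ''cap'' i = (\<Sum>j=1..d. real (row i j) * capacity I j)"
    and Vi: "\<And>l. l \<in> {1..d} \<Longrightarrow> nats s ''V'' (i * d + l) = row i l"
    using tab inp in_n j unfolding tab_def inputs_def by auto
  define s2 where "s2 = nat_update ''c'' 0 (i * d) (nat_update ''b'' 0 (?n * d) s)"
  have R: "runs I (Seq (copy_row ''V'') store_row) s2 (26 * d + 71) (tab (Suc ?n))"
  proof (rule runs_Seq[where ?b1.0 = "26 * d + 11" and ?b2.0 = 60],
      rule runs_copy_row[where d = d and p = "?n * d" and r = "i * d"])
    fix s' assume ag: "agree {''e'', ''V''} {} s2 s'" and V: "nats s' ''V'' =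
      (\<lambda>c. if ?n * d < c \<and> c \<le> ?n * d + d then nats s2 ''V'' (c - ?n * d + i * d) else nats s2 ''V'' c)"
    have vals: "nats s' ''N'' 0 = ?n" "nats s' ''i'' 0 = i" "nats s' ''j'' 0 = j"
      "nats s' ''v'' 0 = grid q (servers I j) k" "nats s' ''b'' 0 = ?n * d"
      "reals s' ''beta'' j = \<beta> j" "reals s' ''zmax'' j = capacity I j"
      "reals s' ''W'' = reals s ''W''" "reals s' ''cap'' = reals s ''cap''"
      using ag s N d bz by (auto simp: agree_def s2_def)
    have V_old: "nats s' ''V'' (i' * d + l) = nats s ''V'' (i' * d + l)" if "i' < ?n" "l \<in> {1..d}" for i' l
    proof -
      have "Suc i' * d \<le> ?n * d" using that by (intro mult_right_mono) auto
      then show ?thesis using that by (auto simp: V s2_def)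
    qed
    have V_new: "nats s' ''V'' (?n * d + l) = row i l" if "l \<in> {1..d}" for l
      using that Vi[OF that] by (auto simp: V s2_def add.commute)
    define s3 where "s3 = nat_update ''N'' 0 (Suc ?n) (real_update ''cap'' ?n
      (reals s ''cap'' i + real (grid q (servers I j) k) * capacity I j) (real_update ''W'' ?n
      (reals s ''W'' i + \<beta> j * real (grid q (servers I j) k))
      (nat_update ''V'' (?n * d + j) (grid q (servers I j) k) s')))"
    have "tab (Suc ?n) s3"
    proof (rule tab_Suc[OF tab], goal_cases)
      case (2 i' l)
      then show ?case using V_old[OF 2] cell_less[OF 2(2) j 2(1)] by (simp add: s3_def)
    next
      case (3 l)
      then show ?case using V_new[OF 3] row_block(2)[OF i k(2) j 3] by (simp add: s3_def)
    next
      case 5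
      then show ?case using Wi(1) row_block(3)[OF i k(2) j, of \<beta>] by (simp add: s3_def sw_0)
    next
      case 7
      then show ?case using Wi(2) row_block(3)[OF i k(2) j, of "capacity I"]
        by (simp add: s3_def mult.commute)
    qed (simp_all add: s3_def vals)
    then show "runs I store_row s' 60 (tab (Suc ?n))"
      by (simp add: store_row_def vals s3_def)
  qed (use d dis in \<open>auto simp: s2_def\<close>)
  show ?thesis
    unfolding add_row_def using bound N s d
    by (simp add: s2_def[symmetric] runs_weaken[OF R])
qed

lemma tab_agree:
  assumes "agree A B s s'" "tab n s" "''N'' \<notin> A" "''V'' \<notin> A" "''W'' \<notin> B" "''cap'' \<notin> B"
  shows "tab n s'"
  using assms(2) unfolding tab_def
  by (simp add: agree_nats[OF assms(1)] agree_reals[OF assms(1)] assms(3-))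

lemma runs_next_value:
  assumes "inputs s" "j \<in> {1..d}" "nats s ''j'' 0 = j"
    "grid_state q (servers I j) k = (nats s ''v'' 0, nats s ''s'' 0)"
  shows "runs I next_value s 60
    (\<lambda>s'. grid_state q (servers I j) (Suc k) = (nats s' ''v'' 0, nats s' ''s'' 0))"
proof -
  have "nats s ''q'' 0 = q" "nats s ''m'' j = servers I j"
    using assms unfolding inputs_def by auto
  then show ?thesis
    unfolding next_value_def using assms(3,4) by (auto simp: grid_state_Suc Let_def)
qed

lemma runs_add_value:
  assumes inp: "inputs s" and tab: "tab (Suc k * str j) s" and j: "j \<in> {1..d}"
    and k: "Suc k < base j"
    and s: "nats s ''j'' 0 = j" "nats s ''S'' j = str j"
      "grid_state q (servers I j) k = (nats s ''v'' 0, nats s ''s'' 0)"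
  shows "runs I add_value s (str j * (26 * d + 113) + 80)
    (\<lambda>s'. tab (Suc (Suc k) * str j) s' \<and>
       grid_state q (servers I j) (Suc k) = (nats s' ''v'' 0, nats s' ''s'' 0))"
  unfolding add_value_def
proof (rule runs_Seq_agree[where ?b2.0 = "str j * (26 * d + 113) + 10", OF runs_next_value[OF inp j s(1,3)]])
  fix s1 assume st: "grid_state q (servers I j) (Suc k) = (nats s1 ''v'' 0, nats s1 ''s'' 0)"
    and "agree (nat_writes next_value) (real_writes next_value) s s1"
  then have ag: "agree {''s'', ''v''} {} s s1"
    by (auto simp: next_value_def insert_commute)
  have inp1: "inputs s1" by (rule inputs_agree[OF ag inp]) simp_all
  have tab1: "tab (Suc k * str j) s1" by (rule tab_agree[OF ag tab]) simp_all
  have s1: "nats s1 ''j'' 0 = j" "nats s1 ''S'' j = str j"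
    using s agree_nats[OF ag] by simp_all
  show "runs I (For ''i'' (NConst 0) (NRead ''S'' (nvar ''j'')) add_row) s1 (str j * (26 * d + 113) + 10)
    (\<lambda>s'. tab (Suc (Suc k) * str j) s' \<and>
       grid_state q (servers I j) (Suc k) = (nats s' ''v'' 0, nats s' ''s'' 0))"
  proof (rule runs_For[where l = 0 and h = "str j" and b = "26 * d + 100" and
        P = "\<lambda>i. tab (Suc k * str j + i)"], goal_cases)
    case 3
    then show ?case using tab1 by simp
  next
    case (4 i s' v)
    then show ?case by (simp add: tab_def)
  next
    case (5 i s')
    then show ?case using s1 agree_nats[OF 5(2)] by simp
  next
    case (7 i s')
    note ag' = agree_nats[OF 7(5)]
    show ?case unfolding add_Suc_right
    proof (rule runs_add_row[where j = j])
      show "inputs s'" by (rule inputs_agree[OF 7(5) inp1]) simp_all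
      show "nats s' ''v'' 0 = grid q (servers I j) (Suc k)" using st ag' by simp
    qed (use 7 j k s1 ag' in simp_all)
  next
    case (8 s')
    then show ?case using st agree_nats[OF 8(2)] by (simp add: add.commute)
  qed simp_all
qed simp

lemma runs_add_type:
  assumes inp: "inputs s" and tab: "tab (str j) s" and j: "j \<in> {1..d}"
    and s: "nats s ''j'' 0 = j"
  shows "runs I add_type s (N * (26 * d + 210) + 50)
    (\<lambda>s'. tab (str (Suc j)) s' \<and> nats s' ''S'' = (nats s ''S'')(j := str j))"
proof -
  define s1 where "s1 = nat_update ''s'' 0 (Suc 0) (nat_update ''v'' 0 0 (nat_update ''S'' j (str j) s))"
  let ?m = "servers I j"
  have ag: "agree {''s'', ''v'', ''S''} {} s s1" by (simp add: s1_def agree_def)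
  have inp1: "inputs s1" by (rule inputs_agree[OF ag inp]) simp_all
  have m: "nats s1 ''m'' j = ?m" using inp1 j by (simp add: inputs_def)
  have top: "str j * base j = str (Suc j)" using stride_Suc[of j base] j by simp
  have "runs I add_values s1 (grid_top q ?m * (7 + (str j * (26 * d + 113) + 80)) + 7)
      (\<lambda>s'. tab (str (Suc j)) s' \<and> nats s' ''S'' = (nats s ''S'')(j := str j))"
    unfolding add_values_def
  \<comment> \<open>After k rounds there are k + 1 blocks; block 0, for value 0, is the table of the
    earlier types and needs no work.\<close>
  proof (rule runs_While[where n = "grid_top q ?m" and b = "str j * (26 * d + 113) + 80" and
        P = "\<lambda>k s'. tab (Suc k * str j) s' \<and> grid_state q ?m k = (nats s' ''v'' 0, nats s' ''s'' 0)"], goal_cases)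
    case 1
    have "tab (str j) s1" by (rule tab_agree[OF ag tab]) simp_all
    then show ?case by (simp add: s1_def)
  next
    case (2 k s')
    note ag' = agree_nats[OF 2(3)]
    have "grid q ?m k < ?m" using 2(1) by (rule grid_less_top)
    then have "bval (NLess (nvar ''v'') (NRead ''m'' (nvar ''j''))) s'"
      using 2 m ag' s by (simp add: s1_def)
    moreover have "inputs s'" by (rule inputs_agree[OF 2(3) inp1]) simp_all
    moreover have "nats s' ''j'' 0 = j" "nats s' ''S'' j = str j" using ag' s by (simp_all add: s1_def)
    ultimately show ?case using 2 j by (intro conjI runs_add_value) (auto simp: base_def)
  next
    case (3 s')
    note ag' = agree_nats[OF 3(2)]
    have "nats s' ''v'' 0 = ?m" using 3(1) grid_top[OF q_pos, of ?m] by simp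
    moreover have "tab (str (Suc j)) s'"
      using 3(1) top by (simp add: base_def mult.commute)
    moreover have "nats s' ''S'' = (nats s ''S'')(j := str j)" using ag' by (simp add: s1_def)
    ultimately show ?case using ag' m s by (simp add: s1_def)
  next
    case 4
    then show ?case by simp
  qed
  \<comment> \<open>Each round appends \<open>str j\<close> rows at O(d) steps each, and all blocks
    of type j together have at most \<open>N\<close> rows.\<close>
  moreover have "grid_top q ?m * (7 + (str j * (26 * d + 113) + 80)) + 7 \<le> N * (26 * d + 210) + 10"
  proof -
    have le: "str j * base j \<le> N"
      unfolding top N_def using j by (intro stride_mono[where n = base, OF base_pos]) auto
    have "1 \<le> str j" using stride_pos[where n = base, OF base_pos, of j] by simp
    then have "grid_top q ?m * (7 + (str j * (26 * d + 113) + 80)) \<le>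
        base j * (str j * 87 + str j * (26 * d + 113))"
      by (intro mult_mono) (auto simp: base_def)
    also have "\<dots> = (str j * base j) * (26 * d + 200)" by (simp add: algebra_simps)
    also have "\<dots> \<le> N * (26 * d + 200)" using le by (intro mult_right_mono) auto
    finally show ?thesis by (simp add: algebra_simps)
  qed
  ultimately have R: "runs I add_values s1 (N * (26 * d + 210) + 10)
      (\<lambda>s'. tab (str (Suc j)) s' \<and> nats s' ''S'' = (nats s ''S'')(j := str j))"
    by (rule runs_weaken)
  have "nats s ''N'' 0 = str j" using tab by (simp add: tab_def)
  then show ?thesis
    unfolding add_type_def using s by (simp add: s1_def[symmetric] runs_weaken[OF R])
qed

definition strides :: "mem \<Rightarrow> bool" where
  "strides s \<longleftrightarrow> (\<forall>j\<in>{1..d}. nats s ''S'' j = str j)"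

lemma runs_build_table:
  assumes inp: "inputs s" and zero: "nats s ''V'' = (\<lambda>_. 0)" "reals s ''W'' = (\<lambda>_. 0)" "reals s ''cap'' = (\<lambda>_. 0)"
  shows "runs I build_table s (d * (N * (26 * d + 210) + 70) + 30) (\<lambda>s'. tab N s' \<and> strides s')"
proof -
  define s1 where "s1 = nat_update ''N'' 0 1 s"
  have ag: "agree {''N''} {} s s1" by (simp add: s1_def agree_def)
  have inp1: "inputs s1" by (rule inputs_agree[OF ag inp]) simp_all
  have "runs I (For ''j'' (NConst 1) (NAdd (nvar ''d'') (NConst 1)) add_type) s1
      (d * (N * (26 * d + 210) + 64) + 11) (\<lambda>s'. tab N s' \<and> strides s')"
  proof (rule runs_For[where l = 1 and h = "Suc d" and b = "N * (26 * d + 210) + 50" and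
        P = "\<lambda>j s'. tab (str j) s' \<and> (\<forall>l\<in>{1..<j}. nats s' ''S'' l = str l)"], goal_cases)
    case 3
    then show ?case using zero by (simp add: tab_def s1_def row_0 sw_0)
  next
    case (4 i s' v)
    then show ?case by (simp add: tab_def)
  next
    case (5 i s')
    then show ?case using inp1 agree_nats[OF 5(2)] by (simp add: inputs_def)
  next
    case (7 j s')
    have "inputs s'" by (rule inputs_agree[OF 7(5) inp1]) simp_all
    then have "runs I add_type s' (N * (26 * d + 210) + 50)
        (\<lambda>s''. tab (str (Suc j)) s'' \<and> nats s'' ''S'' = (nats s' ''S'')(j := str j))"
      using 7 by (intro runs_add_type) auto
    then show ?case
      by (rule runs_mono) (use 7 in \<open>auto simp: less_Suc_eq\<close>)
  next
    case (8 s')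
    then show ?case by (auto simp: N_def strides_def)
  qed simp_all
  note R = this
  show ?thesis unfolding build_table_def
    by (simp add: s1_def[symmetric] del: One_nat_def) (rule runs_weaken[OF R], simp add: algebra_simps)
qed

end

section \<open>Processing a time slot\<close>

text \<open>A configuration that cannot serve the volume would have infinite cost.  It takes over the entry
  of the last row instead, where all servers are on: from there it is reached for free.\<close>

definition seed_state :: com where
  "seed_state = If (BNot (RLess (RRead ''cap'' (nvar ''i'')) (RRead ''lambda'' (nvar ''t''))))
     (Seq (Eval ''g'' (NConst 0) (nvar ''t'') ''V'' (NMul (nvar ''i'') (nvar ''d'')))
     (Seq (RAssign ''A'' (nvar ''i'')
        (RAdd (RRead ''W'' (NAdd (nvar ''p'') (nvar ''i''))) (RRead ''g'' (NConst 0))))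
     (NAssign ''R'' (nvar ''i'') (nvar ''i''))))
     (Seq (RAssign ''A'' (nvar ''i'') (RRead ''A'' (NSub (nvar ''N'') (NConst 1))))
     (NAssign ''R'' (nvar ''i'') (NRead ''R'' (NSub (nvar ''N'') (NConst 1)))))"

abbreviation above :: nexp where "above \<equiv> NAdd (nvar ''i'') (NRead ''S'' (nvar ''j''))"
abbreviation below :: nexp where "below \<equiv> NSub (nvar ''i'') (NRead ''S'' (nvar ''j''))"
abbreviation level :: "nexp \<Rightarrow> nexp" where
  "level k \<equiv> NRead ''V'' (NAdd (NMul k (nvar ''d'')) (nvar ''j''))"

definition relax_up :: com where
  "relax_up = If (BAnd (NLess (level (nvar ''i'')) (NRead ''m'' (nvar ''j'')))
       (RLess (RRead ''A'' above) (RRead ''A'' (nvar ''i''))))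
     (Seq (RAssign ''A'' (nvar ''i'') (RRead ''A'' above))
       (NAssign ''R'' (nvar ''i'') (NRead ''R'' above))) Skip"

text \<open>\<open>For\<close> only counts upwards, so the descending index is computed from the
  counter \<open>r\<close>.\<close>

definition descend_step :: com where
  "descend_step = Seq (nset ''i'' (NSub (NSub (nvar ''N'') (NConst 1)) (nvar ''r'')))
     (Seq seed_state (For ''j'' (NConst 1) (NAdd (nvar ''d'') (NConst 1)) relax_up))"

definition descend :: com where
  "descend = For ''r'' (NConst 0) (nvar ''N'') descend_step"

abbreviation candidate :: rexp where
  "candidate \<equiv> RAdd (RRead ''W'' (NAdd (nvar ''o'') below))
     (RMul (RRead ''beta'' (nvar ''j'')) (RSub (RNat (level (nvar ''i''))) (RNat (level below))))"

definition relax_down :: com where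
  "relax_down = If (BAnd (NLess (NConst 0) (level (nvar ''i'')))
       (RLess candidate (RRead ''W'' (NAdd (nvar ''o'') (nvar ''i'')))))
     (Seq (RAssign ''W'' (NAdd (nvar ''o'') (nvar ''i'')) candidate)
       (NAssign ''Q'' (NAdd (nvar ''o'') (nvar ''i'')) (NRead ''Q'' (NAdd (nvar ''o'') below)))) Skip"

definition ascend_step :: com where
  "ascend_step = Seq (RAssign ''W'' (NAdd (nvar ''o'') (nvar ''i'')) (RRead ''A'' (nvar ''i'')))
     (Seq (NAssign ''Q'' (NAdd (nvar ''o'') (nvar ''i'')) (NRead ''R'' (nvar ''i'')))
     (For ''j'' (NConst 1) (NAdd (nvar ''d'') (NConst 1)) relax_down))"

definition ascend :: com where
  "ascend = For ''i'' (NConst 0) (nvar ''N'') ascend_step"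

definition slot_step :: com where
  "slot_step = Seq (nset ''p'' (NMul (NSub (nvar ''t'') (NConst 1)) (nvar ''N'')))
     (Seq (nset ''o'' (NMul (nvar ''t'') (nvar ''N''))) (Seq descend ascend))"

definition all_slots :: com where
  "all_slots = For ''t'' (NConst 1) (NAdd (nvar ''T'') (NConst 1)) slot_step"

lemma writes_sweeps [simp]:
  "nat_writes seed_state = {''R''}" "real_writes seed_state = {''A'', ''g''}"
  "nat_writes relax_up = {''R''}" "real_writes relax_up = {''A''}"
  "nat_writes descend_step = {''R'', ''i'', ''j''}" "real_writes descend_step = {''A'', ''g''}"
  "nat_writes descend = {''R'', ''i'', ''j'', ''r''}" "real_writes descend = {''A'', ''g''}"
  "nat_writes relax_down = {''Q''}" "real_writes relax_down = {''W''}"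
  "nat_writes ascend_step = {''Q'', ''j''}" "real_writes ascend_step = {''W''}"
  "nat_writes ascend = {''Q'', ''i'', ''j''}" "real_writes ascend = {''W''}"
  "nat_writes slot_step = {''R'', ''Q'', ''i'', ''j'', ''r'', ''p'', ''o''}"
  "real_writes slot_step = {''A'', ''g'', ''W''}"
  by (auto simp: seed_state_def relax_up_def descend_step_def descend_def
      relax_down_def ascend_step_def ascend_def slot_step_def)

section \<open>Correctness of the two sweeps\<close>

context sizing_grid
begin

definition ready :: "mem \<Rightarrow> bool" where
  "ready s \<longleftrightarrow> inputs s \<and> strides s \<and> nats s ''N'' 0 = N \<and>
     (\<forall>i<N. (\<forall>j\<in>{1..d}. nats s ''V'' (i * d + j) = row i j) \<and>
        reals s ''cap'' i = (\<Sum>j=1..d. real (row i j) * capacity I j))"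

lemma ready_agree:
  assumes "agree A B s s'" "ready s" "''T'' \<notin> A" "''d'' \<notin> A" "''q'' \<notin> A" "''m'' \<notin> A"
    "''N'' \<notin> A" "''V'' \<notin> A" "''S'' \<notin> A" "''beta'' \<notin> B" "''zmax'' \<notin> B" "''lambda'' \<notin> B" "''cap'' \<notin> B"
  shows "ready s'"
  using assms(2) inputs_agree[OF assms(1)] unfolding ready_def strides_def
  by (simp add: agree_nats[OF assms(1)] agree_reals[OF assms(1)] assms(3-))

lemma readyD:
  assumes "ready s"
  shows "nats s ''T'' 0 = T" "nats s ''d'' 0 = d" "nats s ''N'' 0 = N"
    "\<And>j. j \<in> {1..d} \<Longrightarrow> nats s ''m'' j = servers I j"
    "\<And>j. j \<in> {1..d} \<Longrightarrow> reals s ''beta'' j = \<beta> j"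
    "\<And>j. j \<in> {1..d} \<Longrightarrow> nats s ''S'' j = str j"
    "\<And>i j. i < N \<Longrightarrow> j \<in> {1..d} \<Longrightarrow> nats s ''V'' (i * d + j) = row i j"
    "\<And>i t. i < N \<Longrightarrow> t \<in> {1..T} \<Longrightarrow> reals s ''cap'' i < reals s ''lambda'' t \<longleftrightarrow> \<not> serves t i"
  using assms unfolding ready_def inputs_def strides_def can_serve_def by auto

text \<open>\<open>J\<close> holds the coordinates already relaxed at i. \<open>R i\<close> is the
  configuration that realises \<open>A i\<close>: it serves the volume and lies above i, so i is
  reached from it for free. The remaining clauses are premises of
  \<open>sweeps_optimal\<close>.\<close>

definition swept_up :: "nat \<Rightarrow> (nat \<Rightarrow> real) \<Rightarrow> (nat \<Rightarrow> real) \<Rightarrow> (nat \<Rightarrow> nat) \<Rightarrow> nat \<Rightarrow> nat set \<Rightarrow> bool" where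
  "swept_up t h A R i J \<longleftrightarrow> R i < N \<and> serves t (R i) \<and> (\<forall>j\<in>{1..d}. row i j \<le> row (R i) j) \<and>
     A i = h (R i) \<and> (serves t i \<longrightarrow> A i \<le> h i) \<and>
     (\<forall>j\<in>J. row i j < servers I j \<longrightarrow> A i \<le> A (i + str j))"

definition swept_down :: "nat \<Rightarrow> (nat \<Rightarrow> real) \<Rightarrow> (nat \<Rightarrow> real) \<Rightarrow> (nat \<Rightarrow> real) \<Rightarrow> (nat \<Rightarrow> nat) \<Rightarrow>
    nat \<Rightarrow> nat set \<Rightarrow> bool" where
  "swept_down t h A W Q i J \<longleftrightarrow> Q i < N \<and> serves t (Q i) \<and> h (Q i) + sw (Q i) i \<le> W i \<and> W i \<le> A i \<and>
     (\<forall>j\<in>J. 0 < row i j \<longrightarrow> W i \<le> W (i - str j) + \<beta> j * (real (row i j) - real (row (i - str j) j)))"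

text \<open>Entries refer only to codes from i upwards, so later writes of the descending sweep do
  not disturb them; the next lemma is the mirror image.\<close>

lemma swept_up_cong:
  "(\<And>k. i \<le> k \<Longrightarrow> A' k = A k \<and> R' k = R k) \<Longrightarrow> swept_up t h A R i J \<Longrightarrow> swept_up t h A' R' i J"
  unfolding swept_up_def by auto

lemma swept_down_cong:
  "(\<And>k. k \<le> i \<Longrightarrow> W' k = W k \<and> Q' k = Q k) \<Longrightarrow> swept_down t h A W Q i J \<Longrightarrow> swept_down t h A W' Q' i J"
  unfolding swept_down_def by auto

lemma runs_seed_state:
  assumes ready: "ready s" and t: "t \<in> {1..T}" "serves t (N - 1)" and i: "i < N"
    and s: "nats s ''t'' 0 = t" "nats s ''i'' 0 = i"
    and h: "\<And>k. k < N \<Longrightarrow> h k = reals s ''W'' (nats s ''p'' 0 + k) + g t k"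
    and top: "i < N - 1 \<Longrightarrow> swept_up t h (reals s ''A'') (nats s ''R'') (N - 1) J"
  shows "runs I seed_state s 60 (\<lambda>s'. (\<forall>k. k \<noteq> i \<longrightarrow> reals s' ''A'' k = reals s ''A'' k \<and> nats s' ''R'' k = nats s ''R'' k) \<and>
      swept_up t h (reals s' ''A'') (nats s' ''R'') i {})"
proof (cases "serves t i")
  case True
  have "slot_cost I t (\<lambda>j. nats s ''V'' (i * d + j)) = slot_cost I t (row i)"
    using readyD(7)[OF ready i] by (intro slot_cost_cong) auto
  then have cost: "slot_cost I t (\<lambda>j. nats s ''V'' (i * d + j)) = ereal (g t i)"
    using slot_cost_real[OF valid t(1) True] by simp
  define s1 where "s1 = real_update ''g'' 0 (g t i) s"
  let ?c = "Seq (RAssign ''A'' (nvar ''i'')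
      (RAdd (RRead ''W'' (NAdd (nvar ''p'') (nvar ''i''))) (RRead ''g'' (NConst 0))))
    (NAssign ''R'' (nvar ''i'') (nvar ''i''))"
  let ?Q = "\<lambda>s'. (\<forall>k. k \<noteq> i \<longrightarrow> reals s' ''A'' k = reals s ''A'' k \<and> nats s' ''R'' k = nats s ''R'' k) \<and>
      swept_up t h (reals s' ''A'') (nats s' ''R'') i {}"
  have "swept_up t h ((reals s ''A'')(i := reals s ''W'' (nats s ''p'' 0 + i) + g t i))
      ((nats s ''R'')(i := i)) i {}"
    using True i h[OF i] by (simp add: swept_up_def)
  then have "runs I ?c s1 30 ?Q" using s by (simp add: s1_def)
  then have "runs I (Seq (Eval ''g'' (NConst 0) (nvar ''t'') ''V'' (NMul (nvar ''i'') (nvar ''d''))) ?c)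
      s (15 + 30) ?Q"
    by (intro runs_Seq[OF runs_Eval[where v = "g t i"] order_refl])
      (use t s cost readyD(2)[OF ready] in \<open>simp_all add: s1_def\<close>)
  then show ?thesis unfolding seed_state_def
    using readyD(8)[OF ready i t(1)] True s by (simp add: runs_weaken)
next
  case False
  \<comment> \<open>The last row serves the volume, so i is a different row and the last one has
    already been treated.\<close>
  then have "i < N - 1" using t(2) i by (cases "i = N - 1") auto
  note top = top[OF this]
  have "row i j \<le> row (nats s ''R'' (N - 1)) j" if "j \<in> {1..d}" for j
    using top row_le[of i j] row_top[OF that] that unfolding swept_up_def by force
  then show ?thesis unfolding seed_state_def
    using readyD(2,3,8)[OF ready] False i t(1) s top by (auto simp: swept_up_def)
qed

text \<open>The upper neighbour has a larger code and is already final. Replacing \<open>A i\<close>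
  only lowers it, which preserves the inequalities for the coordinates relaxed before, and the
  realising configuration of the neighbour lies above i as well.\<close>

lemma runs_relax_up:
  assumes ready: "ready s" and i: "i < N" and j: "j \<in> {1..d}"
    and s: "nats s ''i'' 0 = i" "nats s ''j'' 0 = j"
    and own: "swept_up t h (reals s ''A'') (nats s ''R'') i {1..<j}"
    and higher: "\<And>k. i < k \<Longrightarrow> k < N \<Longrightarrow> swept_up t h (reals s ''A'') (nats s ''R'') k {1..d}"
  shows "runs I relax_up s 80 (\<lambda>s'. (\<forall>k. k \<noteq> i \<longrightarrow> reals s' ''A'' k = reals s ''A'' k \<and> nats s' ''R'' k = nats s ''R'' k) \<and>
      swept_up t h (reals s' ''A'') (nats s' ''R'') i {1..<Suc j})"
proof -
  note r = readyD(2)[OF ready] readyD(4)[OF ready j] readyD(6)[OF ready j] readyD(7)[OF ready i j]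
  have pos: "0 < str l" for l by (rule stride_pos[where n = base, OF base_pos])
  have J: "{1..<Suc j} = insert j {1..<j}" using j by auto
  show ?thesis
  proof (cases "row i j < servers I j \<and> reals s ''A'' (i + str j) < reals s ''A'' i")
    case True
    note up = up_neighbour[OF i j conjunct1[OF True]]
    have n: "swept_up t h (reals s ''A'') (nats s ''R'') (i + str j) {1..d}"
      using up(1) pos[of j] by (intro higher) auto
    have "row i l \<le> row (nats s ''R'' (i + str j)) l" if "l \<in> {1..d}" for l
    proof -
      have "row i l \<le> row (i + str j) l" using up(2)[OF that] by (simp add: row_le_iff)
      also have "\<dots> \<le> row (nats s ''R'' (i + str j)) l" using n that by (simp add: swept_up_def)
      finally show ?thesis .
    qed
    then have "swept_up t h ((reals s ''A'')(i := reals s ''A'' (i + str j)))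
        ((nats s ''R'')(i := nats s ''R'' (i + str j))) i {1..<Suc j}"
      using n own True pos unfolding swept_up_def J by auto
    then show ?thesis unfolding relax_up_def using True r s by simp
  next
    case False
    then have "swept_up t h (reals s ''A'') (nats s ''R'') i {1..<Suc j}"
      using own unfolding swept_up_def J by auto
    then show ?thesis unfolding relax_up_def using False r s by auto
  qed
qed

lemma runs_descend_step:
  assumes ready: "ready s" and t: "t \<in> {1..T}" "serves t (N - 1)" and r: "r < N"
    and s: "nats s ''t'' 0 = t" "nats s ''r'' 0 = r"
    and h: "\<And>k. k < N \<Longrightarrow> h k = reals s ''W'' (nats s ''p'' 0 + k) + g t k"
    and higher: "\<And>k. N - r \<le> k \<Longrightarrow> k < N \<Longrightarrow> swept_up t h (reals s ''A'') (nats s ''R'') k {1..d}"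
  shows "runs I descend_step s (94 * d + 90)
    (\<lambda>s'. \<forall>k. N - Suc r \<le> k \<and> k < N \<longrightarrow> swept_up t h (reals s' ''A'') (nats s' ''R'') k {1..d})"
proof -
  define i where "i = N - 1 - r"
  have i: "i < N" "N - Suc r = i" "N - r = Suc i" using r by (auto simp: i_def)
  define s1 where "s1 = nat_update ''i'' 0 i s"
  have ag: "agree {''i''} {} s s1" by (simp add: s1_def agree_def)
  have ready1: "ready s1" by (rule ready_agree[OF ag ready]) simp_all
  have s1: "nats s1 ''t'' 0 = t" "nats s1 ''i'' 0 = i" using s by (simp_all add: s1_def)
  have h1: "h k = reals s1 ''W'' (nats s1 ''p'' 0 + k) + g t k" if "k < N" for k
    using h[OF that] by (simp add: s1_def)
  have higher1: "swept_up t h (reals s1 ''A'') (nats s1 ''R'') k {1..d}" if "i < k" "k < N" for k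
    using higher[of k] that i by (simp add: s1_def)
  have R: "runs I (Seq seed_state (For ''j'' (NConst 1) (NAdd (nvar ''d'') (NConst 1)) relax_up)) s1 (60 + (94 * d + 11))
    (\<lambda>s'. \<forall>k. N - Suc r \<le> k \<and> k < N \<longrightarrow> swept_up t h (reals s' ''A'') (nats s' ''R'') k {1..d})"
  proof (rule runs_Seq_agree[OF runs_seed_state[OF ready1 t i(1) s1 h1 higher1] order_refl])
    fix s2 assume s2: "(\<forall>k. k \<noteq> i \<longrightarrow> reals s2 ''A'' k = reals s1 ''A'' k \<and> nats s2 ''R'' k = nats s1 ''R'' k) \<and>
        swept_up t h (reals s2 ''A'') (nats s2 ''R'') i {}"
      and ag2: "agree (nat_writes seed_state) (real_writes seed_state) s1 s2"
    have ready2: "ready s2" by (rule ready_agree[OF ag2 ready1]) simp_all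
    show "runs I (For ''j'' (NConst 1) (NAdd (nvar ''d'') (NConst 1)) relax_up) s2 (94 * d + 11)
      (\<lambda>s'. \<forall>k. N - Suc r \<le> k \<and> k < N \<longrightarrow> swept_up t h (reals s' ''A'') (nats s' ''R'') k {1..d})"
    proof (rule runs_For[where l = 1 and h = "Suc d" and b = 80 and P = "\<lambda>j s'.
          (\<forall>k. k \<noteq> i \<longrightarrow> reals s' ''A'' k = reals s1 ''A'' k \<and> nats s' ''R'' k = nats s1 ''R'' k) \<and>
          swept_up t h (reals s' ''A'') (nats s' ''R'') i {1..<j}"], goal_cases)
      case 3
      then show ?case using s2 by simp
    next
      case (5 j s')
      then show ?case using readyD(2)[OF ready2] agree_nats[OF 5(2), of "''d''"] by simp
    next
      case (7 j s')
      have ready': "ready s'" by (rule ready_agree[OF 7(5) ready2]) simp_all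
      have si: "nats s' ''i'' 0 = i" using s1 agree_nats[OF ag2] agree_nats[OF 7(5)] by simp
      have hi: "swept_up t h (reals s' ''A'') (nats s' ''R'') k {1..d}" if "i < k" "k < N" for k
        by (rule swept_up_cong[OF _ higher1[OF that]]) (use 7(3) that in auto)
      have "j \<in> {1..d}" using 7 by auto
      then show ?case
        by (rule runs_mono[OF runs_relax_up[OF ready' i(1) _ si 7(4) conjunct2[OF 7(3)] hi]])
          (use 7(3) in auto)
    next
      case (8 s')
      have "swept_up t h (reals s' ''A'') (nats s' ''R'') k {1..d}" if "i \<le> k" "k < N" for k
      proof (cases "k = i")
        case True
        then show ?thesis using 8(1) by (simp add: atLeastLessThanSuc_atLeastAtMost)
      next
        case False
        then have "i < k" using that by simp
        then show ?thesis
          by (intro swept_up_cong[OF _ higher1[of k]]) (use 8(1) that in auto)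
      qed
      then show ?case using i by simp
    qed simp_all
  qed (use N_pos in simp_all)
  have "N - (1 + r) = i" by (simp add: i_def)
  then show ?thesis unfolding descend_step_def using readyD(3)[OF ready] s
    by (simp add: s1_def[symmetric] del: One_nat_def) (rule runs_weaken[OF R], simp)
qed

lemma runs_descend:
  assumes ready: "ready s" and t: "t \<in> {1..T}" "serves t (N - 1)"
    and s: "nats s ''t'' 0 = t"
    and h: "\<And>k. k < N \<Longrightarrow> h k = reals s ''W'' (nats s ''p'' 0 + k) + g t k"
  shows "runs I descend s (N * (94 * d + 102) + 9)
    (\<lambda>s'. \<forall>k<N. swept_up t h (reals s' ''A'') (nats s' ''R'') k {1..d})"
  unfolding descend_def
proof (rule runs_For[where l = 0 and h = N and b = "94 * d + 90" and P = "\<lambda>r s'.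
      \<forall>k. N - r \<le> k \<and> k < N \<longrightarrow> swept_up t h (reals s' ''A'') (nats s' ''R'') k {1..d}"], goal_cases)
  case (5 j s')
  then show ?case using readyD(3)[OF ready] agree_nats[OF 5(2), of "''N''"] by simp
next
  case (7 r s')
  note ag = agree_nats[OF 7(5)] agree_reals[OF 7(5)]
  show ?case
  proof (rule runs_descend_step[OF _ t 7(2)])
    show "ready s'" by (rule ready_agree[OF 7(5) ready]) simp_all
    show "h k = reals s' ''W'' (nats s' ''p'' 0 + k) + g t k" if "k < N" for k
      using h[OF that] ag by simp
  qed (use 7 ag s in simp_all)
next
  case 3
  then show ?case by auto
next
  case (8 s')
  then show ?case by simp
qed simp_all

text \<open>The mirror image of the upward relaxation. That the predecessor taken from the neighbour
  still realises the new value follows from the triangle inequality in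
  \<open>sw_down_neighbour\<close>.\<close>

lemma runs_relax_down:
  assumes ready: "ready s" and i: "i < N" and j: "j \<in> {1..d}"
    and s: "nats s ''i'' 0 = i" "nats s ''j'' 0 = j" "nats s ''o'' 0 = b"
    and own: "swept_down t h A (\<lambda>k. reals s ''W'' (b + k)) (\<lambda>k. nats s ''Q'' (b + k)) i {1..<j}"
    and lower: "\<And>k. k < i \<Longrightarrow> swept_down t h A (\<lambda>k. reals s ''W'' (b + k)) (\<lambda>k. nats s ''Q'' (b + k)) k {1..d}"
  shows "runs I relax_down s 130 (\<lambda>s'. (\<forall>k. k \<noteq> b + i \<longrightarrow> reals s' ''W'' k = reals s ''W'' k \<and> nats s' ''Q'' k = nats s ''Q'' k) \<and>
      swept_down t h A (\<lambda>k. reals s' ''W'' (b + k)) (\<lambda>k. nats s' ''Q'' (b + k)) i {1..<Suc j})"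
proof -
  let ?k = "i - str j"
  define cand where "cand = reals s ''W'' (b + ?k) + \<beta> j * (real (row i j) - real (row ?k j))"
  have k: "?k < N" using i by simp
  note r = readyD(2)[OF ready] readyD(5)[OF ready j] readyD(6)[OF ready j] readyD(7)[OF ready i j]
    readyD(7)[OF ready k j]
  have pos: "0 < str l" for l by (rule stride_pos[where n = base, OF base_pos])
  have J: "{1..<Suc j} = insert j {1..<j}" using j by auto
  show ?thesis
  proof (cases "0 < row i j \<and> cand < reals s ''W'' (b + i)")
    case True
    have le: "str l \<le> i" if "l \<in> {1..d}" "0 < row i l" for l using down_neighbour(1) that by blast
    have less: "?k < i" using le[OF j] True pos[of j] by auto
    have n: "swept_down t h A (\<lambda>k. reals s ''W'' (b + k)) (\<lambda>k. nats s ''Q'' (b + k)) ?k {1..d}"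
      by (rule lower[OF less])
    let ?q = "nats s ''Q'' (b + ?k)"
    have "sw ?q i \<le> sw ?q ?k + \<beta> j * (real (row i j) - real (row ?k j))"
      using sw_down_neighbour(1)[OF j] True by blast
    then have "h ?q + sw ?q i \<le> cand" using n unfolding swept_down_def cand_def by linarith
    \<comment> \<open>The truncated subtraction really moves to another cell, so lowering the entry
      of i leaves all neighbours on the right-hand sides unchanged.\<close>
    moreover have "i - str l \<noteq> i" if "l \<in> {1..<Suc j}" "0 < row i l" for l
      using le[of l] pos[of l] that j by (metis One_nat_def atLeastAtMost_iff atLeastLessThan_iff
        diff_less less_Suc_eq_le less_irrefl less_le_trans order_trans)
    ultimately have "swept_down t h A (\<lambda>k. ((reals s ''W'')(b + i := cand)) (b + k))
        (\<lambda>k. ((nats s ''Q'')(b + i := ?q)) (b + k)) i {1..<Suc j}"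
      using n own True unfolding swept_down_def J by (auto simp: cand_def)
    then show ?thesis unfolding relax_down_def using True r s by (simp add: cand_def)
  next
    case False
    then have "swept_down t h A (\<lambda>k. reals s ''W'' (b + k)) (\<lambda>k. nats s ''Q'' (b + k)) i {1..<Suc j}"
      using own unfolding swept_down_def J by (auto simp: cand_def)
    then show ?thesis unfolding relax_down_def using False r s by (auto simp: cand_def)
  qed
qed

lemma runs_ascend_step:
  assumes ready: "ready s" and i: "i < N"
    and s: "nats s ''i'' 0 = i" "nats s ''o'' 0 = b"
    and up: "swept_up t h (reals s ''A'') (nats s ''R'') i {1..d}"
    and lower: "\<And>k. k < i \<Longrightarrow> swept_down t h (reals s ''A'') (\<lambda>k. reals s ''W'' (b + k)) (\<lambda>k. nats s ''Q'' (b + k)) k {1..d}"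
  shows "runs I ascend_step s (144 * d + 50) (\<lambda>s'.
      (\<forall>k. k \<noteq> b + i \<longrightarrow> reals s' ''W'' k = reals s ''W'' k \<and> nats s' ''Q'' k = nats s ''Q'' k) \<and>
      (\<forall>k\<le>i. swept_down t h (reals s ''A'') (\<lambda>k. reals s' ''W'' (b + k)) (\<lambda>k. nats s' ''Q'' (b + k)) k {1..d}))"
    (is "runs I _ s _ ?Q")
proof -
  define s1 where "s1 = nat_update ''Q'' (b + i) (nats s ''R'' i) (real_update ''W'' (b + i) (reals s ''A'' i) s)"
  have ag: "agree {''Q''} {''W''} s s1" by (simp add: s1_def agree_def)
  have ready1: "ready s1" by (rule ready_agree[OF ag ready]) simp_all
  have s1: "nats s1 ''i'' 0 = i" "nats s1 ''o'' 0 = b" using s by (simp_all add: s1_def)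
  have lower1: "swept_down t h (reals s ''A'') (\<lambda>k. reals s' ''W'' (b + k)) (\<lambda>k. nats s' ''Q'' (b + k)) k {1..d}"
    if "k < i" "\<forall>k. k \<noteq> b + i \<longrightarrow> reals s' ''W'' k = reals s ''W'' k \<and> nats s' ''Q'' k = nats s ''Q'' k" for k s'
    by (rule swept_down_cong[OF _ lower[OF that(1)]]) (use that in auto)
  have own: "swept_down t h (reals s ''A'') (\<lambda>k. reals s1 ''W'' (b + k)) (\<lambda>k. nats s1 ''Q'' (b + k)) i {}"
    \<comment> \<open>The configuration \<open>R i\<close> lies above i, so switching from it to i
      costs nothing.\<close>
    using up sw_eq_0[of i "nats s ''R'' i"] by (simp add: swept_up_def swept_down_def s1_def)
  have R: "runs I (For ''j'' (NConst 1) (NAdd (nvar ''d'') (NConst 1)) relax_down) s1 (144 * d + 11) ?Q"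
  proof (rule runs_For[where l = 1 and h = "Suc d" and b = 130 and P = "\<lambda>j s'.
          (\<forall>k. k \<noteq> b + i \<longrightarrow> reals s' ''W'' k = reals s ''W'' k \<and> nats s' ''Q'' k = nats s ''Q'' k) \<and>
          swept_down t h (reals s ''A'') (\<lambda>k. reals s' ''W'' (b + k)) (\<lambda>k. nats s' ''Q'' (b + k)) i {1..<j}"], goal_cases)
    case 3
    then show ?case using own by (simp add: s1_def)
  next
    case (5 j s')
    then show ?case using readyD(2)[OF ready1] agree_nats[OF 5(2), of "''d''"] by simp
  next
    case (7 j s')
    have ready': "ready s'" by (rule ready_agree[OF 7(5) ready1]) simp_all
    have si: "nats s' ''i'' 0 = i" "nats s' ''o'' 0 = b" using s1 agree_nats[OF 7(5)] by simp_all
    have "j \<in> {1..d}" using 7 by auto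
    then show ?case
      by (rule runs_mono[OF runs_relax_down[OF ready' i _ si(1) 7(4) si(2) conjunct2[OF 7(3)]
        lower1[OF _ conjunct1[OF 7(3)]]]]) (use 7(3) in auto)
  next
    case (8 s')
    have "swept_down t h (reals s ''A'') (\<lambda>k. reals s' ''W'' (b + k)) (\<lambda>k. nats s' ''Q'' (b + k)) k {1..d}"
      if "k \<le> i" for k
    proof (cases "k = i")
      case True
      then show ?thesis using 8(1) by (simp add: atLeastLessThanSuc_atLeastAtMost)
    next
      case False
      then show ?thesis using that 8(1) by (intro lower1) auto
    qed
    then show ?case using 8(1) by blast
  qed simp_all
  show ?thesis unfolding ascend_step_def using s
    by (simp add: s1_def[symmetric] del: One_nat_def) (rule runs_weaken[OF R], simp)
qed

lemma runs_ascend: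
  assumes ready: "ready s" and s: "nats s ''o'' 0 = b"
    and up: "\<And>k. k < N \<Longrightarrow> swept_up t h (reals s ''A'') (nats s ''R'') k {1..d}"
  shows "runs I ascend s (N * (144 * d + 62) + 9) (\<lambda>s'.
      (\<forall>k<b. reals s' ''W'' k = reals s ''W'' k \<and> nats s' ''Q'' k = nats s ''Q'' k) \<and>
      (\<forall>k<N. swept_down t h (reals s ''A'') (\<lambda>k. reals s' ''W'' (b + k)) (\<lambda>k. nats s' ''Q'' (b + k)) k {1..d}))"
  unfolding ascend_def
proof (rule runs_For[where l = 0 and h = N and b = "144 * d + 50" and P = "\<lambda>i s'.
      (\<forall>k<b. reals s' ''W'' k = reals s ''W'' k \<and> nats s' ''Q'' k = nats s ''Q'' k) \<and>
      (\<forall>k<i. swept_down t h (reals s ''A'') (\<lambda>k. reals s' ''W'' (b + k)) (\<lambda>k. nats s' ''Q'' (b + k)) k {1..d})"], goal_cases)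
  case (5 i s')
  then show ?case using readyD(3)[OF ready] agree_nats[OF 5(2), of "''N''"] by simp
next
  case (7 i s')
  note ag = agree_nats[OF 7(5)] agree_reals[OF 7(5)]
  have ready': "ready s'" by (rule ready_agree[OF 7(5) ready]) simp_all
  have s': "nats s' ''o'' 0 = b" "reals s' ''A'' = reals s ''A''" "nats s' ''R'' = nats s ''R''"
    using ag s by simp_all
  have "runs I ascend_step s' (144 * d + 50) (\<lambda>s''.
      (\<forall>k. k \<noteq> b + i \<longrightarrow> reals s'' ''W'' k = reals s' ''W'' k \<and> nats s'' ''Q'' k = nats s' ''Q'' k) \<and>
      (\<forall>k\<le>i. swept_down t h (reals s' ''A'') (\<lambda>k. reals s'' ''W'' (b + k)) (\<lambda>k. nats s'' ''Q'' (b + k)) k {1..d}))"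
    using 7 up by (intro runs_ascend_step[OF ready']) (auto simp: s')
  then show ?case by (rule runs_mono) (use 7(3) in \<open>auto simp: s' less_Suc_eq_le\<close>)
qed simp_all

text \<open>The invariants of the sweeps show that each new entry is attained;
  \<open>sweeps_optimal\<close> shows that no choice for slot t is cheaper.\<close>

lemma runs_slot_step:
  assumes ready: "ready s" and t: "t \<in> {1..T}" "serves t (N - 1)"
    and s: "nats s ''t'' 0 = t"
    and dp: "dp_tables (\<lambda>t i. reals s ''W'' (t * N + i)) (\<lambda>t i. nats s ''Q'' (t * N + i)) (t - 1)"
  shows "runs I slot_step s (N * (238 * d + 164) + 50)
    (\<lambda>s'. dp_tables (\<lambda>t i. reals s' ''W'' (t * N + i)) (\<lambda>t i. nats s' ''Q'' (t * N + i)) t)"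
    (is "runs I _ s _ ?Q")
proof -
  define s1 where "s1 = nat_update ''o'' 0 (t * N) (nat_update ''p'' 0 ((t - 1) * N) s)"
  define h where "h k = reals s ''W'' ((t - 1) * N + k) + g t k" for k
  have ag: "agree {''o'', ''p''} {} s s1" by (simp add: s1_def agree_def)
  have ready1: "ready s1" by (rule ready_agree[OF ag ready]) simp_all
  have s1: "nats s1 ''t'' 0 = t" using s by (simp add: s1_def)
  have h1: "h k = reals s1 ''W'' (nats s1 ''p'' 0 + k) + g t k" for k
    by (simp add: h_def s1_def)
  have R: "runs I (Seq descend ascend) s1 (N * (94 * d + 102) + 9 + (N * (144 * d + 62) + 9)) ?Q"
  proof (rule runs_Seq_agree[OF runs_descend[OF ready1 t s1 h1] order_refl])
    fix s2 assume up: "\<forall>k<N. swept_up t h (reals s2 ''A'') (nats s2 ''R'') k {1..d}"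
      and ag2: "agree (nat_writes descend) (real_writes descend) s1 s2"
    have ready2: "ready s2" by (rule ready_agree[OF ag2 ready1]) simp_all
    have s2: "nats s2 ''o'' 0 = t * N" using agree_nats[OF ag2] by (simp add: s1_def)
    have WQ: "reals s2 ''W'' = reals s ''W''" "nats s2 ''Q'' = nats s ''Q''"
      using agree_nats[OF ag2] agree_reals[OF ag2] by (simp_all add: s1_def)
    show "runs I ascend s2 (N * (144 * d + 62) + 9) ?Q"
    proof (rule runs_mono[OF runs_ascend[OF ready2 s2] order_refl])
      show "swept_up t h (reals s2 ''A'') (nats s2 ''R'') k {1..d}" if "k < N" for k
        using up that by blast
      fix s' :: mem
      assume s': "(\<forall>k<t * N. reals s' ''W'' k = reals s2 ''W'' k \<and> nats s' ''Q'' k = nats s2 ''Q'' k) \<and>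
        (\<forall>k<N. swept_down t h (reals s2 ''A'') (\<lambda>k. reals s' ''W'' (t * N + k)) (\<lambda>k. nats s' ''Q'' (t * N + k)) k {1..d})"
      then have down: "swept_down t h (reals s2 ''A'') (\<lambda>k. reals s' ''W'' (t * N + k))
          (\<lambda>k. nats s' ''Q'' (t * N + k)) k {1..d}" if "k < N" for k
        using that by blast
      \<comment> \<open>Earlier slots occupy the cells below t N, which the ascending sweep does not
        touch.\<close>
      have old: "reals s' ''W'' (l * N + k) = reals s ''W'' (l * N + k)"
        "nats s' ''Q'' (l * N + k) = nats s ''Q'' (l * N + k)" if "l < t" "k < N" for l k
      proof -
        have "Suc l * N \<le> t * N" using that by (intro mult_right_mono) auto
        then have "l * N + k < t * N" using that by simp
        then show "reals s' ''W'' (l * N + k) = reals s ''W'' (l * N + k)"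
          "nats s' ''Q'' (l * N + k) = nats s ''Q'' (l * N + k)" using s' WQ by auto
      qed
      have opt: "reals s' ''W'' (t * N + i) \<le> h k + sw k i" if "i < N" "k < N" "serves t k" for i k
        using up down that
        by (intro sweeps_optimal[where t = t and A = "reals s2 ''A''" and W = "\<lambda>i. reals s' ''W'' (t * N + i)"])
          (auto simp: swept_up_def swept_down_def)
      have hW: "h k = reals s' ''W'' ((t - 1) * N + k) + g t k" if "k < N" for k
        using old(1)[of "t - 1" k] that t(1) by (simp add: h_def)
      have new: "nats s' ''Q'' (t * N + i) < N \<and> serves t (nats s' ''Q'' (t * N + i)) \<and>
          reals s' ''W'' ((t - 1) * N + nats s' ''Q'' (t * N + i)) + g t (nats s' ''Q'' (t * N + i)) +
            sw (nats s' ''Q'' (t * N + i)) i \<le> reals s' ''W'' (t * N + i) \<and>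
          (\<forall>k<N. serves t k \<longrightarrow>
            reals s' ''W'' (t * N + i) \<le> reals s' ''W'' ((t - 1) * N + k) + g t k + sw k i)" if "i < N" for i
        using down[OF that] opt[OF that] hW unfolding swept_down_def by auto
      show "?Q s'"
        unfolding dp_tables_def
      proof (intro conjI ballI allI impI)
        fix i assume "i < N"
        then show "reals s' ''W'' (0 * N + i) = sw 0 i"
          using old(1)[of 0 i] dp t(1) unfolding dp_tables_def by simp
      next
        fix l i assume l: "l \<in> {1..t}" and i: "i < N"
        have dpl: "nats s ''Q'' (l * N + i) < N \<and> serves l (nats s ''Q'' (l * N + i)) \<and>
            reals s ''W'' ((l - 1) * N + nats s ''Q'' (l * N + i)) + g l (nats s ''Q'' (l * N + i)) +
              sw (nats s ''Q'' (l * N + i)) i \<le> reals s ''W'' (l * N + i) \<and>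
            (\<forall>k<N. serves l k \<longrightarrow>
              reals s ''W'' (l * N + i) \<le> reals s ''W'' ((l - 1) * N + k) + g l k + sw k i)" if "l \<noteq> t"
          using dp l i that unfolding dp_tables_def by (auto dest!: bspec[of _ _ l])
        have all: "nats s' ''Q'' (l * N + i) < N \<and> serves l (nats s' ''Q'' (l * N + i)) \<and>
            reals s' ''W'' ((l - 1) * N + nats s' ''Q'' (l * N + i)) + g l (nats s' ''Q'' (l * N + i)) +
              sw (nats s' ''Q'' (l * N + i)) i \<le> reals s' ''W'' (l * N + i) \<and>
            (\<forall>k<N. serves l k \<longrightarrow>
              reals s' ''W'' (l * N + i) \<le> reals s' ''W'' ((l - 1) * N + k) + g l k + sw k i)"
        proof (cases "l = t")
          case True
          then show ?thesis using new[OF i] by simp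
        next
          case False
          then have "l < t" "l - 1 < t" using l by auto
          then show ?thesis using dpl[OF False] old i by simp
        qed
        then show "nats s' ''Q'' (l * N + i) < N" "serves l (nats s' ''Q'' (l * N + i))"
            "reals s' ''W'' ((l - 1) * N + nats s' ''Q'' (l * N + i)) + g l (nats s' ''Q'' (l * N + i)) +
              sw (nats s' ''Q'' (l * N + i)) i \<le> reals s' ''W'' (l * N + i)"
          by blast+
        show "reals s' ''W'' (l * N + i) \<le> reals s' ''W'' ((l - 1) * N + k) + g l k + sw k i"
          if "k < N" "serves l k" for k
          using all that by blast
      qed
    qed
  qed
  show ?thesis unfolding slot_step_def using readyD(3)[OF ready] s
    by (simp add: s1_def[symmetric, simplified] s1_def[symmetric]) (rule runs_weaken[OF R], simp add: algebra_simps)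
qed

lemma runs_all_slots:
  assumes ready: "ready s" and W: "\<And>i. i < N \<Longrightarrow> reals s ''W'' i = sw 0 i"
    and top: "\<And>t. t \<in> {1..T} \<Longrightarrow> serves t (N - 1)"
  shows "runs I all_slots s (T * (N * (238 * d + 164) + 64) + 11)
    (\<lambda>s'. dp_tables (\<lambda>t i. reals s' ''W'' (t * N + i)) (\<lambda>t i. nats s' ''Q'' (t * N + i)) T)"
  unfolding all_slots_def
proof (rule runs_For[where l = 1 and h = "Suc T" and b = "N * (238 * d + 164) + 50" and
      P = "\<lambda>t s'. dp_tables (\<lambda>t i. reals s' ''W'' (t * N + i)) (\<lambda>t i. nats s' ''Q'' (t * N + i)) (t - 1)"], goal_cases)
  case 3
  then show ?case using W by (simp add: dp_tables_def)
next
  case (5 t s')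
  then show ?case using readyD(1)[OF ready] agree_nats[OF 5(2), of "''T''"] by simp
next
  case (7 t s')
  have "ready s'" by (rule ready_agree[OF 7(5) ready]) simp_all
  then show ?case using 7 top[of t] by (simp add: runs_slot_step)
qed simp_all

end

section \<open>Extracting the schedule\<close>

definition trace_step :: com where
  "trace_step = Seq (nset ''t'' (NSub (nvar ''T'') (nvar ''r'')))
     (Seq (nset ''u'' (NRead ''Q'' (NAdd (NMul (nvar ''t'') (nvar ''N'')) (nvar ''u''))))
     (Seq (nset ''b'' (NMul (NSub (nvar ''t'') (NConst 1)) (nvar ''d'')))
     (Seq (nset ''c'' (NMul (nvar ''u'') (nvar ''d''))) (copy_row ''x''))))"

definition trace_back :: com where
  "trace_back = Seq (nset ''u'' (NConst 0)) (For ''r'' (NConst 0) (nvar ''T'') trace_step)"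

definition right_sizing :: com where
  "right_sizing = Seq find_precision (Seq build_table (Seq all_slots trace_back))"

lemma writes_trace_step [simp]:
  "nat_writes trace_step = {''t'', ''u'', ''b'', ''c'', ''e'', ''x''}" "real_writes trace_step = {}"
  by (auto simp: trace_step_def)

lemma writes_main [simp]:
  "nat_writes build_table = {''b'', ''c'', ''e'', ''V'', ''N'', ''s'', ''v'', ''i'', ''S'', ''j''}"
  "real_writes build_table = {''W'', ''cap''}"
  "nat_writes all_slots = {''R'', ''Q'', ''i'', ''j'', ''r'', ''p'', ''o'', ''t''}"
  "real_writes all_slots = {''A'', ''g'', ''W''}"
  by (auto simp: build_table_def all_slots_def)

context sizing_grid
begin

text \<open>The rows of x are filled from the last slot to the first, so what has to survive are the
  cells above the current row.\<close>

lemma runs_trace_step: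
  assumes ready: "ready s" and t: "t \<in> {1..T}" and s: "nats s ''r'' 0 = T - t"
    and u: "nats s ''Q'' (t * N + nats s ''u'' 0) = v" "v < N"
  shows "runs I trace_step s (26 * d + 80) (\<lambda>s'. nats s' ''u'' 0 = v \<and>
     (\<forall>j\<in>{1..d}. nats s' ''x'' ((t - 1) * d + j) = row v j) \<and>
     (\<forall>k. (t - 1) * d + d < k \<longrightarrow> nats s' ''x'' k = nats s ''x'' k))" (is "runs I _ s _ ?Q")
proof -
  define s1 where "s1 = nat_update ''c'' 0 (v * d) (nat_update ''b'' 0 ((t - 1) * d)
    (nat_update ''u'' 0 v (nat_update ''t'' 0 t s)))"
  have R: "runs I (copy_row ''x'') s1 (26 * d + 11) ?Q"
  proof (rule runs_copy_row[where d = d and p = "(t - 1) * d" and r = "v * d"])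
    fix s' assume ag: "agree {''e'', ''x''} {} s1 s'" and x: "nats s' ''x'' =
      (\<lambda>k. if (t - 1) * d < k \<and> k \<le> (t - 1) * d + d then nats s1 ''V'' (k - (t - 1) * d + v * d)
           else nats s1 ''x'' k)"
    have "nats s' ''u'' 0 = v" using agree_nats[OF ag] by (simp add: s1_def)
    then show "?Q s'" using readyD(7)[OF ready u(2)] by (auto simp: x s1_def add.commute)
  qed (use readyD(2)[OF ready] in \<open>simp_all add: s1_def\<close>)
  have "T - (T - t) = t" using t by simp
  then show ?thesis
    unfolding trace_step_def using readyD(1-3)[OF ready] s u
    by (simp add: s1_def[symmetric] del: One_nat_def) (rule runs_weaken[OF R], simp)
qed

lemma runs_trace_back:
  assumes ready: "ready s" and Q: "\<And>t i. t \<in> {1..T} \<Longrightarrow> i < N \<Longrightarrow> nats s ''Q'' (t * N + i) < N"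
  shows "runs I trace_back s (T * (26 * d + 92) + 20) (\<lambda>s'. \<exists>u. u (Suc T) = 0 \<and>
     (\<forall>t\<in>{1..T}. u t = nats s ''Q'' (t * N + u (Suc t))) \<and>
     (\<forall>t j. output_schedule I s' t j = (if t \<in> {1..T} \<and> j \<in> {1..d} then row (u t) j else 0)))"
    (is "runs I _ s _ ?Q")
proof -
  \<comment> \<open>\<open>w r\<close> is the configuration after r backward steps, that is, in slot
    T + 1 - r; it starts with all servers off after the last slot.\<close>
  define w where "w = rec_nat 0 (\<lambda>r v. nats s ''Q'' ((T - r) * N + v))"
  have w0: "w 0 = 0" and wS: "w (Suc r) = nats s ''Q'' ((T - r) * N + w r)" for r
    by (simp_all add: w_def)
  have wN: "w r < N" if "r \<le> T" for r
    using that by (induction r) (auto simp: w0 wS N_pos intro!: Q)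
  define s1 where "s1 = nat_update ''u'' 0 0 s"
  have ag: "agree {''u''} {} s s1" by (simp add: s1_def agree_def)
  have ready1: "ready s1" by (rule ready_agree[OF ag ready]) simp_all
  have R: "runs I (For ''r'' (NConst 0) (nvar ''T'') trace_step) s1 (T * (26 * d + 92) + 9) ?Q"
  proof (rule runs_For[where l = 0 and h = T and b = "26 * d + 80" and P = "\<lambda>r s'.
        nats s' ''u'' 0 = w r \<and>
        (\<forall>t\<in>{T - r<..T}. \<forall>j\<in>{1..d}. nats s' ''x'' ((t - 1) * d + j) = row (w (Suc T - t)) j)"], goal_cases)
    case 3
    then show ?case by (simp add: s1_def w0)
  next
    case (5 r s')
    then show ?case using readyD(1)[OF ready1] agree_nats[OF 5(2), of "''T''"] by simp
  next
    case (7 r s')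
    define t where "t = T - r"
    have t: "t \<in> {1..T}" "r = T - t" "Suc T - t = Suc r" "T - Suc r = t - 1" using 7 by (auto simp: t_def)
    have ready': "ready s'" by (rule ready_agree[OF 7(5) ready1]) simp_all
    have "nats s' ''Q'' = nats s ''Q''" using agree_nats[OF 7(5)] by (simp add: s1_def)
    then have "nats s' ''Q'' (t * N + nats s' ''u'' 0) = w (Suc r)" using 7(3) by (simp add: wS t_def)
    moreover have "w (Suc r) < N" using 7 by (intro wN) simp
    moreover have "nats s' ''r'' 0 = T - t" using 7(4) t(2) by simp
    ultimately have "runs I trace_step s' (26 * d + 80) (\<lambda>s''. nats s'' ''u'' 0 = w (Suc r) \<and>
       (\<forall>j\<in>{1..d}. nats s'' ''x'' ((t - 1) * d + j) = row (w (Suc r)) j) \<and>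
       (\<forall>k. (t - 1) * d + d < k \<longrightarrow> nats s'' ''x'' k = nats s' ''x'' k))"
      using t(1) by (intro runs_trace_step[OF ready'])
    then show ?case
    proof (rule runs_mono)
      fix s'' :: mem
      assume s'': "nats s'' ''u'' 0 = w (Suc r) \<and>
       (\<forall>j\<in>{1..d}. nats s'' ''x'' ((t - 1) * d + j) = row (w (Suc r)) j) \<and>
       (\<forall>k. (t - 1) * d + d < k \<longrightarrow> nats s'' ''x'' k = nats s' ''x'' k)"
      have "nats s'' ''x'' ((l - 1) * d + j) = row (w (Suc T - l)) j"
        if l: "l \<in> {T - Suc r<..T}" and j: "j \<in> {1..d}" for l j
      proof (cases "l = t")
        case True
        then show ?thesis using s'' j t(3) by simp
      next
        case False
        then have lt: "t < l" using l t by auto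
        then have "d + (t - 1) * d \<le> (l - 1) * d"
          using mult_right_mono[of "Suc (t - 1)" "l - 1" d] t(1) by auto
        then have "(t - 1) * d + d < (l - 1) * d + j" using j by auto
        then have "nats s'' ''x'' ((l - 1) * d + j) = nats s' ''x'' ((l - 1) * d + j)" using s'' by blast
        moreover have "l \<in> {T - r<..T}" using lt l unfolding t_def by simp
        ultimately show ?thesis using 7(3) j by simp
      qed
      then show "nats s'' ''u'' 0 = w (Suc r) \<and> (\<forall>t\<in>{T - Suc r<..T}. \<forall>j\<in>{1..d}.
          nats s'' ''x'' ((t - 1) * d + j) = row (w (Suc T - t)) j)" using s'' by blast
    qed simp
  next
    case (8 s')
    let ?u = "\<lambda>t. w (Suc T - t)"
    have "?u t = nats s ''Q'' (t * N + ?u (Suc t))" if "t \<in> {1..T}" for t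
    proof -
      have "Suc T - t = Suc (T - t)" "T - (T - t) = t" using that by auto
      then show ?thesis by (simp add: wS)
    qed
    moreover have "output_schedule I s' t j = (if t \<in> {1..T} \<and> j \<in> {1..d} then row (?u t) j else 0)" for t j
      using 8(1) unfolding output_schedule_def by auto
    ultimately show ?case by (intro exI[of _ ?u]) (simp add: w0)
  qed simp_all
  \<comment> \<open>Naming the postcondition keeps the simplifier from rewriting it.\<close>
  define Post where "Post = ?Q"
  show ?thesis unfolding trace_back_def Post_def[symmetric]
    by (simp add: s1_def[symmetric]) (rule runs_weaken[OF R[folded Post_def]], simp)
qed

section \<open>The overall running time\<close>

definition time_bound :: nat where
  "time_bound = (d * (N * (26 * d + 210) + 70) + 30) + ((T * (N * (238 * d + 164) + 64) + 11) +
     (T * (26 * d + 92) + 20))"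

lemma runs_main:
  assumes X: "feasible_schedule I X" and inp: "inputs s" and \<epsilon>: "2 / real q \<le> \<epsilon>"
    and zero: "nats s ''V'' = (\<lambda>_. 0)" "reals s ''W'' = (\<lambda>_. 0)" "reals s ''cap'' = (\<lambda>_. 0)"
  shows "runs I (Seq build_table (Seq all_slots trace_back)) s time_bound
    (\<lambda>s'. feasible_schedule I (output_schedule I s') \<and>
      (\<forall>Y. feasible_schedule I Y \<longrightarrow>
        real_schedule_cost I (output_schedule I s') \<le> (1 + \<epsilon>) * real_schedule_cost I Y))"
    (is "runs I _ s _ ?Q")
  unfolding time_bound_def
proof (rule runs_Seq_agree[OF runs_build_table[OF inp zero] order_refl])
  fix s1 assume s1: "tab N s1 \<and> strides s1"
    and ag1: "agree (nat_writes build_table) (real_writes build_table) s s1"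
  have "inputs s1" by (rule inputs_agree[OF ag1 inp]) simp_all
  with s1 have ready1: "ready s1" and W: "\<And>i. i < N \<Longrightarrow> reals s1 ''W'' i = sw 0 i"
    unfolding ready_def tab_def by auto
  show "runs I (Seq all_slots trace_back) s1 ((T * (N * (238 * d + 164) + 64) + 11) + (T * (26 * d + 92) + 20)) ?Q"
  proof (rule runs_Seq_agree[OF runs_all_slots[OF ready1 W serves_top[OF X]] order_refl])
    fix s2 assume dp: "dp_tables (\<lambda>t i. reals s2 ''W'' (t * N + i)) (\<lambda>t i. nats s2 ''Q'' (t * N + i)) T"
      and ag2: "agree (nat_writes all_slots) (real_writes all_slots) s1 s2"
    have ready2: "ready s2" by (rule ready_agree[OF ag2 ready1]) simp_all
    have Q: "nats s2 ''Q'' (t * N + i) < N" if "t \<in> {1..T}" "i < N" for t i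
      using dp that unfolding dp_tables_def by blast
    show "runs I trace_back s2 (T * (26 * d + 92) + 20) ?Q"
    proof (rule runs_mono[OF runs_trace_back[OF ready2 Q] order_refl])
      fix s' :: mem
      assume "\<exists>u. u (Suc T) = 0 \<and> (\<forall>t\<in>{1..T}. u t = nats s2 ''Q'' (t * N + u (Suc t))) \<and>
        (\<forall>t j. output_schedule I s' t j = (if t \<in> {1..T} \<and> j \<in> {1..d} then row (u t) j else 0))"
      then obtain u where u: "u (Suc T) = 0" "\<And>t. t \<in> {1..T} \<Longrightarrow> u t = nats s2 ''Q'' (t * N + u (Suc t))"
        "\<And>t j. output_schedule I s' t j = (if t \<in> {1..T} \<and> j \<in> {1..d} then row (u t) j else 0)"
        by blast
      show "?Q s'"
        using trace_approximates[where u = u and X = "output_schedule I s'", OF dp u(1) _ u(3) \<epsilon>] u(2) by blast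
    qed
  qed
qed

lemma T_pos: "1 \<le> T" and d_pos: "1 \<le> d" using valid unfolding valid_instance_def by auto

lemma time_bound_le: "time_bound \<le> (26 * d * d + 550 * d + 420) * (T * N)"
proof -
  have TN: "1 \<le> T * N" "N \<le> T * N" "T \<le> T * N" using T_pos N_pos by auto
  have "d * (N * (26 * d + 210) + 70) + 30 \<le> d * (T * N * (26 * d + 210) + T * N * 70) + T * N * 30"
    using TN by (intro add_mono mult_mono) auto
  moreover have "T * (N * (238 * d + 164) + 64) + 11 \<le> T * N * (238 * d + 164) + T * N * 64 + T * N * 11"
  proof -
    have "T * (N * (238 * d + 164) + 64) = T * N * (238 * d + 164) + T * 64"
      by (simp only: distrib_left mult.assoc)
    then show ?thesis using TN by linarith
  qed
  moreover have "T * (26 * d + 92) + 20 \<le> T * N * (26 * d + 92) + T * N * 20"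
    using TN by (intro add_mono mult_mono) auto
  ultimately have "time_bound \<le> d * (T * N * (26 * d + 210) + T * N * 70) + T * N * 30 +
      (T * N * (238 * d + 164) + T * N * 64 + T * N * 11 + (T * N * (26 * d + 92) + T * N * 20))"
    unfolding time_bound_def by linarith
  also have "\<dots> = (26 * d * d + 544 * d + 381) * (T * N)" by (simp add: algebra_simps)
  also have "\<dots> \<le> (26 * d * d + 550 * d + 420) * (T * N)" by (intro mult_right_mono) auto
  finally show ?thesis .
qed

lemma N_bound: "real N \<le> (7 * real q) ^ d * (\<Prod>j=1..d. max 1 (log 2 (real (servers I j))))"
proof -
  have "real N = (\<Prod>j=1..d. real (base j))"
    by (simp add: N_def stride_def atLeastLessThanSuc_atLeastAtMost)
  also have "\<dots> \<le> (\<Prod>j=1..d. 7 * real q * max 1 (log 2 (real (servers I j))))"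
  proof (intro prod_mono conjI)
    fix j assume "j \<in> {1..d}"
    then have "1 \<le> servers I j" using valid unfolding valid_instance_def by auto
    then show "real (base j) \<le> 7 * real q * max 1 (log 2 (real (servers I j)))"
      unfolding base_def by (rule grid_top_bound[OF q_pos])
  qed simp
  also have "\<dots> = (7 * real q) ^ d * (\<Prod>j=1..d. max 1 (log 2 (real (servers I j))))"
    by (subst prod.distrib) simp
  finally show ?thesis .
qed

text \<open>The factor 21 = 7 * 3 combines \<open>N_bound\<close> with q \<le> 3 / \<epsilon>, and
  68 = 16 * 3 + 20 pays for the search of q, using that 1 / \<epsilon> is at most its d-th
  power.\<close>

lemma total_time:
  assumes \<epsilon>: "0 < \<epsilon>" "\<epsilon> < 1" "real q \<le> 3 / \<epsilon>"
  defines "B \<equiv> real T * (1 / \<epsilon>) ^ d * (\<Prod>j=1..d. max 1 (log 2 (real (servers I j))))"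
  shows "real (16 * q + 20 + time_bound) \<le> (68 + (26 * real d * real d + 550 * real d + 420) * 21 ^ d) * B"
proof -
  define L where "L = (\<Prod>j=1..d. max 1 (log 2 (real (servers I j))))"
  have L: "1 \<le> L" unfolding L_def by (intro prod_ge_1) auto
  have e1: "1 \<le> 1 / \<epsilon>" using \<epsilon> by simp
  have e: "1 / \<epsilon> \<le> (1 / \<epsilon>) ^ d" using self_le_power[OF e1] d_pos by simp
  have T: "1 \<le> real T" using T_pos by simp
  have "1 / \<epsilon> = 1 * (1 / \<epsilon>) * 1" by simp
  also have "\<dots> \<le> real T * (1 / \<epsilon>) ^ d * L"
    using T e L e1 \<epsilon> by (intro mult_mono) auto
  finally have eB: "1 / \<epsilon> \<le> B" by (simp add: B_def L_def)
  have q: "real q \<le> 3 * B" using \<epsilon>(3) eB by (simp add: field_simps)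
  have B1: "1 \<le> B" using e1 eB by linarith
  have "real N \<le> (7 * real q) ^ d * L" using N_bound by (simp add: L_def)
  also have "\<dots> \<le> (21 * (1 / \<epsilon>)) ^ d * L"
    using \<epsilon> L by (intro mult_right_mono power_mono) (auto simp: field_simps)
  finally have "real T * real N \<le> real T * ((21 * (1 / \<epsilon>)) ^ d * L)"
    by (intro mult_left_mono) auto
  also have "\<dots> = 21 ^ d * B" unfolding B_def L_def power_mult_distrib by (simp add: mult_ac)
  finally have TN: "real (T * N) \<le> 21 ^ d * B" by simp
  define K where "K = 26 * d * d + 550 * d + 420"
  have "real time_bound \<le> real (K * (T * N))"
    unfolding of_nat_le_iff K_def by (rule time_bound_le)
  also have "\<dots> \<le> real K * (21 ^ d * B)"
    unfolding of_nat_mult[of K] using TN by (intro mult_left_mono) auto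
  finally have "real time_bound \<le> real K * 21 ^ d * B" by simp
  moreover have "real (16 * q + 20 + time_bound) = 16 * real q + 20 + real time_bound" by simp
  ultimately have "real (16 * q + 20 + time_bound) \<le> 68 * B + real K * 21 ^ d * B"
    using q B1 by linarith
  also have "\<dots> = (68 + (26 * real d * real d + 550 * real d + 420) * 21 ^ d) * B"
    by (simp add: K_def algebra_simps)
  finally show ?thesis .
qed

end

text \<open>One program serves all instances, and the constant depends on d alone. The maximum with
  1 is needed because log 1 = 0 while the running time is positive. Without a feasible schedule
  there would be nothing to compute, so one is assumed to exist.\<close>

theorem theorem21:
  "\<exists>p :: com. \<forall>d :: nat. \<exists>C :: real. \<forall>(I :: dc_instance) (\<epsilon> :: real).
     valid_instance I \<and> types I = d \<and> (\<exists>X. feasible_schedule I X) \<and> 0 < \<epsilon> \<and> \<epsilon> < 1 \<longrightarrow>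
     (\<exists>n s Y. exec I p (input_mem I \<epsilon>) n s \<and>
        feasible_schedule I (output_schedule I s) \<and>
        optimal_schedule I Y \<and>
        schedule_cost I (output_schedule I s) \<le> ereal (1 + \<epsilon>) * schedule_cost I Y \<and>
        real n \<le> C * (real (slots I) * (1 / \<epsilon>) ^ d *
                     (\<Prod>j=1..d. max 1 (log 2 (real (servers I j))))))"
proof (intro exI[of _ right_sizing] allI)
  fix d :: nat
  show "\<exists>C :: real. \<forall>(I :: dc_instance) (\<epsilon> :: real).
     valid_instance I \<and> types I = d \<and> (\<exists>X. feasible_schedule I X) \<and> 0 < \<epsilon> \<and> \<epsilon> < 1 \<longrightarrow>
     (\<exists>n s Y. exec I right_sizing (input_mem I \<epsilon>) n s \<and>
        feasible_schedule I (output_schedule I s) \<and>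
        optimal_schedule I Y \<and>
        schedule_cost I (output_schedule I s) \<le> ereal (1 + \<epsilon>) * schedule_cost I Y \<and>
        real n \<le> C * (real (slots I) * (1 / \<epsilon>) ^ d *
                     (\<Prod>j=1..d. max 1 (log 2 (real (servers I j))))))"
  proof (intro exI[of _ "68 + (26 * real d * real d + 550 * real d + 420) * 21 ^ d"] allI impI)
    fix I :: dc_instance and \<epsilon> :: real
    assume "valid_instance I \<and> types I = d \<and> (\<exists>X. feasible_schedule I X) \<and> 0 < \<epsilon> \<and> \<epsilon> < 1"
    then obtain X where valid: "valid_instance I" and d: "types I = d"
      and X: "feasible_schedule I X" and \<epsilon>: "0 < \<epsilon>" "\<epsilon> < 1" by blast
    define q where "q = nat \<lceil>2 / \<epsilon>\<rceil>"
    have "2 < 2 / \<epsilon>" using \<epsilon> by (simp add: field_simps)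
    then have "2 / \<epsilon> \<le> real q" "real q \<le> 2 / \<epsilon> + 1" unfolding q_def by linarith+
    moreover have "1 \<le> 1 / \<epsilon>" using \<epsilon> by simp
    \<comment> \<open>The 1 lost by rounding up is at most 1 / \<epsilon>.\<close>
    ultimately have q: "2 / \<epsilon> \<le> real q" "real q \<le> 3 / \<epsilon>" by simp_all
    then have q1: "1 \<le> q" using \<open>2 < 2 / \<epsilon>\<close> by linarith
    have q\<epsilon>: "2 / real q \<le> \<epsilon>" using q(1) q1 \<epsilon> by (simp add: field_simps)
    interpret sizing_grid I q by unfold_locales (use valid q1 in auto)
    let ?Q = "\<lambda>s'. feasible_schedule I (output_schedule I s') \<and>
      (\<forall>Y. feasible_schedule I Y \<longrightarrow>
        real_schedule_cost I (output_schedule I s') \<le> (1 + \<epsilon>) * real_schedule_cost I Y)"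
    have "runs I right_sizing (input_mem I \<epsilon>) (16 * q + 20 + time_bound) ?Q"
      unfolding right_sizing_def
    proof (rule runs_Seq[OF _ order_refl], rule runs_find_precision[of _ \<epsilon>])
      fix s assume ag: "agree {''q''} {} (input_mem I \<epsilon>) s" and qs: "nats s ''q'' 0 = nat \<lceil>2 / \<epsilon>\<rceil>"
      have "inputs s" using qs[folded q_def]
        by (simp add: inputs_def agree_nats[OF ag] agree_reals[OF ag] input_mem_def)
      then show "runs I (Seq build_table (Seq all_slots trace_back)) s time_bound ?Q"
        by (rule runs_main[OF X _ q\<epsilon>])
          (simp_all add: agree_nats[OF ag] agree_reals[OF ag] input_mem_def)
    qed (use \<epsilon> in \<open>simp_all add: input_mem_def q_def\<close>)
    then obtain n s where n: "exec I right_sizing (input_mem I \<epsilon>) n s" "n \<le> 16 * q + 20 + time_bound"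
      and s: "?Q s" unfolding runs_def by blast
    obtain Y where Y: "optimal_schedule I Y" using optimal_schedule_exists[OF X] by blast
    then have fY: "feasible_schedule I Y" by (simp add: optimal_schedule_def)
    have "schedule_cost I (output_schedule I s) \<le> ereal (1 + \<epsilon>) * schedule_cost I Y"
      using s fY schedule_cost_real[OF valid] by simp
    moreover have "real n \<le> (68 + (26 * real d * real d + 550 * real d + 420) * 21 ^ d) *
        (real (slots I) * (1 / \<epsilon>) ^ d * (\<Prod>j=1..d. max 1 (log 2 (real (servers I j)))))"
    proof -
      have "real n \<le> real (16 * q + 20 + time_bound)" unfolding of_nat_le_iff by (rule n(2))
      also note total_time[OF \<epsilon> q(2)]
      finally show ?thesis by (simp only: d)
    qed
    ultimately show "\<exists>n s Y. exec I right_sizing (input_mem I \<epsilon>) n s \<and>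
        feasible_schedule I (output_schedule I s) \<and> optimal_schedule I Y \<and>
        schedule_cost I (output_schedule I s) \<le> ereal (1 + \<epsilon>) * schedule_cost I Y \<and>
        real n \<le> (68 + (26 * real d * real d + 550 * real d + 420) * 21 ^ d) *
          (real (slots I) * (1 / \<epsilon>) ^ d * (\<Prod>j=1..d. max 1 (log 2 (real (servers I j)))))"
      using n(1) s Y by blast
  qed
qed

end
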